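(* Let $X$ be a Hadamard manifold, $\Gamma\subset\mathrm{Is}(X)$ a non-elementary discrete group containing a (weak) rank one isometry $h$, $o\in\mathrm{Ax}(h)$, $\delta>0$, and $\mu$ a $\delta$-dimensional $\Gamma$-invariant conformal density. Then a radial limit point cannot be a point mass for $\mu$, i.e. $\mu_o(\{\eta\})=0$ for every $\eta\in L_\Gamma^{\mathrm{rad}}$.
   Context: A Hadamard manifold $X$ is a complete simply connected Riemannian manifold of non-positive sectional curvature, with distance $d$; $\partial X$ is its geometric boundary (cone topology), $\overline X=X\cup\partial X$, $\mathrm{Is}(X)$ its isometry group; geodesics have unit speed. The limit set of a discrete $\Gamma\subset\mathrm{Is}(X)$ is $L_\Gamma=\overline{\Gamma\cdot x}\cap\partial X$; $\Gamma$ is non-elementary if $L_\Gamma$ is infinite. An isometry $h\neq\mathrm{id}$ is axial if there are $l(h)>0$ and a geodesic $\sigma$ (an axis) with $h\sigma(t)=\sigma(t+l(h))$ for all $t$; $\mathrm{Ax}(h)=\{x:d(x,hx)=l(h)\}$. A geodesic is (weak) rank one if it does not bound a flat strip of infinite width (a flat half plane); an axial isometry is (weak) rank one if it has a rank one axis. Busemann function: $\mathcal{B}_\xi(x,y)=\lim_{s\to\infty}(d(x,\sigma(s))-d(y,\sigma(s)))$ for any ray $\sigma$ in the class of $\xi\in\partial X$. A $\delta$-dimensional $\Gamma$-invariant conformal density is a continuous map $x\mapsto\mu_x$ from $X$ to the cone of positive finite Borel measures on $\partial X$ such that $\mu_o$ is supported on $L_\Gamma$, $\gamma_*\mu_x=\mu_{\gamma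 x}$ for all $\gamma\in\Gamma$, $x\in X$, and $\frac{d\mu_x}{d\mu_o}(\eta)=e^{\delta\mathcal{B}_\eta(o,x)}$ for $x\in X$, $\eta\in\mathrm{supp}(\mu_o)$. Radial limit set: let $B_x(c)$ be the open ball and $\mathrm{pr}_o(B)\subset\partial X$ the set of end points $\tau(+\infty)$ of geodesics $\tau$ starting at $o$ and passing through a point of $B$. For $c>0$ put $L_\Gamma(c)=\bigcap_{R>0}\bigcup_{\gamma\in\Gamma,\,d(o,\gamma o)>R}\mathrm{pr}_o(B_{\gamma o}(c))$, and $L_\Gamma^{\mathrm{rad}}=\bigcup_{c>0}L_\Gamma(c)$; its elements are the radial limit points. *)

theory Defs
  imports "HOL-Analysis.Analysis" "HOL-Algebra.Group"
begin

section \<open>Smooth manifolds and Riemannian metrics\<close>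

text \<open>A chart is a pair of a domain \<open>U\<close> and a coordinate map \<open>\<phi>\<close>; only the values of
  \<open>\<phi>\<close> on \<open>U\<close> matter. The model space is a Euclidean space \<open>'e\<close>, whose dimension is the dimension
  of the manifold.\<close>

type_synonym ('a, 'e) chart = "'a set \<times> ('a \<Rightarrow> 'e)"

primrec times_differentiable_on ::
  "nat \<Rightarrow> ('e::euclidean_space \<Rightarrow> 'f::real_normed_vector) \<Rightarrow> 'e set \<Rightarrow> bool" where
  "times_differentiable_on 0 f S \<longleftrightarrow> continuous_on S f"
| "times_differentiable_on (Suc k) f S \<longleftrightarrow>
     (\<forall>x\<in>S. f differentiable (at x)) \<and>
     (\<forall>v. times_differentiable_on k (\<lambda>x. frechet_derivative f (at x) v) S)"

text \<open>Intended for open \<open>S\<close>.\<close>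

definition smooth_on :: "('e::euclidean_space \<Rightarrow> 'f::real_normed_vector) \<Rightarrow> 'e set \<Rightarrow> bool" where
  "smooth_on f S \<longleftrightarrow> (\<forall>k. times_differentiable_on k f S)"

definition transition_map :: "('a, 'e) chart \<Rightarrow> ('a, 'e) chart \<Rightarrow> 'e \<Rightarrow> 'e" where
  "transition_map c c' = snd c' \<circ> inv_into (fst c) (snd c)"

definition smooth_atlas :: "('a::topological_space, 'e::euclidean_space) chart set \<Rightarrow> bool" where
  "smooth_atlas A \<longleftrightarrow>
     (\<Union>c\<in>A. fst c) = UNIV \<and>
     (\<forall>(U, \<phi>)\<in>A. open U \<and> open (\<phi> ` U) \<and> homeomorphism U (\<phi> ` U) \<phi> (inv_into U \<phi>)) \<and>
     (\<forall>c\<in>A. \<forall>c'\<in>A. smooth_on (transition_map c c') (snd c ` (fst c \<inter> fst c')))"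

text \<open>A Riemannian metric is given by its coordinate expressions: \<open>g c x u v\<close> is the inner product,
  at the point with coordinates \<open>x\<close> in the chart \<open>c\<close>, of the tangent vectors with coordinates
  \<open>u\<close> and \<open>v\<close>.\<close>

definition riemannian_metric ::
  "('a, 'e::euclidean_space) chart set \<Rightarrow> (('a, 'e) chart \<Rightarrow> 'e \<Rightarrow> 'e \<Rightarrow> 'e \<Rightarrow> real) \<Rightarrow> bool" where
  "riemannian_metric A g \<longleftrightarrow>
     (\<forall>c\<in>A. (\<forall>x\<in>snd c ` fst c.
          bilinear (g c x) \<and> (\<forall>u v. g c x u v = g c x v u) \<and> (\<forall>u. u \<noteq> 0 \<longrightarrow> g c x u u > 0)) \<and>
        (\<forall>u v. smooth_on (\<lambda>x. g c x u v) (snd c ` fst c))) \<and>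
     (\<forall>c\<in>A. \<forall>c'\<in>A. \<forall>p\<in>fst c \<inter> fst c'. \<forall>u v.
        g c (snd c p) u v =
          (let T = frechet_derivative (transition_map c c') (at (snd c p))
           in g c' (snd c' p) (T u) (T v)))"

definition C1_curve_on ::
  "('a::topological_space, 'e::euclidean_space) chart set \<Rightarrow> real \<Rightarrow> real \<Rightarrow> (real \<Rightarrow> 'a) \<Rightarrow> bool" where
  "C1_curve_on A a b c \<longleftrightarrow>
     continuous_on {a..b} c \<and>
     (\<forall>(U, \<phi>)\<in>A. \<exists>D. continuous_on ({a..b} \<inter> c -` U) D \<and>
        (\<forall>t\<in>{a..b} \<inter> c -` U. ((\<phi> \<circ> c) has_vector_derivative D t) (at t within {a..b})))"

definition piecewise_C1_curve ::
  "('a::topological_space, 'e::euclidean_space) chart set \<Rightarrow> (real \<Rightarrow> 'a) \<Rightarrow> bool" where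
  "piecewise_C1_curve A c \<longleftrightarrow>
     (\<exists>S. finite S \<and> {0, 1} \<subseteq> S \<and> S \<subseteq> {0..1} \<and>
        (\<forall>a\<in>S. \<forall>b\<in>S. a < b \<and> {a<..<b} \<inter> S = {} \<longrightarrow> C1_curve_on A a b c))"

text \<open>The speed is computed in an arbitrary chart around the point; by the compatibility of the
  coordinate expressions of \<open>g\<close> it does not depend on the chart.\<close>

definition curve_speed ::
  "('a, 'e::euclidean_space) chart set \<Rightarrow> (('a, 'e) chart \<Rightarrow> 'e \<Rightarrow> 'e \<Rightarrow> 'e \<Rightarrow> real)
     \<Rightarrow> (real \<Rightarrow> 'a) \<Rightarrow> real \<Rightarrow> real" where
  "curve_speed A g c t =
     (let k = (SOME k. k \<in> A \<and> c t \<in> fst k);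
          v = vector_derivative (snd k \<circ> c) (at t)
      in sqrt (g k (snd k (c t)) v v))"

definition curve_length ::
  "('a, 'e::euclidean_space) chart set \<Rightarrow> (('a, 'e) chart \<Rightarrow> 'e \<Rightarrow> 'e \<Rightarrow> 'e \<Rightarrow> real)
     \<Rightarrow> (real \<Rightarrow> 'a) \<Rightarrow> real" where
  "curve_length A g c = integral {0..1} (curve_speed A g c)"

definition riemannian_distance ::
  "('a::topological_space, 'e::euclidean_space) chart set
     \<Rightarrow> (('a, 'e) chart \<Rightarrow> 'e \<Rightarrow> 'e \<Rightarrow> 'e \<Rightarrow> real) \<Rightarrow> 'a \<Rightarrow> 'a \<Rightarrow> real" where
  "riemannian_distance A g p q =
     (INF c \<in> {c. piecewise_C1_curve A c \<and> c 0 = p \<and> c 1 = q}. curve_length A g c)"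


section \<open>Curvature\<close>

text \<open>In the definitions below \<open>G\<close> is a Riemannian metric on an open subset of \<open>'e\<close>, and vectors
  of \<open>'e\<close> are identified with constant vector fields, whose Lie brackets vanish.
  By the Koszul formula, \<open>christoffel G x u v\<close> is the Levi-Civita derivative of \<open>v\<close> in the
  direction \<open>u\<close> at \<open>x\<close>.\<close>

definition christoffel ::
  "('e::euclidean_space \<Rightarrow> 'e \<Rightarrow> 'e \<Rightarrow> real) \<Rightarrow> 'e \<Rightarrow> 'e \<Rightarrow> 'e \<Rightarrow> 'e" where
  "christoffel G x u v = (THE z. \<forall>w.
     G x z w = (frechet_derivative (\<lambda>y. G y v w) (at x) u
              + frechet_derivative (\<lambda>y. G y u w) (at x) v
              - frechet_derivative (\<lambda>y. G y u v) (at x) w) / 2)"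

text \<open>Sign convention: \<open>R(u,v)w\<close> is the second covariant derivative of \<open>w\<close> first along \<open>v\<close>, then
  along \<open>u\<close>, minus the same with \<open>u\<close> and \<open>v\<close> exchanged; round spheres have positive sectional
  curvature.\<close>

definition riemann_curvature ::
  "('e::euclidean_space \<Rightarrow> 'e \<Rightarrow> 'e \<Rightarrow> real) \<Rightarrow> 'e \<Rightarrow> 'e \<Rightarrow> 'e \<Rightarrow> 'e \<Rightarrow> 'e" where
  "riemann_curvature G x u v w =
     frechet_derivative (\<lambda>y. christoffel G y v w) (at x) u
   - frechet_derivative (\<lambda>y. christoffel G y u w) (at x) v
   + christoffel G x u (christoffel G x v w)
   - christoffel G x v (christoffel G x u w)"

definition sectional_curvature ::
  "('e::euclidean_space \<Rightarrow> 'e \<Rightarrow> 'e \<Rightarrow> real) \<Rightarrow> 'e \<Rightarrow> 'e \<Rightarrow> 'e \<Rightarrow> real" where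
  "sectional_curvature G x u v =
     G x (riemann_curvature G x u v v) u / (G x u u * G x v v - (G x u v)\<^sup>2)"


section \<open>Hadamard manifolds\<close>

text \<open>The manifold is the whole type \<open>'a\<close>, and the Riemannian distance is the distance of its
  metric space structure. Connectedness is part of \<open>simply_connected\<close>; second
  countability follows from connectedness, as \<open>'a\<close> is metrizable and locally Euclidean.\<close>

definition hadamard_manifold ::
  "('a::metric_space, 'e::euclidean_space) chart set
     \<Rightarrow> (('a, 'e) chart \<Rightarrow> 'e \<Rightarrow> 'e \<Rightarrow> 'e \<Rightarrow> real) \<Rightarrow> bool" where
  "hadamard_manifold A g \<longleftrightarrow>
     smooth_atlas A \<and> riemannian_metric A g \<and>
     (\<forall>p q. dist p q = riemannian_distance A g p q) \<and>
     complete (UNIV :: 'a set) \<and>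
     simply_connected (UNIV :: 'a set) \<and>
     (\<forall>c\<in>A. \<forall>x\<in>snd c ` fst c. \<forall>u v. u \<noteq> v \<and> independent {u, v} \<longrightarrow>
        sectional_curvature (g c) x u v \<le> 0)"


section \<open>Isometries\<close>

definition isometries :: "('a::metric_space \<Rightarrow> 'a) set" where
  "isometries = {f. bij f \<and> (\<forall>x y. dist (f x) (f y) = dist x y)}"

definition isometry_group :: "('a::metric_space \<Rightarrow> 'a) monoid" where
  "isometry_group = \<lparr>carrier = isometries, mult = (\<circ>), one = id\<rparr>"

definition compact_open_topology :: "('a::metric_space \<Rightarrow> 'a) topology" where
  "compact_open_topology =
     topology_generated_by {{f \<in> isometries. f ` K \<subseteq> U} | K U. compact K \<and> open U}"

definition discrete_isometry_group :: "('a::metric_space \<Rightarrow> 'a) set \<Rightarrow> bool" where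
  "discrete_isometry_group \<Gamma> \<longleftrightarrow>
     subgroup \<Gamma> isometry_group \<and> subtopology compact_open_topology \<Gamma> = discrete_topology \<Gamma>"


section \<open>Geodesics and rank one isometries\<close>

text \<open>In a Hadamard manifold the geodesics are exactly the distance minimizing ones, so
  unit speed geodesics are the isometric embeddings of intervals. The values of a ray on negative
  parameters are irrelevant.\<close>

definition geodesic_line :: "(real \<Rightarrow> 'a::metric_space) \<Rightarrow> bool" where
  "geodesic_line \<sigma> \<longleftrightarrow> (\<forall>s t. dist (\<sigma> s) (\<sigma> t) = \<bar>s - t\<bar>)"

definition geodesic_ray :: "(real \<Rightarrow> 'a::metric_space) \<Rightarrow> bool" where
  "geodesic_ray \<sigma> \<longleftrightarrow> (\<forall>s\<ge>0. \<forall>t\<ge>0. dist (\<sigma> s) (\<sigma> t) = \<bar>s - t\<bar>)"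

definition geodesic_segment :: "(real \<Rightarrow> 'a::metric_space) \<Rightarrow> 'a \<Rightarrow> 'a \<Rightarrow> bool" where
  "geodesic_segment \<tau> x y \<longleftrightarrow> \<tau> 0 = x \<and> \<tau> (dist x y) = y \<and>
     (\<forall>s\<in>{0..dist x y}. \<forall>t\<in>{0..dist x y}. dist (\<tau> s) (\<tau> t) = \<bar>s - t\<bar>)"

text \<open>The distance of \<open>real \<times> real\<close> is the Euclidean one.\<close>

definition bounds_flat_half_plane :: "(real \<Rightarrow> 'a::metric_space) \<Rightarrow> bool" where
  "bounds_flat_half_plane \<sigma> \<longleftrightarrow>
     (\<exists>F :: real \<times> real \<Rightarrow> 'a.
        (\<forall>p\<in>UNIV \<times> {0..}. \<forall>q\<in>UNIV \<times> {0..}. dist (F p) (F q) = dist p q) \<and>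
        (\<forall>t. F (t, 0) = \<sigma> t))"

definition rank_one_geodesic :: "(real \<Rightarrow> 'a::metric_space) \<Rightarrow> bool" where
  "rank_one_geodesic \<sigma> \<longleftrightarrow> geodesic_line \<sigma> \<and> \<not> bounds_flat_half_plane \<sigma>"

definition translates_axis ::
  "('a::metric_space \<Rightarrow> 'a) \<Rightarrow> real \<Rightarrow> (real \<Rightarrow> 'a) \<Rightarrow> bool" where
  "translates_axis h l \<sigma> \<longleftrightarrow> l > 0 \<and> geodesic_line \<sigma> \<and> (\<forall>t. h (\<sigma> t) = \<sigma> (t + l))"

definition axial :: "('a::metric_space \<Rightarrow> 'a) \<Rightarrow> bool" where
  "axial h \<longleftrightarrow> h \<in> isometries \<and> h \<noteq> id \<and> (\<exists>l \<sigma>. translates_axis h l \<sigma>)"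

definition rank_one_isometry :: "('a::metric_space \<Rightarrow> 'a) \<Rightarrow> bool" where
  "rank_one_isometry h \<longleftrightarrow>
     axial h \<and> (\<exists>l \<sigma>. translates_axis h l \<sigma> \<and> rank_one_geodesic \<sigma>)"

text \<open>All axes of an axial isometry are translated by the same amount.\<close>

definition translation_length :: "('a::metric_space \<Rightarrow> 'a) \<Rightarrow> real" where
  "translation_length h = (THE l. \<exists>\<sigma>. translates_axis h l \<sigma>)"

definition axial_set :: "('a::metric_space \<Rightarrow> 'a) \<Rightarrow> 'a set" where
  "axial_set h = {x. dist x (h x) = translation_length h}"


section \<open>The geometric boundary\<close>

definition asymptotic :: "((real \<Rightarrow> 'a::metric_space) \<times> (real \<Rightarrow> 'a)) set" where
  "asymptotic = {(\<sigma>, \<tau>). geodesic_ray \<sigma> \<and> geodesic_ray \<tau> \<and>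
     (\<exists>K. \<forall>t\<ge>0. dist (\<sigma> t) (\<tau> t) \<le> K)}"

type_synonym 'a ideal_point = "(real \<Rightarrow> 'a) set"

definition geometric_boundary :: "'a::metric_space ideal_point set" where
  "geometric_boundary = Collect geodesic_ray // asymptotic"

definition ray_endpoint :: "(real \<Rightarrow> 'a::metric_space) \<Rightarrow> 'a ideal_point" where
  "ray_endpoint \<sigma> = asymptotic `` {\<sigma>}"

definition boundary_action :: "('a \<Rightarrow> 'a) \<Rightarrow> 'a ideal_point \<Rightarrow> 'a ideal_point" where
  "boundary_action \<gamma> \<xi> = (\<lambda>\<sigma>. \<gamma> \<circ> \<sigma>) ` \<xi>"

text \<open>Points of the compactification are \<open>Inl x\<close> with \<open>x\<close> in the manifold and \<open>Inr \<xi>\<close> with \<open>\<xi>\<close> in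
  the boundary. The truncated cone consists of the points outside the closed ball of radius
  \<open>R\<close> around \<open>\<sigma> 0\<close> whose connecting geodesic from \<open>\<sigma> 0\<close> passes \<open>\<epsilon>\<close>-close to \<open>\<sigma> R\<close> at time \<open>R\<close>.\<close>

definition truncated_cone ::
  "(real \<Rightarrow> 'a::metric_space) \<Rightarrow> real \<Rightarrow> real \<Rightarrow> ('a + 'a ideal_point) set" where
  "truncated_cone \<sigma> R \<epsilon> =
     Inl ` {z. dist (\<sigma> 0) z > R \<and>
               (\<exists>\<tau>. geodesic_segment \<tau> (\<sigma> 0) z \<and> dist (\<tau> R) (\<sigma> R) < \<epsilon>)} \<union>
     Inr ` {\<xi> \<in> geometric_boundary. \<exists>\<tau>\<in>\<xi>. \<tau> 0 = \<sigma> 0 \<and> dist (\<tau> R) (\<sigma> R) < \<epsilon>}"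

definition cone_topology :: "('a::metric_space + 'a ideal_point) topology" where
  "cone_topology = topology_generated_by
     ({Inl ` U | U. open U} \<union>
      {truncated_cone \<sigma> R \<epsilon> | \<sigma> R \<epsilon>. geodesic_ray \<sigma> \<and> R > 0 \<and> \<epsilon> > 0})"

definition boundary_topology :: "'a::metric_space ideal_point topology" where
  "boundary_topology = pullback_topology geometric_boundary Inr cone_topology"

definition boundary_borel :: "'a::metric_space ideal_point measure" where
  "boundary_borel = sigma geometric_boundary {U. openin boundary_topology U}"


section \<open>Limit sets\<close>

text \<open>The limit set does not depend on the point \<open>x\<close>.\<close>

definition limit_set :: "('a::metric_space \<Rightarrow> 'a) set \<Rightarrow> 'a \<Rightarrow> 'a ideal_point set" where
  "limit_set \<Gamma> x =
     {\<xi> \<in> geometric_boundary. Inr \<xi> \<in> cone_topology closure_of (Inl ` (\<lambda>\<gamma>. \<gamma> x) ` \<Gamma>)}"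

definition non_elementary :: "('a::metric_space \<Rightarrow> 'a) set \<Rightarrow> 'a \<Rightarrow> bool" where
  "non_elementary \<Gamma> x \<longleftrightarrow> infinite (limit_set \<Gamma> x)"

definition shadow :: "'a::metric_space \<Rightarrow> 'a set \<Rightarrow> 'a ideal_point set" where
  "shadow x B = {ray_endpoint \<tau> | \<tau>. geodesic_ray \<tau> \<and> \<tau> 0 = x \<and> (\<exists>t\<ge>0. \<tau> t \<in> B)}"

definition radial_limit_set_within ::
  "('a::metric_space \<Rightarrow> 'a) set \<Rightarrow> 'a \<Rightarrow> real \<Rightarrow> 'a ideal_point set" where
  "radial_limit_set_within \<Gamma> x c =
     (\<Inter>R\<in>{0<..}. \<Union>\<gamma>\<in>{\<gamma> \<in> \<Gamma>. dist x (\<gamma> x) > R}. shadow x (ball (\<gamma> x) c))"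

definition radial_limit_set ::
  "('a::metric_space \<Rightarrow> 'a) set \<Rightarrow> 'a \<Rightarrow> 'a ideal_point set" where
  "radial_limit_set \<Gamma> x = (\<Union>c\<in>{0<..}. radial_limit_set_within \<Gamma> x c)"


section \<open>Busemann functions and conformal densities\<close>

text \<open>In a Hadamard manifold the limit does not depend on the ray chosen in the class \<open>\<xi>\<close>.\<close>

definition busemann :: "'a::metric_space ideal_point \<Rightarrow> 'a \<Rightarrow> 'a \<Rightarrow> real" where
  "busemann \<xi> x y =
     (let \<sigma> = (SOME \<sigma>. \<sigma> \<in> \<xi>) in Lim at_top (\<lambda>s. dist x (\<sigma> s) - dist y (\<sigma> s)))"

definition boundary_support ::
  "'a::metric_space ideal_point measure \<Rightarrow> 'a ideal_point set" where
  "boundary_support M =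
     {\<eta> \<in> geometric_boundary. \<forall>U. openin boundary_topology U \<and> \<eta> \<in> U \<longrightarrow> emeasure M U > 0}"

text \<open>Continuity is with respect to the weak topology on measures. The Radon-Nikodym derivative is
  only determined up to null sets of \<open>\<mu> x0\<close>, hence the quantifier \<open>AE\<close>.\<close>

definition conformal_density ::
  "('a::metric_space \<Rightarrow> 'a) set \<Rightarrow> 'a \<Rightarrow> real \<Rightarrow> ('a \<Rightarrow> 'a ideal_point measure) \<Rightarrow> bool" where
  "conformal_density \<Gamma> x0 \<delta> \<mu> \<longleftrightarrow>
     (\<forall>x. sets (\<mu> x) = sets boundary_borel \<and> finite_measure (\<mu> x)) \<and>
     (\<forall>f. continuous_map boundary_topology euclideanreal f \<and> bounded (f ` geometric_boundary) \<longrightarrow>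
        continuous_on UNIV (\<lambda>x. \<integral>\<eta>. f \<eta> \<partial>\<mu> x)) \<and>
     boundary_support (\<mu> x0) \<subseteq> limit_set \<Gamma> x0 \<and>
     (\<forall>\<gamma>\<in>\<Gamma>. \<forall>x. distr (\<mu> x) boundary_borel (boundary_action \<gamma>) = \<mu> (\<gamma> x)) \<and>
     (\<forall>x. absolutely_continuous (\<mu> x0) (\<mu> x) \<and>
        (AE \<eta> in \<mu> x0. \<eta> \<in> boundary_support (\<mu> x0) \<longrightarrow>
           RN_deriv (\<mu> x0) (\<mu> x) \<eta> = ennreal (exp (\<delta> * busemann \<eta> x0 x))))"

end

theory Submission
  imports Defs
begin

text \<open>
The theorem compares two values of the mass that the measure \<open>\<mu> (\<gamma> x0)\<close> gives to an atom \<open>\<eta>\<close>. This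
measure is the image of \<open>\<mu> x0\<close> under an isometry, so the mass is at most the total mass of \<open>\<mu> x0\<close>. On the
other hand, conformality makes it \<open>exp (\<delta> * busemann \<eta> x0 (\<gamma> x0))\<close> times the mass of \<open>\<eta>\<close> for
\<open>\<mu> x0\<close>. If \<open>\<gamma> x0\<close> is within \<open>c\<close> of a ray from \<open>x0\<close> to \<open>\<eta>\<close>, then \<open>busemann \<eta> x0 (\<gamma> x0)\<close> is at
least \<open>dist x0 (\<gamma> x0)\<close> up to an additive constant. For a radial limit point there are such \<open>\<gamma>\<close> with
\<open>dist x0 (\<gamma> x0)\<close> as large as desired, which is a contradiction.

The additive constant must not depend on \<open>\<gamma>\<close>. It involves the bound for the distance between the ray
that passes near \<open>\<gamma> x0\<close> and the ray by which the Busemann function is computed, and the former ray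
changes with \<open>\<gamma>\<close>. What saves the argument is that in a Hadamard manifold only one ray leads from \<open>x0\<close>
to \<open>\<eta>\<close> (\<open>hadamard_asymptotic_rays_coincide\<close>). Here completeness, simple connectivity and nonpositive
curvature enter, and most of the text is devoted to this statement. As the distance is an infimum
of lengths and the curvature an expression in Christoffel symbols, it starts from local Riemannian
geometry.

Locally, geodesics are solutions of a boundary value problem in a chart, found as fixed points of a
contraction. For two nearby geodesics \<open>a\<close> and \<open>b\<close> the difference \<open>b - a\<close> is almost a Jacobi field, and nonpositive
curvature makes its norm convex up to an error that is small compared to the gap at the ends
(\<open>Jacobi_convexity\<close>). Interpolating between two arbitrary short geodesics by many, one can make the sum of
these errors as small as desired (\<open>convexity\<close>). It follows that in small balls the midpoints of two pairs
of points are no further apart than the mean of the distances of corresponding points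
(\<open>locally_Busemann_convex\<close>). From here on only the metric space is used: it is simply connected, its closed balls
are compact (\<open>Hopf_Rinow\<close>), its points are joined by curves not much longer than their distance, and
midpoints are locally convex.

Globally, let two rays \<open>a\<close> and \<open>b\<close> start at the same point and stay within distance \<open>K\<close>. Join \<open>a T\<close> to \<open>b T\<close>
by a curve of length at most \<open>K + 1\<close> and fill the triangle by a continuous family of curves from the
common origin. Sample the family by a fine grid and replace, again and again, the interior points of each row
by the midpoints of their neighbours. By local convexity, the gaps between consecutive rows obey a discrete
heat inequality and sink to the linear interpolation between \<open>0\<close> at the origin and their value at the
far end, while the two extreme rows are geodesics and stay (\<open>midpoint_flow_contraction\<close>). Thus the
distance between \<open>a t\<close> and \<open>b t\<close> is at most \<open>(K + 1) * t / T\<close>, and \<open>T\<close> is arbitrary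
(\<open>bounded_rays_coincide\<close>).
\<close>

section \<open>Continuously differentiable maps and fields of bilinear maps\<close>

abbreviation C1_on :: "('e::euclidean_space \<Rightarrow> 'f::real_normed_vector) \<Rightarrow> 'e set \<Rightarrow> bool" where
  "C1_on f S \<equiv> times_differentiable_on (Suc 0) f S"

abbreviation partial_derivative ::
  "('e::euclidean_space \<Rightarrow> 'b \<Rightarrow> 'c \<Rightarrow> 'f::real_normed_vector) \<Rightarrow> 'e \<Rightarrow> 'e \<Rightarrow> 'b \<Rightarrow> 'c \<Rightarrow> 'f" where
  "partial_derivative F x h u v \<equiv> frechet_derivative (\<lambda>y. F y u v) (at x) h"

lemma C1_on_has_derivative:
  assumes "C1_on f S" "x \<in> S"
  shows "(f has_derivative frechet_derivative f (at x)) (at x)"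
  using assms by (auto simp: frechet_derivative_works)

lemma C1_on_continuous: "C1_on f S \<Longrightarrow> continuous_on S f"
  by (meson C1_on_has_derivative continuous_at_imp_continuous_on has_derivative_continuous)

lemma C1_on_continuous_derivative:
  "C1_on f S \<Longrightarrow> continuous_on S (\<lambda>x. frechet_derivative f (at x) h)"
  by simp

lemma C1_onI:
  assumes "\<And>x. x \<in> S \<Longrightarrow> (f has_derivative f' x) (at x)" "\<And>h. continuous_on S (\<lambda>x. f' x h)"
  shows "C1_on f S"
proof -
  have "frechet_derivative f (at x) = f' x" if "x \<in> S" for x
    using frechet_derivative_at[OF assms(1)[OF that]] by simp
  moreover from this have "continuous_on S (\<lambda>x. frechet_derivative f (at x) h)" for h
    using assms(2)[of h] by (simp cong: continuous_on_cong)
  ultimately show ?thesis using assms(1) by (auto simp: differentiable_def)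
qed

lemma linear_expand:
  fixes f :: "'e::euclidean_space \<Rightarrow> 'f::real_vector"
  assumes "linear f" shows "f v = (\<Sum>b\<in>Basis. (v \<bullet> b) *\<^sub>R f b)"
proof -
  have "f v = f (\<Sum>b\<in>Basis. (v \<bullet> b) *\<^sub>R b)" by (simp add: euclidean_representation)
  also have "\<dots> = (\<Sum>b\<in>Basis. (v \<bullet> b) *\<^sub>R f b)"
    by (simp add: linear_sum[OF assms] linear_scale[OF assms])
  finally show ?thesis .
qed

text \<open>The derivative in each basis direction is uniformly continuous on \<open>K\<close>; expanding in the basis, so is
the derivative in all directions at once, and the mean value inequality on segments, which stay
in the convex set \<open>K\<close>, gives the estimate.\<close>

lemma C1_uniform_linearization:
  fixes f :: "'e::euclidean_space \<Rightarrow> 'f::real_normed_vector"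
  assumes f: "C1_on f \<Omega>" and K: "compact K" "convex K" "K \<subseteq> \<Omega>" and e: "0 < e"
  shows "\<exists>r>0. \<forall>x\<in>K. \<forall>y\<in>K. norm (y - x) < r \<longrightarrow>
           norm (f y - f x - frechet_derivative f (at x) (y - x)) \<le> e * norm (y - x)"
proof -
  let ?D = "\<lambda>x. frechet_derivative f (at x)"
  have lin: "linear (?D x)" if "x \<in> K" for x
    using C1_on_has_derivative[OF f, of x] K that has_derivative_linear by blast
  define e' where "e' = e / (real DIM('e) + 1)"
  have e': "e' > 0" using e by (simp add: e'_def)
  have "\<exists>r>0. \<forall>x\<in>K. \<forall>y\<in>K. norm (y - x) < r \<longrightarrow> norm (?D y b - ?D x b) < e'" for b
  proof -
    have "uniformly_continuous_on K (\<lambda>x. ?D x b)"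
      using f K by (intro compact_uniformly_continuous) (auto intro: continuous_on_subset)
    then show ?thesis
      using e' unfolding uniformly_continuous_on_def dist_norm by blast
  qed
  then obtain r where r: "\<And>b. r b > 0"
      "\<And>b x y. x \<in> K \<Longrightarrow> y \<in> K \<Longrightarrow> norm (y - x) < r b \<Longrightarrow> norm (?D y b - ?D x b) < e'" by metis
  define r0 where "r0 = Min (r ` Basis)"
  have r0: "r0 > 0" "\<And>b. b \<in> Basis \<Longrightarrow> r0 \<le> r b" using r(1) by (auto simp: r0_def)
  have D: "norm (?D y v - ?D x v) \<le> e * norm v"
    if "x \<in> K" "y \<in> K" "norm (y - x) < r0" for x y v
  proof -
    have ex: "?D z v = (\<Sum>b\<in>Basis. (v \<bullet> b) *\<^sub>R ?D z b)" if "z \<in> K" for z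
      using linear_expand[OF lin[OF that]] .
    have "?D y v - ?D x v = (\<Sum>b\<in>Basis. (v \<bullet> b) *\<^sub>R (?D y b - ?D x b))"
      by (simp add: ex[OF that(1)] ex[OF that(2)] sum_subtractf scaleR_diff_right)
    also have "norm \<dots> \<le> (\<Sum>b\<in>(Basis::'e set). norm v * e')"
    proof (rule sum_norm_le)
      fix b :: 'e assume b: "b \<in> Basis"
      have "norm (?D y b - ?D x b) \<le> e'"
        using r(2)[OF that(1,2), of b] that(3) r0(2)[OF b] by linarith
      then show "norm ((v \<bullet> b) *\<^sub>R (?D y b - ?D x b)) \<le> norm v * e'"
        unfolding norm_scaleR using Basis_le_norm[OF b, of v] by (intro mult_mono) auto
    qed
    also have "\<dots> \<le> e * norm v"
      using e by (simp add: e'_def field_simps mult_left_mono)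
    finally show ?thesis .
  qed
  show ?thesis
  proof (intro exI[of _ r0] conjI ballI impI r0)
    fix x y assume xy: "x \<in> K" "y \<in> K" "norm (y - x) < r0"
    have seg: "x + t *\<^sub>R (y - x) \<in> K" if "t \<in> {0..1}" for t
      using K(2) xy that convexD_alt[of K x y t] by (simp add: algebra_simps)
    have dd: "(f has_derivative ?D z) (at z within K \<inter> ball x r0)" if "z \<in> K \<inter> ball x r0" for z
      using C1_on_has_derivative[OF f, of z] K that by (auto intro: has_derivative_at_withinI)
    have "norm (f y - f x - ?D x (y - x)) \<le> norm (y - x) * e"
    proof (rule differentiable_bound_linearization[where S = "K \<inter> ball x r0" and f' = ?D])
      show "x + t *\<^sub>R (y - x) \<in> K \<inter> ball x r0" if t: "t \<in> {0..1}" for t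
      proof -
        have "norm (t *\<^sub>R (y - x)) \<le> norm (y - x)" using t by (simp add: mult_left_le_one_le)
        then show ?thesis using seg[OF t] xy by (simp add: dist_norm)
      qed
      show "onorm (?D z - ?D x) \<le> e" if "z \<in> K \<inter> ball x r0" for z
        using D[OF xy(1), of z] that e
        by (intro onorm_bound) (auto simp: dist_norm norm_minus_commute fun_diff_def)
    qed (use dd xy r0 in auto)
    then show "norm (f y - f x - ?D x (y - x)) \<le> e * norm (y - x)" by (simp add: mult.commute)
  qed
qed

lemma C1_Lipschitz:
  fixes f :: "'e::euclidean_space \<Rightarrow> 'f::real_normed_vector"
  assumes f: "C1_on f \<Omega>" and K: "compact K" "convex K" "K \<subseteq> \<Omega>"
  shows "\<exists>C\<ge>0. \<forall>x\<in>K. norm (f x) \<le> C \<and> (\<forall>h. norm (frechet_derivative f (at x) h) \<le> C * norm h) \<and>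
           (\<forall>y\<in>K. norm (f y - f x) \<le> C * norm (y - x))"
proof -
  let ?D = "\<lambda>x. frechet_derivative f (at x)"
  have lin: "linear (?D x)" if "x \<in> K" for x
    using C1_on_has_derivative[OF f, of x] K that has_derivative_linear by blast
  have "\<exists>C. \<forall>x\<in>K. norm (?D x b) \<le> C" for b
  proof -
    have "compact ((\<lambda>x. ?D x b) ` K)"
      using f K by (intro compact_continuous_image) (auto intro: continuous_on_subset)
    then have "bounded ((\<lambda>x. ?D x b) ` K)" by (rule compact_imp_bounded)
    then show ?thesis unfolding bounded_iff by auto
  qed
  then obtain c where c: "\<And>b x. x \<in> K \<Longrightarrow> norm (?D x b) \<le> c b" by metis
  define C where "C = (\<Sum>b\<in>Basis. \<bar>c b\<bar>)"
  have D: "norm (?D x v) \<le> C * norm v" if "x \<in> K" for x v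
  proof -
    have "?D x v = (\<Sum>b\<in>Basis. (v \<bullet> b) *\<^sub>R ?D x b)"
      using linear_expand[OF lin[OF that]] .
    also have "norm \<dots> \<le> (\<Sum>b\<in>(Basis::'e set). norm v * \<bar>c b\<bar>)"
    proof (rule sum_norm_le)
      fix b :: 'e assume b: "b \<in> Basis"
      have "norm (?D x b) \<le> \<bar>c b\<bar>" using c[OF that, of b] by linarith
      then show "norm ((v \<bullet> b) *\<^sub>R ?D x b) \<le> norm v * \<bar>c b\<bar>"
        unfolding norm_scaleR using Basis_le_norm[OF b, of v] by (intro mult_mono) auto
    qed
    finally show ?thesis by (simp add: C_def sum_distrib_left mult.commute)
  qed
  have L: "norm (f y - f x) \<le> C * norm (y - x)" if "x \<in> K" "y \<in> K" for x y
  proof (rule differentiable_bound[OF K(2), where f' = ?D])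
    show "(f has_derivative ?D z) (at z within K)" if "z \<in> K" for z
      using C1_on_has_derivative[OF f, of z] K that by (auto intro: has_derivative_at_withinI)
    show "onorm (?D z) \<le> C" if "z \<in> K" for z
      using D[OF that] by (intro onorm_bound) (auto simp: C_def sum_nonneg)
  qed (use that in auto)
  have "compact (f ` K)"
    using C1_on_continuous[OF f] K by (intro compact_continuous_image) (auto intro: continuous_on_subset)
  then have "bounded (f ` K)" by (rule compact_imp_bounded)
  then obtain B where B: "\<And>x. x \<in> K \<Longrightarrow> norm (f x) \<le> B"
    unfolding bounded_iff by auto
  have C0: "C \<ge> 0" by (simp add: C_def sum_nonneg)
  show ?thesis
  proof (rule exI[of _ "C + \<bar>B\<bar>"], intro conjI ballI allI)
    show "0 \<le> C + \<bar>B\<bar>" using C0 by simp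
    show "norm (f x) \<le> C + \<bar>B\<bar>" if "x \<in> K" for x using B[OF that] C0 by linarith
    show "norm (?D x h) \<le> (C + \<bar>B\<bar>) * norm h" if "x \<in> K" for x h
      using D[OF that, of h] by (simp add: distrib_right add_increasing2)
    show "norm (f y - f x) \<le> (C + \<bar>B\<bar>) * norm (y - x)" if "x \<in> K" "y \<in> K" for x y
      using L[OF that] by (simp add: distrib_right add_increasing2)
  qed
qed

text \<open>Metrics and Christoffel symbols are both fields of this kind. Bilinearity reduces every estimate to
the finitely many functions \<open>\<lambda>x. F x i j\<close> with basis vectors \<open>i\<close> and \<open>j\<close>, so that bounds on compact sets
are uniform in the vectors.\<close>

locale C1_bilinear_field =
  fixes F :: "'e::euclidean_space \<Rightarrow> 'e \<Rightarrow> 'e \<Rightarrow> 'f::real_normed_vector" and \<Omega> :: "'e set"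
  assumes bilinear: "x \<in> \<Omega> \<Longrightarrow> bilinear (F x)"
    and C1: "C1_on (\<lambda>x. F x u v) \<Omega>"
    and open_domain: "open \<Omega>"
begin

lemma has_derivative:
  "x \<in> \<Omega> \<Longrightarrow> ((\<lambda>y. F y u v) has_derivative (\<lambda>h. partial_derivative F x h u v)) (at x)"
  using C1_on_has_derivative[OF C1] .

lemma expand: "x \<in> \<Omega> \<Longrightarrow> F x u v = (\<Sum>i\<in>Basis. \<Sum>j\<in>Basis. ((u \<bullet> i) * (v \<bullet> j)) *\<^sub>R F x i j)"
proof -
  assume x: "x \<in> \<Omega>"
  have "F x u v = F x (\<Sum>i\<in>Basis. (u \<bullet> i) *\<^sub>R i) (\<Sum>j\<in>Basis. (v \<bullet> j) *\<^sub>R j)"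
    by (simp add: euclidean_representation)
  also have "\<dots> = (\<Sum>(i,j)\<in>Basis\<times>Basis. F x ((u \<bullet> i) *\<^sub>R i) ((v \<bullet> j) *\<^sub>R j))"
    using bilinear_sum[OF bilinear[OF x], of "\<lambda>i. (u \<bullet> i) *\<^sub>R i" Basis "\<lambda>j. (v \<bullet> j) *\<^sub>R j" Basis] by simp
  also have "\<dots> = (\<Sum>(i,j)\<in>Basis\<times>Basis. ((u \<bullet> i) * (v \<bullet> j)) *\<^sub>R F x i j)"
    using bilinear[OF x] by (simp add: bilinear_lmul bilinear_rmul mult.commute)
  finally show ?thesis by (simp add: sum.cartesian_product)
qed

lemma expand_derivative:
  assumes x: "x \<in> \<Omega>"
  shows "partial_derivative F x h u v =
    (\<Sum>i\<in>Basis. \<Sum>j\<in>Basis. ((u \<bullet> i) * (v \<bullet> j)) *\<^sub>R partial_derivative F x h i j)"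
proof -
  have "((\<lambda>y. \<Sum>i\<in>Basis. \<Sum>j\<in>Basis. ((u \<bullet> i) * (v \<bullet> j)) *\<^sub>R F y i j) has_derivative
     (\<lambda>h. \<Sum>i\<in>Basis. \<Sum>j\<in>Basis. ((u \<bullet> i) * (v \<bullet> j)) *\<^sub>R partial_derivative F x h i j)) (at x)"
    by (intro has_derivative_sum has_derivative_scaleR_right has_derivative x)
  then have "((\<lambda>y. F y u v) has_derivative
     (\<lambda>h. \<Sum>i\<in>Basis. \<Sum>j\<in>Basis. ((u \<bullet> i) * (v \<bullet> j)) *\<^sub>R partial_derivative F x h i j)) (at x)"
    by (rule has_derivative_transform_within_open[OF _ open_domain x]) (simp add: expand[symmetric])
  from has_derivative_unique[OF has_derivative[OF x] this] show ?thesis by meson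
qed

lemma bilinear_derivative:
  assumes x: "x \<in> \<Omega>" shows "bilinear (partial_derivative F x h)"
proof -
  let ?P = "partial_derivative F x h"
  note ex = expand_derivative[OF x]
  have "?P (a + b) v = ?P a v + ?P b v" "?P u (a + b) = ?P u a + ?P u b"
    "?P (c *\<^sub>R u) v = c *\<^sub>R ?P u v" "?P u (c *\<^sub>R v) = c *\<^sub>R ?P u v" for a b u v c
    unfolding ex[of "a + b" v h] ex[of a v h] ex[of b v h] ex[of u "a + b" h] ex[of u a h] ex[of u b h]
      ex[of "c *\<^sub>R u" v h] ex[of u "c *\<^sub>R v" h] ex[of u v h]
    by (simp_all add: inner_add_left distrib_left distrib_right
       scaleR_add_left sum.distrib scaleR_sum_right mult_ac)
  then show ?thesis unfolding bilinear_def by (auto intro!: linearI)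
qed

lemma linear_derivative: "x \<in> \<Omega> \<Longrightarrow> linear (\<lambda>h. partial_derivative F x h u v)"
  using has_derivative has_derivative_linear by blast

lemma norm_expand_le:
  assumes "\<And>i j. i \<in> Basis \<Longrightarrow> j \<in> Basis \<Longrightarrow> norm (E i j) \<le> c"
  shows "norm (\<Sum>i\<in>Basis. \<Sum>j\<in>Basis. ((u \<bullet> i) * (v \<bullet> j)) *\<^sub>R E i j :: 'f)
    \<le> (real DIM('e))\<^sup>2 * c * norm (u::'e) * norm (v::'e)"
proof -
  have "norm (\<Sum>i\<in>Basis. \<Sum>j\<in>Basis. ((u \<bullet> i) * (v \<bullet> j)) *\<^sub>R E i j)
      \<le> (\<Sum>i\<in>(Basis::'e set). \<Sum>j\<in>(Basis::'e set). norm u * norm v * c)"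
  proof (intro sum_norm_le)
    fix i j :: 'e assume ij: "i \<in> Basis" "j \<in> Basis"
    have "\<bar>u \<bullet> i\<bar> * \<bar>v \<bullet> j\<bar> * norm (E i j) \<le> norm u * norm v * c"
      using ij assms[OF ij] by (intro mult_mono Basis_le_norm mult_nonneg_nonneg) auto
    then show "norm (((u \<bullet> i) * (v \<bullet> j)) *\<^sub>R E i j) \<le> norm u * norm v * c"
      by (simp add: abs_mult)
  qed
  then show ?thesis by (simp add: power2_eq_square mult_ac)
qed

lemma uniform_linearization:
  assumes K: "compact K" "convex K" "K \<subseteq> \<Omega>" and e: "0 < e"
  shows "\<exists>r>0. \<forall>x\<in>K. \<forall>y\<in>K. norm (y - x) < r \<longrightarrow> (\<forall>u v.
           norm (F y u v - F x u v - partial_derivative F x (y - x) u v)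
             \<le> e * norm (y - x) * norm u * norm v)"
proof -
  define e' where "e' = e / (real DIM('e))\<^sup>2"
  have e': "e' > 0" "(real DIM('e))\<^sup>2 * e' = e" using e by (auto simp: e'_def)
  have "\<exists>r>0. \<forall>x\<in>K. \<forall>y\<in>K. norm (y - x) < r \<longrightarrow>
           norm (F y u v - F x u v - partial_derivative F x (y - x) u v) \<le> e' * norm (y - x)" for u v
    by (rule C1_uniform_linearization[OF C1 K e'(1)])
  then obtain r where r: "\<And>u v. r u v > 0" "\<And>u v x y. x \<in> K \<Longrightarrow> y \<in> K \<Longrightarrow> norm (y - x) < r u v \<Longrightarrow>
           norm (F y u v - F x u v - partial_derivative F x (y - x) u v) \<le> e' * norm (y - x)" by metis
  define r0 where "r0 = Min ((\<lambda>(i,j). r i j) ` (Basis \<times> Basis))"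
  have r0: "r0 > 0" using r(1) by (auto simp: r0_def)
  have r0': "r0 \<le> r i j" if "i \<in> Basis" "j \<in> Basis" for i j
    unfolding r0_def using that by (intro Min_le) (auto intro!: image_eqI[of _ _ "(i,j)"])
  show ?thesis
  proof (intro exI[of _ r0] conjI ballI impI allI r0)
    fix x y u v assume xy: "x \<in> K" "y \<in> K" "norm (y - x) < r0"
    have x: "x \<in> \<Omega>" "y \<in> \<Omega>" using xy K by auto
    have "norm (F y u v - F x u v - partial_derivative F x (y - x) u v)
       = norm (\<Sum>i\<in>Basis. \<Sum>j\<in>Basis. ((u \<bullet> i) * (v \<bullet> j)) *\<^sub>R
                 (F y i j - F x i j - partial_derivative F x (y - x) i j))"
      by (simp add: expand[OF x(1), of u v] expand[OF x(2), of u v] expand_derivative[OF x(1), of u v "y - x"]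
          scaleR_diff_right sum_subtractf)
    also have "\<dots> \<le> (real DIM('e))\<^sup>2 * (e' * norm (y - x)) * norm u * norm v"
      using xy r0' by (intro norm_expand_le r(2)) (auto intro: order.strict_trans2)
    also have "\<dots> = e * norm (y - x) * norm u * norm v" using e'(2) by (simp add: mult.assoc[symmetric])
    finally show "norm (F y u v - F x u v - partial_derivative F x (y - x) u v)
             \<le> e * norm (y - x) * norm u * norm v" .
  qed
qed

lemma uniform_bound:
  assumes K: "compact K" "convex K" "K \<subseteq> \<Omega>"
  shows "\<exists>C\<ge>0. \<forall>x\<in>K. \<forall>u v. norm (F x u v) \<le> C * norm u * norm v \<and>
           (\<forall>h. norm (partial_derivative F x h u v) \<le> C * norm h * norm u * norm v) \<and>
           (\<forall>y\<in>K. norm (F y u v - F x u v) \<le> C * norm (y - x) * norm u * norm v)"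
proof -
  have "\<exists>C\<ge>0. \<forall>x\<in>K. norm (F x u v) \<le> C \<and> (\<forall>h. norm (partial_derivative F x h u v) \<le> C * norm h) \<and>
           (\<forall>y\<in>K. norm (F y u v - F x u v) \<le> C * norm (y - x))" for u v
    by (rule C1_Lipschitz[OF C1 K])
  then obtain c where c: "\<And>u v. c u v \<ge> 0" "\<And>x u v. x \<in> K \<Longrightarrow> norm (F x u v) \<le> c u v"
      "\<And>x u v h. x \<in> K \<Longrightarrow> norm (partial_derivative F x h u v) \<le> c u v * norm h"
      "\<And>x y u v. x \<in> K \<Longrightarrow> y \<in> K \<Longrightarrow> norm (F y u v - F x u v) \<le> c u v * norm (y - x)"
    by metis
  define C where "C = Max ((\<lambda>(i,j). c i j) ` (Basis \<times> Basis))"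
  have C': "c i j \<le> C" if "i \<in> Basis" "j \<in> Basis" for i j
    unfolding C_def using that by (intro Max_ge) (auto intro!: image_eqI[of _ _ "(i,j)"])
  have C0: "C \<ge> 0" using C' c(1) nonempty_Basis by (meson all_not_in_conv order_trans)
  let ?D = "(real DIM('e))\<^sup>2"
  show ?thesis
  proof (intro exI[of _ "?D * C"] conjI ballI allI)
    show "0 \<le> ?D * C" using C0 by simp
    fix x u v assume x: "x \<in> K"
    then have xO: "x \<in> \<Omega>" using K by auto
    show "norm (F x u v) \<le> ?D * C * norm u * norm v"
      unfolding expand[OF xO, of u v] using c(2)[OF x] C' by (intro norm_expand_le) (meson order_trans)
    show "norm (partial_derivative F x h u v) \<le> ?D * C * norm h * norm u * norm v" for h
    proof -
      have "norm (partial_derivative F x h u v) \<le> ?D * (C * norm h) * norm u * norm v"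
        unfolding expand_derivative[OF xO, of u v h] using c(3)[OF x] C'
        by (intro norm_expand_le) (meson mult_right_mono norm_ge_zero order_trans)
      then show ?thesis by (simp add: mult.assoc)
    qed
    fix y assume y: "y \<in> K"
    then have yO: "y \<in> \<Omega>" using K by auto
    have "norm (F y u v - F x u v) = norm (\<Sum>i\<in>Basis. \<Sum>j\<in>Basis. ((u \<bullet> i) * (v \<bullet> j)) *\<^sub>R
                 (F y i j - F x i j))"
      by (simp add: expand[OF xO, of u v] expand[OF yO, of u v] scaleR_diff_right sum_subtractf)
    also have "\<dots> \<le> ?D * (C * norm (y - x)) * norm u * norm v"
        using c(4)[OF x y] C'
        by (intro norm_expand_le) (meson mult_right_mono norm_ge_zero order_trans)
    finally show "norm (F y u v - F x u v) \<le> ?D * C * norm (y - x) * norm u * norm v"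
      by (simp add: mult.assoc)
  qed
qed

lemma derivative_simps:
  assumes x: "x \<in> \<Omega>"
  shows "partial_derivative F x h (a + b) v = partial_derivative F x h a v + partial_derivative F x h b v"
    "partial_derivative F x h v (a + b) = partial_derivative F x h v a + partial_derivative F x h v b"
    "partial_derivative F x h (c *\<^sub>R a) v = c *\<^sub>R partial_derivative F x h a v"
    "partial_derivative F x h v (c *\<^sub>R a) = c *\<^sub>R partial_derivative F x h v a"
    "partial_derivative F x h 0 v = 0" "partial_derivative F x h v 0 = 0"
    "partial_derivative F x (a + b) u v = partial_derivative F x a u v + partial_derivative F x b u v"
    "partial_derivative F x (c *\<^sub>R a) u v = c *\<^sub>R partial_derivative F x a u v"
    "partial_derivative F x 0 u v = 0"
  using bilinear_ladd[OF bilinear_derivative[OF x, of h]] bilinear_radd[OF bilinear_derivative[OF x, of h]]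
    bilinear_lmul[OF bilinear_derivative[OF x, of h]] bilinear_rmul[OF bilinear_derivative[OF x, of h]]
    bilinear_lzero[OF bilinear_derivative[OF x, of h]] bilinear_rzero[OF bilinear_derivative[OF x, of h]]
    linear_add[OF linear_derivative[OF x, of u v]] linear_scale[OF linear_derivative[OF x, of u v]]
    linear_0[OF linear_derivative[OF x, of u v]]
  by blast+

end

section \<open>Christoffel symbols and the sign of the curvature\<close>

locale coordinate_metric =
  fixes G :: "'e::euclidean_space \<Rightarrow> 'e \<Rightarrow> 'e \<Rightarrow> real" and \<Omega> :: "'e set"
  assumes bilinear_G: "x \<in> \<Omega> \<Longrightarrow> bilinear (G x)"
    and sym: "x \<in> \<Omega> \<Longrightarrow> G x u v = G x v u"
    and pos: "x \<in> \<Omega> \<Longrightarrow> u \<noteq> 0 \<Longrightarrow> G x u u > 0"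
    and smooth: "smooth_on (\<lambda>x. G x u v) \<Omega>"
    and open_\<Omega>: "open \<Omega>"
begin

lemma C1_G: "C1_on (\<lambda>x. G x u v) \<Omega>"
  using smooth unfolding smooth_on_def by blast

lemma C1_DG: "C1_on (\<lambda>x. partial_derivative G x h u v) \<Omega>"
proof -
  have "times_differentiable_on (Suc (Suc 0)) (\<lambda>x. G x u v) \<Omega>"
    using smooth unfolding smooth_on_def by blast
  then show ?thesis by (metis times_differentiable_on.simps(2))
qed

end

sublocale coordinate_metric \<subseteq> G: C1_bilinear_field G \<Omega>
  by unfold_locales (auto simp: bilinear_G open_\<Omega> simp del: times_differentiable_on.simps intro: C1_G)

context coordinate_metric
begin

lemma lin1: "x \<in> \<Omega> \<Longrightarrow> linear (\<lambda>u. G x u v)" and lin2: "x \<in> \<Omega> \<Longrightarrow> linear (G x u)"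
  using bilinear_G unfolding bilinear_def by blast+

lemma G_simps:
  assumes "x \<in> \<Omega>"
  shows "G x (a + b) v = G x a v + G x b v" "G x v (a + b) = G x v a + G x v b"
    "G x (a - b) v = G x a v - G x b v" "G x v (a - b) = G x v a - G x v b"
    "G x (c *\<^sub>R a) v = c * G x a v" "G x v (c *\<^sub>R a) = c * G x v a"
    "G x 0 v = 0" "G x v 0 = 0" "G x (- a) v = - G x a v" "G x v (- a) = - G x v a"
  using bilinear_G[OF assms]
  by (simp_all add: bilinear_ladd bilinear_radd bilinear_lsub bilinear_rsub bilinear_lmul bilinear_rmul
      bilinear_lzero bilinear_rzero bilinear_lneg bilinear_rneg)

lemma nonneg: "x \<in> \<Omega> \<Longrightarrow> 0 \<le> G x u u"
  using pos[of x u] G_simps(7)[of x u] by (cases "u = 0") auto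

lemma continuous_G:
  assumes "continuous_on S f" "continuous_on S a" "continuous_on S b" "f ` S \<subseteq> \<Omega>"
  shows "continuous_on S (\<lambda>t. G (f t) (a t) (b t))"
proof -
  have "continuous_on S (\<lambda>t. \<Sum>i\<in>Basis. \<Sum>j\<in>Basis. ((a t \<bullet> i) * (b t \<bullet> j)) *\<^sub>R G (f t) i j)"
    by (intro continuous_intros assms continuous_on_compose2[OF C1_on_continuous[OF C1_G] assms(1) assms(4)])
  moreover have "(\<Sum>i\<in>Basis. \<Sum>j\<in>Basis. ((a t \<bullet> i) * (b t \<bullet> j)) *\<^sub>R G (f t) i j) = G (f t) (a t) (b t)"
    if "t \<in> S" for t
    using assms(4) that by (intro G.expand[symmetric]) auto
  ultimately show ?thesis by (simp cong: continuous_on_cong)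
qed

text \<open>The minimum of \<open>G\<close> over the product of \<open>K\<close> and the unit sphere is positive.\<close>

lemma uniformly_positive:
  assumes K: "compact K" "K \<subseteq> \<Omega>"
  shows "\<exists>l>0. \<forall>x\<in>K. \<forall>v. l * (norm v)\<^sup>2 \<le> G x v v"
proof (cases "K = {}")
  case False
  have cont: "continuous_on (K \<times> sphere 0 1) (\<lambda>p. G (fst p) (snd p) (snd p))"
    using K by (intro continuous_G continuous_intros) auto
  have "compact (K \<times> sphere (0::'e) 1)" using K by (intro compact_Times) auto
  moreover have "K \<times> sphere (0::'e) 1 \<noteq> {}" using False by simp
  ultimately obtain p where p: "p \<in> K \<times> sphere 0 1"
      "\<And>q. q \<in> K \<times> sphere 0 1 \<Longrightarrow> G (fst p) (snd p) (snd p) \<le> G (fst q) (snd q) (snd q)"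
    using continuous_attains_inf[OF _ _ cont] by blast
  let ?l = "G (fst p) (snd p) (snd p)"
  have "fst p \<in> \<Omega>" "snd p \<noteq> 0" using p(1) K by auto
  then have "?l > 0" by (rule pos)
  moreover have "?l * (norm v)\<^sup>2 \<le> G x v v" if "x \<in> K" for x v
  proof (cases "v = 0")
    case False
    have "?l \<le> G x ((1 / norm v) *\<^sub>R v) ((1 / norm v) *\<^sub>R v)"
      using p(2)[of "(x, (1 / norm v) *\<^sub>R v)"] that False by auto
    also have "\<dots> = G x v v / (norm v)\<^sup>2"
      using G_simps[of x] that K by (auto simp: power2_eq_square)
    finally show ?thesis using False by (simp add: field_simps)
  qed (use that K nonneg in auto)
  ultimately show ?thesis by blast
qed (auto intro: exI[of _ 1])

text \<open>The Riesz representation: a definite form is injective as a map to the dual space, hence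
bijective by counting dimensions.\<close>

lemma ex1_solution:
  assumes x: "x \<in> \<Omega>"
  shows "\<exists>!z. \<forall>b\<in>Basis. G x z b = k b"
proof -
  let ?f = "\<lambda>z. \<Sum>b\<in>Basis. G x z b *\<^sub>R b"
  have lin: "linear ?f"
    by (intro linearI) (simp_all add: G_simps[OF x] sum.distrib scaleR_add_left scaleR_sum_right)
  have comp: "?f z \<bullet> b = G x z b" if "b \<in> Basis" for z b
    using that by (simp add: inner_sum_left_Basis)
  have zero: "z = 0" if "\<forall>b\<in>Basis. G x z b = 0" for z
  proof (rule ccontr)
    assume "z \<noteq> 0"
    have "G x z z = (\<Sum>b\<in>Basis. (z \<bullet> b) *\<^sub>R G x z b)" by (rule linear_expand[OF lin2[OF x]])
    then show False using that pos[OF x \<open>z \<noteq> 0\<close>] by simp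
  qed
  have "inj ?f"
    unfolding linear_injective_0[OF lin]
  proof (intro allI impI zero ballI)
    fix z b assume "?f z = 0" "b \<in> (Basis::'e set)"
    then show "G x z b = 0" using comp[of b z] by simp
  qed
  then have sj: "surj ?f" using lin linear_injective_imp_surjective by blast
  obtain z where z: "(\<Sum>b\<in>Basis. k b *\<^sub>R b) = ?f z"
    using surjD[OF sj, of "\<Sum>b\<in>Basis. k b *\<^sub>R b"] by blast
  show ?thesis
  proof (rule ex1I[of _ z])
    show "\<forall>b\<in>Basis. G x z b = k b"
    proof
      fix b :: 'e assume b: "b \<in> Basis"
      have "G x z b = (\<Sum>b\<in>Basis. k b *\<^sub>R b) \<bullet> b" using comp[OF b, of z] z by simp
      then show "G x z b = k b" using b by (simp add: inner_sum_left_Basis)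
    qed
    fix y assume "\<forall>b\<in>Basis. G x y b = k b"
    then have "y - z = 0" using \<open>\<forall>b\<in>Basis. G x z b = k b\<close> by (intro zero) (simp add: G_simps[OF x])
    then show "y = z" by simp
  qed
qed

lemma solution_unique:
  assumes "x \<in> \<Omega>" "\<And>b. b \<in> Basis \<Longrightarrow> G x y b = G x z b" shows "y = z"
  using ex1_solution[OF assms(1), of "\<lambda>b. G x z b"] assms(2) by metis

text \<open>A vector \<open>y\<close> that almost satisfies the equations is close to the solution, by definiteness applied to
the difference. This stability is the reason why the solution is as regular in \<open>x\<close> as the data.\<close>

lemma solution_estimate:
  assumes x: "x \<in> \<Omega>" and l: "l > 0" "\<And>v. l * (norm v)\<^sup>2 \<le> G x v v"
    and z: "\<And>b. b \<in> Basis \<Longrightarrow> G x z b = k b"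
  shows "norm (z - y) \<le> (\<Sum>b\<in>Basis. \<bar>k b - G x y b\<bar>) / l"
proof (cases "z = y")
  case False
  let ?d = "z - y"
  have "l * (norm ?d)\<^sup>2 \<le> G x ?d ?d" by (rule l)
  also have "\<dots> = (\<Sum>b\<in>Basis. (?d \<bullet> b) *\<^sub>R G x ?d b)" by (rule linear_expand[OF lin2[OF x]])
  also have "\<dots> \<le> (\<Sum>b\<in>Basis. norm ?d * \<bar>k b - G x y b\<bar>)"
  proof (rule sum_mono)
    fix b :: 'e assume b: "b \<in> Basis"
    have "(?d \<bullet> b) *\<^sub>R G x ?d b \<le> \<bar>?d \<bullet> b\<bar> * \<bar>k b - G x y b\<bar>"
      using z[OF b] by (simp add: G_simps[OF x] abs_mult[symmetric])
    also have "\<dots> \<le> norm ?d * \<bar>k b - G x y b\<bar>"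
      using Basis_le_norm[OF b] by (rule mult_right_mono) simp
    finally show "(?d \<bullet> b) *\<^sub>R G x ?d b \<le> norm ?d * \<bar>k b - G x y b\<bar>" .
  qed
  finally have "norm ?d * (l * norm ?d) \<le> norm ?d * (\<Sum>b\<in>Basis. \<bar>k b - G x y b\<bar>)"
    by (simp add: sum_distrib_left power2_eq_square mult_ac)
  then have "l * norm ?d \<le> (\<Sum>b\<in>Basis. \<bar>k b - G x y b\<bar>)" using False by simp
  then show ?thesis using l(1) by (simp add: field_simps)
qed (use l in \<open>auto intro: divide_nonneg_pos sum_nonneg\<close>)

lemma solution_local_estimate:
  assumes x0: "x0 \<in> \<Omega>" and z: "\<And>x b. x \<in> \<Omega> \<Longrightarrow> b \<in> Basis \<Longrightarrow> G x (z x) b = k x b"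
  shows "\<exists>l>0. \<exists>r>0. ball x0 r \<subseteq> \<Omega> \<and> (\<forall>x\<in>ball x0 r. \<forall>y. norm (z x - y) \<le> (\<Sum>b\<in>Basis. \<bar>k x b - G x y b\<bar>) / l)"
proof -
  obtain r where r: "r > 0" "cball x0 r \<subseteq> \<Omega>" using open_\<Omega> x0 open_contains_cball by blast
  obtain l where l: "l > 0" "\<And>x v. x \<in> cball x0 r \<Longrightarrow> l * (norm v)\<^sup>2 \<le> G x v v"
    using uniformly_positive[OF compact_cball r(2)] by blast
  have "norm (z x - y) \<le> (\<Sum>b\<in>Basis. \<bar>k x b - G x y b\<bar>) / l" if "x \<in> ball x0 r" for x y
  proof -
    have xO: "x \<in> \<Omega>" "x \<in> cball x0 r" using that r(2) by auto
    show ?thesis by (rule solution_estimate[OF xO(1) l(1) l(2)[OF xO(2)] z[OF xO(1)]])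
  qed
  then show ?thesis using l(1) r ball_subset_cball by (intro exI[of _ l] exI[of _ r] conjI) (auto intro: less_imp_le)
qed

lemma solution_continuous:
  assumes z: "\<And>x b. x \<in> \<Omega> \<Longrightarrow> b \<in> Basis \<Longrightarrow> G x (z x) b = k x b"
    and k: "\<And>b. b \<in> Basis \<Longrightarrow> continuous_on \<Omega> (\<lambda>x. k x b)"
  shows "continuous_on \<Omega> z"
proof (rule continuous_at_imp_continuous_on, rule ballI)
  fix x0 assume x0: "x0 \<in> \<Omega>"
  obtain l r where lr: "l > 0" "r > 0"
    "\<And>x y. x \<in> ball x0 r \<Longrightarrow> norm (z x - y) \<le> (\<Sum>b\<in>Basis. \<bar>k x b - G x y b\<bar>) / l"
    using solution_local_estimate[OF x0 z] by blast
  have k': "((\<lambda>x. k x b) \<longlongrightarrow> k x0 b) (at x0)" if "b \<in> Basis" for b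
    using k[OF that] x0 open_\<Omega> by (simp add: continuous_on_eq_continuous_at isCont_def)
  have G': "((\<lambda>x. G x (z x0) b) \<longlongrightarrow> G x0 (z x0) b) (at x0)" for b
    using C1_on_continuous[OF C1_G] x0 open_\<Omega> by (simp add: continuous_on_eq_continuous_at isCont_def)
  have "((\<lambda>x. (\<Sum>b\<in>Basis. \<bar>k x b - G x (z x0) b\<bar>) / l) \<longlongrightarrow>
      (\<Sum>b\<in>Basis. \<bar>k x0 b - G x0 (z x0) b\<bar>) / l) (at x0)"
    using lr(1) by (intro tendsto_intros k' G') auto
  then have lim: "((\<lambda>x. (\<Sum>b\<in>Basis. \<bar>k x b - G x (z x0) b\<bar>) / l) \<longlongrightarrow> 0) (at x0)"
    by (simp add: z[OF x0])
  have "((\<lambda>x. z x - z x0) \<longlongrightarrow> 0) (at x0)"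
    using lr by (intro Lim_null_comparison[OF _ lim] eventually_at_in_open'[THEN eventually_mono, of "ball x0 r"]) auto
  then show "isCont z x0" unfolding isCont_def by (simp add: LIM_zero_iff)
qed

text \<open>Differentiating the equation for \<open>z\<close> leads to a linear equation of the same kind for the derivative
of \<open>z\<close>. Its solution \<open>z'\<close> is continuous, and it is the derivative because the affine
approximation that it defines satisfies the equation for \<open>z\<close> up to a residual of smaller order.\<close>

lemma solution_C1:
  assumes z: "\<And>x b. x \<in> \<Omega> \<Longrightarrow> b \<in> Basis \<Longrightarrow> G x (z x) b = k x b"
    and k: "\<And>b. b \<in> Basis \<Longrightarrow> C1_on (\<lambda>x. k x b) \<Omega>"
  shows "C1_on z \<Omega>"
proof -
  define Dk where "Dk x h b = frechet_derivative (\<lambda>y. k y b) (at x) h" for x h b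
  define z' where "z' x h = (THE y. \<forall>b\<in>Basis. G x y b = Dk x h b - partial_derivative G x h (z x) b)" for x h
  have z': "G x (z' x h) b = Dk x h b - partial_derivative G x h (z x) b"
    if "x \<in> \<Omega>" "b \<in> Basis" for x h b
    using theI'[OF ex1_solution[OF that(1)], of "\<lambda>b. Dk x h b - partial_derivative G x h (z x) b"] that(2)
    unfolding z'_def by blast
  have Dk: "((\<lambda>y. k y b) has_derivative (\<lambda>h. Dk x h b)) (at x)" if "x \<in> \<Omega>" "b \<in> Basis" for x b
    unfolding Dk_def by (rule C1_on_has_derivative[OF k[OF that(2)] that(1)])
  have contz: "continuous_on \<Omega> z"
    by (rule solution_continuous[where k = k, OF z]) (use C1_on_continuous[OF k] in auto)
  have lin: "linear (z' x)" if x: "x \<in> \<Omega>" for x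
  proof -
    have l1: "linear (\<lambda>h. Dk x h b - partial_derivative G x h (z x) b)" if "b \<in> Basis" for b
      using has_derivative_linear[OF Dk[OF x that]] G.linear_derivative[OF x] by (rule linear_compose_sub)
    show ?thesis
    proof (intro linearI; rule solution_unique[OF x])
      show "G x (z' x (a + c)) b = G x (z' x a + z' x c) b" if "b \<in> Basis" for a b c
        using linear_add[OF l1[OF that]] by (simp add: G_simps[OF x] z'[OF x that])
      show "G x (z' x (r *\<^sub>R a)) b = G x (r *\<^sub>R z' x a) b" if "b \<in> Basis" for a b r
        using linear_scale[OF l1[OF that]] by (simp add: G_simps[OF x] z'[OF x that])
    qed
  qed
  have der: "(z has_derivative z' x0) (at x0)" if x0: "x0 \<in> \<Omega>" for x0
  proof -
    obtain l r where lr: "l > 0" "r > 0" "ball x0 r \<subseteq> \<Omega>"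
      "\<And>x y. x \<in> ball x0 r \<Longrightarrow> norm (z x - y) \<le> (\<Sum>b\<in>Basis. \<bar>k x b - G x y b\<bar>) / l"
      using solution_local_estimate[OF x0 z] by blast
    have bl: "bounded_linear (z' x0)" using lin[OF x0] linear_conv_bounded_linear by blast
    \<comment> \<open>The residual of the affine approximation in the equation for \<open>z\<close>. Expanding its last term in
         a basis makes it a sum of products, which can be differentiated.\<close>
    define \<phi> where "\<phi> b x = k x b - G x (z x0) b - (\<Sum>c\<in>Basis. (z' x0 (x - x0) \<bullet> c) * G x c b)" for b x
    have z'0: "z' x0 0 = 0" using lin[OF x0] linear_0 by blast
    have d\<phi>: "(\<phi> b has_derivative (\<lambda>h. 0)) (at x0)" if b: "b \<in> Basis" for b
    proof -
      have "(\<phi> b has_derivative (\<lambda>h. Dk x0 h b - partial_derivative G x0 h (z x0) b -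
          (\<Sum>c\<in>Basis. (z' x0 (x0 - x0) \<bullet> c) * partial_derivative G x0 h c b + (z' x0 (h - 0) \<bullet> c) * G x0 c b))) (at x0)"
        unfolding \<phi>_def
        by (intro has_derivative_diff has_derivative_sum has_derivative_mult Dk G.has_derivative x0 b
            has_derivative_inner_left bounded_linear.has_derivative[OF bl] has_derivative_ident has_derivative_const)
      moreover have "G x0 (z' x0 h) b = (\<Sum>c\<in>Basis. (z' x0 h \<bullet> c) *\<^sub>R G x0 c b)" for h
        by (rule linear_expand[OF lin1[OF x0]])
      ultimately show ?thesis using z'[OF x0 b] by (simp add: z'0)
    qed
    have \<phi>0: "\<phi> b x0 = 0" if "b \<in> Basis" for b using z[OF x0 that] by (simp add: \<phi>_def z'0)
    have lim: "((\<lambda>x. (\<Sum>b\<in>Basis. norm (\<phi> b x) / norm (x - x0)) / l) \<longlongrightarrow> (\<Sum>b\<in>(Basis::'e set). 0) / l) (at x0)"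
      using d\<phi> \<phi>0 lr(1) by (intro tendsto_intros) (auto simp: has_derivative_iff_norm)
    have le: "norm (norm (z x - z x0 - z' x0 (x - x0)) / norm (x - x0)) \<le> (\<Sum>b\<in>Basis. norm (\<phi> b x) / norm (x - x0)) / l"
      if x: "x \<in> ball x0 r" for x
    proof -
      have xO: "x \<in> \<Omega>" using x lr by auto
      have "G x (z' x0 (x - x0)) b = (\<Sum>c\<in>Basis. (z' x0 (x - x0) \<bullet> c) *\<^sub>R G x c b)" for b
        by (rule linear_expand[OF lin1[OF xO]])
      then have \<phi>: "\<phi> b x = k x b - G x (z x0 + z' x0 (x - x0)) b" for b
        by (simp add: \<phi>_def G_simps[OF xO])
      have "norm (z x - z x0 - z' x0 (x - x0)) \<le> (\<Sum>b\<in>Basis. norm (\<phi> b x)) / l"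
        using lr(4)[OF x, of "z x0 + z' x0 (x - x0)"] by (simp add: \<phi> diff_diff_eq)
      then have "norm (z x - z x0 - z' x0 (x - x0)) / norm (x - x0) \<le> (\<Sum>b\<in>Basis. norm (\<phi> b x)) / l / norm (x - x0)"
        by (rule divide_right_mono) simp
      then show ?thesis by (simp add: sum_divide_distrib[symmetric] mult.commute)
    qed
    have "((\<lambda>x. norm (z x - z x0 - z' x0 (x - x0)) / norm (x - x0)) \<longlongrightarrow> 0) (at x0)"
    proof (rule Lim_null_comparison)
      show "((\<lambda>x. (\<Sum>b\<in>Basis. norm (\<phi> b x) / norm (x - x0)) / l) \<longlongrightarrow> 0) (at x0)" using lim by simp
      show "\<forall>\<^sub>F x in at x0. norm (norm (z x - z x0 - z' x0 (x - x0)) / norm (x - x0))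
              \<le> (\<Sum>b\<in>Basis. norm (\<phi> b x) / norm (x - x0)) / l"
        by (rule eventually_at_in_open'[THEN eventually_mono, of "ball x0 r"]) (use le lr in auto)
    qed
    then show ?thesis unfolding has_derivative_iff_norm using bl by simp
  qed
  show ?thesis
  proof (rule C1_onI[of _ z z'])
    fix h
    show "continuous_on \<Omega> (\<lambda>x. z' x h)"
    proof (rule solution_continuous)
      show "G x (z' x h) b = Dk x h b - partial_derivative G x h (z x) b" if "x \<in> \<Omega>" "b \<in> Basis" for x b
        using z' that .
      fix b :: 'e assume b: "b \<in> Basis"
      have "continuous_on \<Omega> (\<lambda>x. \<Sum>i\<in>Basis. \<Sum>j\<in>Basis. ((z x \<bullet> i) * (b \<bullet> j)) *\<^sub>R partial_derivative G x h i j)"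
        by (intro continuous_intros contz C1_on_continuous[OF C1_DG])
      then have "continuous_on \<Omega> (\<lambda>x. partial_derivative G x h (z x) b)"
        by (rule continuous_on_eq) (rule G.expand_derivative[symmetric])
      moreover have "continuous_on \<Omega> (\<lambda>x. Dk x h b)"
        using k[OF b] unfolding Dk_def by simp
      ultimately show "continuous_on \<Omega> (\<lambda>x. Dk x h b - partial_derivative G x h (z x) b)"
        by (intro continuous_intros)
    qed
  qed (rule der)
qed

abbreviation "\<Gamma> \<equiv> christoffel G"

text \<open>The Koszul formula, in the form in which the definite description that defines the symbols is
justified.\<close>

lemma christoffel:
  assumes x: "x \<in> \<Omega>"
  shows "G x (\<Gamma> x u v) w = (partial_derivative G x u v w + partial_derivative G x v u w - partial_derivative G x w u v) / 2"
proof -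
  define k where "k w = (partial_derivative G x u v w + partial_derivative G x v u w - partial_derivative G x w u v) / 2" for w
  have link: "linear k"
    unfolding k_def by (intro linearI) (simp_all add: G.derivative_simps[OF x] field_simps)
  obtain z where z: "\<forall>b\<in>Basis. G x z b = k b" using ex1_solution[OF x] by blast
  have all: "G x z w = k w" if z: "\<forall>b\<in>Basis. G x z b = k b" for z w
    using linear_expand[OF lin2[OF x], of z w] linear_expand[OF link, of w] z by (simp cong: sum.cong)
  have "(THE z. \<forall>w. G x z w = k w) = z"
    by (rule the_equality) (use all z solution_unique[OF x] in auto)
  then have "\<Gamma> x u v = z" by (simp add: christoffel_def k_def)
  then show ?thesis using all[OF z] by (simp add: k_def)
qed

lemma DG_sym: "x \<in> \<Omega> \<Longrightarrow> partial_derivative G x h u v = partial_derivative G x h v u"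
proof -
  assume x: "x \<in> \<Omega>"
  have "((\<lambda>y. G y v u) has_derivative (\<lambda>h. partial_derivative G x h v u)) (at x)" by (rule G.has_derivative[OF x])
  then have "((\<lambda>y. G y u v) has_derivative (\<lambda>h. partial_derivative G x h v u)) (at x)"
    by (rule has_derivative_transform_within_open[OF _ open_\<Omega> x]) (simp add: sym)
  from has_derivative_unique[OF G.has_derivative[OF x] this] show ?thesis by meson
qed

text \<open>In the sum of the two Koszul formulas only the derivative of \<open>G\<close> along \<open>h\<close> survives.\<close>

lemma metric_compatible:
  assumes x: "x \<in> \<Omega>"
  shows "partial_derivative G x h u v = G x (\<Gamma> x h u) v + G x u (\<Gamma> x h v)"
  using DG_sym[OF x]
  by (subst sym[OF x, of u]) (simp add: christoffel[OF x] field_simps)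

lemma christoffel_sym:
  assumes x: "x \<in> \<Omega>" shows "\<Gamma> x u v = \<Gamma> x v u"
proof (rule solution_unique[OF x])
  fix b
  have "partial_derivative G x b u v = partial_derivative G x b v u" by (rule DG_sym[OF x])
  then show "G x (\<Gamma> x u v) b = G x (\<Gamma> x v u) b" unfolding christoffel[OF x] by (simp add: add.commute)
qed

lemma bilinear_christoffel:
  assumes x: "x \<in> \<Omega>" shows "bilinear (\<Gamma> x)"
proof -
  have 1: "\<Gamma> x (a + b) v = \<Gamma> x a v + \<Gamma> x b v" "\<Gamma> x (c *\<^sub>R a) v = c *\<^sub>R \<Gamma> x a v" for a b c v
    by (intro solution_unique[OF x];
        simp add: G_simps[OF x] christoffel[OF x] G.derivative_simps[OF x] field_simps)+
  moreover have "\<Gamma> x v (a + b) = \<Gamma> x v a + \<Gamma> x v b" "\<Gamma> x v (c *\<^sub>R a) = c *\<^sub>R \<Gamma> x v a" for a b c v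
    by (simp_all add: christoffel_sym[OF x, of v] 1)
  ultimately show ?thesis unfolding bilinear_def by (auto intro!: linearI)
qed

text \<open>The data of the Koszul formula are first derivatives of a smooth metric. One derivative of the
symbols is what the curvature and the linearized geodesic equation require.\<close>

lemma C1_christoffel: "C1_on (\<lambda>x. \<Gamma> x u v) \<Omega>"
proof (rule solution_C1)
  let ?k = "\<lambda>x b. (partial_derivative G x u v b + partial_derivative G x v u b - partial_derivative G x b u v) / 2"
  show "G x (\<Gamma> x u v) b = ?k x b" if "x \<in> \<Omega>" for x b by (rule christoffel[OF that])
  show "C1_on (\<lambda>x. ?k x b) \<Omega>" for b
  proof (rule C1_onI)
    note d = C1_on_has_derivative[OF C1_DG]
    show "((\<lambda>x. ?k x b) has_derivative (\<lambda>h. (frechet_derivative (\<lambda>x. partial_derivative G x u v b) (at x) h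
       + frechet_derivative (\<lambda>x. partial_derivative G x v u b) (at x) h
       - frechet_derivative (\<lambda>x. partial_derivative G x b u v) (at x) h) / 2)) (at x)" if "x \<in> \<Omega>" for x
      by (intro bounded_linear.has_derivative[OF bounded_linear_divide] has_derivative_diff has_derivative_add d that)
    show "continuous_on \<Omega> (\<lambda>x. (frechet_derivative (\<lambda>x. partial_derivative G x u v b) (at x) h
       + frechet_derivative (\<lambda>x. partial_derivative G x v u b) (at x) h
       - frechet_derivative (\<lambda>x. partial_derivative G x b u v) (at x) h) / 2)" for h
      by (intro continuous_intros C1_on_continuous_derivative[OF C1_DG]) simp
  qed
qed

end

sublocale coordinate_metric \<subseteq> Ch: C1_bilinear_field "christoffel G" \<Omega>
  by unfold_locales (auto simp: bilinear_christoffel open_\<Omega> simp del: times_differentiable_on.simps intro: C1_christoffel)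

context coordinate_metric
begin

lemma Ch_simps:
  assumes "x \<in> \<Omega>"
  shows "\<Gamma> x (a + b) v = \<Gamma> x a v + \<Gamma> x b v" "\<Gamma> x v (a + b) = \<Gamma> x v a + \<Gamma> x v b"
    "\<Gamma> x (a - b) v = \<Gamma> x a v - \<Gamma> x b v" "\<Gamma> x v (a - b) = \<Gamma> x v a - \<Gamma> x v b"
    "\<Gamma> x (c *\<^sub>R a) v = c *\<^sub>R \<Gamma> x a v" "\<Gamma> x v (c *\<^sub>R a) = c *\<^sub>R \<Gamma> x v a"
    "\<Gamma> x 0 v = 0" "\<Gamma> x v 0 = 0" "\<Gamma> x (- a) v = - \<Gamma> x a v" "\<Gamma> x v (- a) = - \<Gamma> x v a"
  using bilinear_christoffel[OF assms]
  by (simp_all add: bilinear_ladd bilinear_radd bilinear_lsub bilinear_rsub bilinear_lmul bilinear_rmul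
      bilinear_lzero bilinear_rzero bilinear_lneg bilinear_rneg)

lemma Cauchy_Schwarz:
  assumes x: "x \<in> \<Omega>" shows "(G x u v)\<^sup>2 \<le> G x u u * G x v v"
proof (cases "u = 0")
  case False
  then have p: "G x u u > 0" using pos[OF x] by blast
  let ?c = "G x u v / G x u u"
  have "0 \<le> G x (v - ?c *\<^sub>R u) (v - ?c *\<^sub>R u)" by (rule nonneg[OF x])
  also have "\<dots> = G x v v - (G x u v)\<^sup>2 / G x u u"
    using p sym[OF x, of u v] by (simp add: G_simps[OF x] field_simps power2_eq_square)
  finally show ?thesis using p by (simp add: field_simps)
qed (simp add: G_simps[OF x])

lemma strict_Cauchy_Schwarz:
  assumes x: "x \<in> \<Omega>" and u: "u \<noteq> 0" and v: "\<And>c. v \<noteq> c *\<^sub>R u"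
  shows "(G x u v)\<^sup>2 < G x u u * G x v v"
proof -
  have p: "G x u u > 0" using pos[OF x u] .
  let ?c = "G x u v / G x u u"
  have "0 < G x (v - ?c *\<^sub>R u) (v - ?c *\<^sub>R u)" using v[of ?c] by (intro pos[OF x]) simp
  also have "\<dots> = G x v v - (G x u v)\<^sup>2 / G x u u"
    using p sym[OF x, of u v] by (simp add: G_simps[OF x] field_simps power2_eq_square)
  finally show ?thesis using p by (simp add: field_simps)
qed

text \<open>Sectional curvatures belong to independent pairs, and for those the denominator of the
sectional curvature is positive by the strict Cauchy-Schwarz inequality. For dependent pairs \<open>R(u,v)\<close>
vanishes. The arguments are in the order in which the curvature enters the second variation.\<close>

lemma curvature_nonpos:
  assumes x: "x \<in> \<Omega>"
    and K: "\<And>u v. u \<noteq> v \<Longrightarrow> independent {u, v} \<Longrightarrow> sectional_curvature G x u v \<le> 0"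
  shows "0 \<le> G x (riemann_curvature G x u v u) v"
proof (cases "u \<noteq> 0 \<and> (\<forall>c. v \<noteq> c *\<^sub>R u)")
  case True
  then have ne: "v \<noteq> u" "u \<noteq> 0" by (metis scaleR_one, blast)
  have "independent {v, u}"
    using True ne by (auto simp: independent_insert span_singleton)
  then have le: "sectional_curvature G x v u \<le> 0" using K ne by blast
  have "0 < G x v v * G x u u - (G x v u)\<^sup>2"
    using strict_Cauchy_Schwarz[OF x, of u v] True sym[OF x, of u v] by (simp add: mult.commute)
  then have "G x (riemann_curvature G x v u u) v \<le> 0"
    using le unfolding sectional_curvature_def by (simp add: divide_le_0_iff)
  moreover have "riemann_curvature G x u v u = - riemann_curvature G x v u u"
    by (simp add: riemann_curvature_def)
  ultimately show ?thesis by (simp add: G_simps[OF x])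
next
  case False
  have "riemann_curvature G x u v u = 0"
  proof (cases "u = 0")
    case True
    then show ?thesis
      by (simp add: riemann_curvature_def Ch_simps[OF x] Ch.derivative_simps[OF x])
  next
    case False
    with \<open>\<not> (u \<noteq> 0 \<and> _)\<close> obtain c where c: "v = c *\<^sub>R u" by blast
    show ?thesis unfolding c riemann_curvature_def
      by (simp add: Ch_simps[OF x] Ch.derivative_simps[OF x])
  qed
  then show ?thesis by (simp add: G_simps[OF x])
qed

end

section \<open>Lengths of curves and the Riemannian distance\<close>

lemma C1_curve_on_affine:
  assumes c: "C1_curve_on A a b c" and k: "k > 0" and ab: "a = k * a' + m" "b = k * b' + m"
  shows "C1_curve_on A a' b' (\<lambda>t. c (k * t + m))"
proof -
  have im: "(\<lambda>t. k * t + m) ` {a'..b'} = {a..b}"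
  proof -
    have "(\<lambda>t. k * t + m) ` {a'..b'} = {k * a' + m..k * b' + m}" if "a' \<le> b'"
      using image_affinity_atLeastAtMost[of k m a' b'] k that by simp
    moreover have "{a..b} = {}" "{a'..b'} = {}" if "\<not> a' \<le> b'" using that k ab by auto
    ultimately show ?thesis using ab by (cases "a' \<le> b'") auto
  qed
  have mem: "k * t + m \<in> {a..b}" if "t \<in> {a'..b'}" for t using im that by blast
  show ?thesis unfolding C1_curve_on_def
  proof (intro conjI ballI)
    show "continuous_on {a'..b'} (\<lambda>t. c (k * t + m))"
      by (rule continuous_on_compose2[where g = c and t = "{a..b}"])
        (use c im in \<open>auto simp: C1_curve_on_def intro!: continuous_intros\<close>)
    fix p assume "p \<in> A"
    obtain U \<phi> where p: "p = (U, \<phi>)" by fastforce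
    obtain D where D: "continuous_on ({a..b} \<inter> c -` U) D"
       "\<And>t. t \<in> {a..b} \<inter> c -` U \<Longrightarrow> ((\<phi> \<circ> c) has_vector_derivative D t) (at t within {a..b})"
      using c \<open>p \<in> A\<close> unfolding C1_curve_on_def p by blast
    let ?S = "{a'..b'} \<inter> (\<lambda>t. c (k * t + m)) -` U"
    have "continuous_on ?S (\<lambda>t. k *\<^sub>R D (k * t + m))"
      by (intro continuous_intros continuous_on_compose2[OF D(1)]) (use mem in auto)
    moreover have "((\<phi> \<circ> (\<lambda>t. c (k * t + m))) has_vector_derivative k *\<^sub>R D (k * t + m)) (at t within {a'..b'})"
      if t: "t \<in> ?S" for t
    proof -
      have "((\<lambda>t. k * t + m) has_vector_derivative k) (at t within {a'..b'})"
        by (auto intro!: derivative_eq_intros simp: has_real_derivative_iff_has_vector_derivative[symmetric])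
      moreover have "((\<phi> \<circ> c) has_vector_derivative D (k * t + m)) (at (k * t + m) within (\<lambda>t. k * t + m) ` {a'..b'})"
        unfolding im using t mem by (intro D(2)) auto
      ultimately have "((\<phi> \<circ> c) \<circ> (\<lambda>t. k * t + m) has_vector_derivative k *\<^sub>R D (k * t + m)) (at t within {a'..b'})"
        by (rule vector_diff_chain_within)
      then show ?thesis by (simp add: o_def)
    qed
    ultimately show "case p of (U, \<phi>) \<Rightarrow> \<exists>D. continuous_on ({a'..b'} \<inter> (\<lambda>t. c (k * t + m)) -` U) D \<and>
        (\<forall>t\<in>{a'..b'} \<inter> (\<lambda>t. c (k * t + m)) -` U.
           ((\<phi> \<circ> (\<lambda>t. c (k * t + m))) has_vector_derivative D t) (at t within {a'..b'}))"
      unfolding p by blast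
  qed
qed

lemma C1_curve_on_subinterval:
  assumes c: "C1_curve_on A a b c" and ab: "{a'..b'} \<subseteq> {a..b}"
  shows "C1_curve_on A a' b' c"
  unfolding C1_curve_on_def
proof (intro conjI ballI)
  show "continuous_on {a'..b'} c" using c ab unfolding C1_curve_on_def by (blast intro: continuous_on_subset)
  fix p assume "p \<in> A"
  obtain U \<phi> where p: "p = (U, \<phi>)" by fastforce
  obtain D where D: "continuous_on ({a..b} \<inter> c -` U) D"
     "\<And>t. t \<in> {a..b} \<inter> c -` U \<Longrightarrow> ((\<phi> \<circ> c) has_vector_derivative D t) (at t within {a..b})"
    using c \<open>p \<in> A\<close> unfolding C1_curve_on_def p by blast
  show "case p of (U, \<phi>) \<Rightarrow> \<exists>D. continuous_on ({a'..b'} \<inter> c -` U) D \<and>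
        (\<forall>t\<in>{a'..b'} \<inter> c -` U. ((\<phi> \<circ> c) has_vector_derivative D t) (at t within {a'..b'}))"
    unfolding p prod.case
  proof (intro exI[of _ D] conjI ballI)
    show "continuous_on ({a'..b'} \<inter> c -` U) D" by (rule continuous_on_subset[OF D(1)]) (use ab in blast)
    show "((\<phi> \<circ> c) has_vector_derivative D t) (at t within {a'..b'})" if "t \<in> {a'..b'} \<inter> c -` U" for t
      by (rule has_vector_derivative_within_subset[OF D(2) ab]) (use that ab in blast)
  qed
qed

lemma C1_curve_on_cong:
  assumes c: "C1_curve_on A a b c" and eq: "\<And>t. t \<in> {a..b} \<Longrightarrow> c' t = c t"
  shows "C1_curve_on A a b c'"
  unfolding C1_curve_on_def
proof (intro conjI ballI)
  show "continuous_on {a..b} c'"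
    by (rule continuous_on_eq[of _ c]) (use c eq in \<open>auto simp: C1_curve_on_def\<close>)
  fix p assume "p \<in> A"
  obtain U \<phi> where p: "p = (U, \<phi>)" by fastforce
  obtain D where D: "continuous_on ({a..b} \<inter> c -` U) D"
     "\<And>t. t \<in> {a..b} \<inter> c -` U \<Longrightarrow> ((\<phi> \<circ> c) has_vector_derivative D t) (at t within {a..b})"
    using c \<open>p \<in> A\<close> unfolding C1_curve_on_def p by blast
  have S: "{a..b} \<inter> c' -` U = {a..b} \<inter> c -` U" using eq by auto
  show "case p of (U, \<phi>) \<Rightarrow> \<exists>D. continuous_on ({a..b} \<inter> c' -` U) D \<and>
        (\<forall>t\<in>{a..b} \<inter> c' -` U. ((\<phi> \<circ> c') has_vector_derivative D t) (at t within {a..b}))"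
    unfolding p prod.case S
  proof (intro exI[of _ D] conjI ballI D(1))
    show "((\<phi> \<circ> c') has_vector_derivative D t) (at t within {a..b})" if t: "t \<in> {a..b} \<inter> c -` U" for t
      by (rule has_vector_derivative_transform[OF _ _ D(2)[OF t]]) (use eq t in auto)
  qed
qed

text \<open>The break points of a piecewise \<open>C\<^sup>1\<close> curve are made explicit, since joining curves and restricting
them acts on the break points.\<close>

definition C1_breaks ::
  "('a::topological_space, 'e::euclidean_space) chart set \<Rightarrow> (real \<Rightarrow> 'a) \<Rightarrow> real set \<Rightarrow> bool" where
  "C1_breaks A c S \<longleftrightarrow> finite S \<and> {0, 1} \<subseteq> S \<and> S \<subseteq> {0..1} \<and>
     (\<forall>a\<in>S. \<forall>b\<in>S. a < b \<and> {a<..<b} \<inter> S = {} \<longrightarrow> C1_curve_on A a b c)"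

lemma piecewise_C1_iff_breaks: "piecewise_C1_curve A c \<longleftrightarrow> (\<exists>S. C1_breaks A c S)"
  unfolding piecewise_C1_curve_def C1_breaks_def ..

text \<open>Two versions, because at a break point the left and the right neighbourhoods lie in different pieces.\<close>

lemma C1_breaks_pieces:
  assumes breaks: "C1_breaks A c S"
  shows "0 \<le> x \<Longrightarrow> x < 1 \<Longrightarrow> \<exists>a\<in>S. \<exists>b\<in>S. a \<le> x \<and> x < b \<and> {a<..<b} \<inter> S = {} \<and> C1_curve_on A a b c"
    and "0 < x \<Longrightarrow> x \<le> 1 \<Longrightarrow> \<exists>a\<in>S. \<exists>b\<in>S. a < x \<and> x \<le> b \<and> {a<..<b} \<inter> S = {} \<and> C1_curve_on A a b c"
proof -
  have S: "finite S" "{0,1} \<subseteq> S" "S \<subseteq> {0..1}"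
    and pc: "\<And>a b. a \<in> S \<Longrightarrow> b \<in> S \<Longrightarrow> a < b \<Longrightarrow> {a<..<b} \<inter> S = {} \<Longrightarrow> C1_curve_on A a b c"
    using breaks unfolding C1_breaks_def by blast+
  show "\<exists>a\<in>S. \<exists>b\<in>S. a \<le> x \<and> x < b \<and> {a<..<b} \<inter> S = {} \<and> C1_curve_on A a b c" if x: "0 \<le> x" "x < 1"
  proof -
    let ?L = "{s\<in>S. s \<le> x}" and ?R = "{s\<in>S. x < s}"
    have f: "finite ?L" "finite ?R" "?L \<noteq> {}" "?R \<noteq> {}" using S x by auto
    have "Max ?L \<in> ?L" "Min ?R \<in> ?R" using Max_in[OF f(1,3)] Min_in[OF f(2,4)] by blast+
    moreover have "{Max ?L<..<Min ?R} \<inter> S = {}"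
    proof -
      have False if "s \<in> S" "Max ?L < s" "s < Min ?R" for s
        using that f Max_ge[OF f(1), of s] Min_le[OF f(2), of s] by (cases "s \<le> x") auto
      then show ?thesis by auto
    qed
    ultimately show ?thesis using pc[of "Max ?L" "Min ?R"] by (intro bexI[of _ "Max ?L"] bexI[of _ "Min ?R"]) auto
  qed
  show "\<exists>a\<in>S. \<exists>b\<in>S. a < x \<and> x \<le> b \<and> {a<..<b} \<inter> S = {} \<and> C1_curve_on A a b c" if x: "0 < x" "x \<le> 1"
  proof -
    let ?L = "{s\<in>S. s < x}" and ?R = "{s\<in>S. x \<le> s}"
    have f: "finite ?L" "finite ?R" "?L \<noteq> {}" "?R \<noteq> {}" using S x by auto
    have "Max ?L \<in> ?L" "Min ?R \<in> ?R" using Max_in[OF f(1,3)] Min_in[OF f(2,4)] by blast+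
    moreover have "{Max ?L<..<Min ?R} \<inter> S = {}"
    proof -
      have False if "s \<in> S" "Max ?L < s" "s < Min ?R" for s
        using that f Max_ge[OF f(1), of s] Min_le[OF f(2), of s] by (cases "s < x") auto
      then show ?thesis by auto
    qed
    ultimately show ?thesis using pc[of "Max ?L" "Min ?R"] by (intro bexI[of _ "Max ?L"] bexI[of _ "Min ?R"]) auto
  qed
qed

lemma piecewise_C1_continuous:
  assumes "piecewise_C1_curve A c" shows "continuous_on {0..1} c"
proof -
  obtain S where S: "C1_breaks A c S" using assms piecewise_C1_iff_breaks by blast
  note P = C1_breaks_pieces[OF S]
  have "continuous (at x within {0..1}) c" if x: "x \<in> {0..1}" for x
  proof -
    have r: "continuous (at x within {0..1} \<inter> {x..}) c"
    proof (cases "x < 1")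
      case True
      then obtain a b where ab: "a \<le> x" "x < b" "C1_curve_on A a b c" using P(1)[of x] x by auto
      then have "continuous (at x within {a..b}) c"
        unfolding C1_curve_on_def by (simp add: continuous_on_eq_continuous_within)
      then have "continuous (at x within {x..b}) c" using ab by (auto intro: continuous_within_subset)
      moreover have "at x within {0..1} \<inter> {x..} = at x within {x..b}"
        by (rule at_within_nhd[of _ "{..<min b 1}"]) (use True ab x in auto)
      ultimately show ?thesis by simp
    next
      case False
      then have "{0..1} \<inter> {x..} = {x}" using x by auto
      then have "at x within {0..1} \<inter> {x..} = bot" by (simp add: at_within_eq_bot_iff)
      then show ?thesis by (simp only: continuous_bot)
    qed
    have l: "continuous (at x within {0..1} \<inter> {..x}) c"
    proof (cases "0 < x")
      case True
      then obtain a b where ab: "a < x" "x \<le> b" "C1_curve_on A a b c" using P(2)[of x] x by auto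
      then have "continuous (at x within {a..b}) c"
        unfolding C1_curve_on_def by (simp add: continuous_on_eq_continuous_within)
      then have "continuous (at x within {a..x}) c" using ab by (auto intro: continuous_within_subset)
      moreover have "at x within {0..1} \<inter> {..x} = at x within {a..x}"
        by (rule at_within_nhd[of _ "{max a 0<..}"]) (use True ab x in auto)
      ultimately show ?thesis by simp
    next
      case False
      then have "{0..1} \<inter> {..x} = {x}" using x by auto
      then have "at x within {0..1} \<inter> {..x} = bot" by (simp add: at_within_eq_bot_iff)
      then show ?thesis by (simp only: continuous_bot)
    qed
    have eq: "({0..1} \<inter> {x..}) \<union> ({0..1} \<inter> {..x}) = {0..1}" by auto
    have "(c \<longlongrightarrow> c x) (at x within ({0..1} \<inter> {x..}) \<union> ({0..1} \<inter> {..x}))"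
      using l r unfolding continuous_within by (rule Lim_Un[rotated])
    then show ?thesis unfolding continuous_within eq .
  qed
  then show ?thesis by (simp add: continuous_on_eq_continuous_within)
qed

locale riemannian_space =
  fixes A :: "('a::metric_space, 'e::euclidean_space) chart set"
    and g :: "('a, 'e) chart \<Rightarrow> 'e \<Rightarrow> 'e \<Rightarrow> 'e \<Rightarrow> real"
  assumes atlas: "smooth_atlas A" and metric: "riemannian_metric A g"
    and dist_eq: "dist p q = riemannian_distance A g p q"
begin

lemma ex_chart: "\<exists>k\<in>A. p \<in> fst k"
  using atlas unfolding smooth_atlas_def by blast

lemma
  assumes "k \<in> A"
  shows open_chart: "open (fst k)" and open_chart_image: "open (snd k ` fst k)"
    and chart_homeomorphism: "homeomorphism (fst k) (snd k ` fst k) (snd k) (inv_into (fst k) (snd k))"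
  using atlas assms unfolding smooth_atlas_def by (auto simp: case_prod_beta)

lemma chart_inverse [simp]:
  assumes "k \<in> A"
  shows "p \<in> fst k \<Longrightarrow> inv_into (fst k) (snd k) (snd k p) = p"
    "x \<in> snd k ` fst k \<Longrightarrow> snd k (inv_into (fst k) (snd k) x) = x"
    "x \<in> snd k ` fst k \<Longrightarrow> inv_into (fst k) (snd k) x \<in> fst k"
  using chart_homeomorphism[OF assms] by (auto simp: homeomorphism_def intro: inv_into_into)

lemma open_inv_image:
  assumes k: "k \<in> A" and V: "open V" "V \<subseteq> snd k ` fst k"
  shows "open (inv_into (fst k) (snd k) ` V)"
proof -
  have "openin (top_of_set (fst k)) (inv_into (fst k) (snd k) ` V)"
    using V by (intro homeomorphism_imp_open_map[OF homeomorphism_sym[THEN iffD1, OF chart_homeomorphism[OF k]]])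
      (auto simp: openin_open_eq open_chart_image[OF k])
  then show ?thesis using open_chart[OF k] openin_open_trans by blast
qed

lemma coordinate_metric: "k \<in> A \<Longrightarrow> coordinate_metric (g k) (snd k ` fst k)"
  using metric open_chart_image unfolding riemannian_metric_def
  by unfold_locales blast+

lemma transition_has_derivative:
  assumes k: "k \<in> A" "k' \<in> A" and p: "p \<in> fst k" "p \<in> fst k'"
  shows "((transition_map k k') has_derivative frechet_derivative (transition_map k k') (at (snd k p))) (at (snd k p))"
proof -
  have "smooth_on (transition_map k k') (snd k ` (fst k \<inter> fst k'))"
    using atlas k unfolding smooth_atlas_def by blast
  then have "C1_on (transition_map k k') (snd k ` (fst k \<inter> fst k'))" unfolding smooth_on_def by blast
  then show ?thesis using p by (intro C1_on_has_derivative[of _ "snd k ` (fst k \<inter> fst k')"]) blast+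
qed

lemma change_of_chart:
  assumes k: "k \<in> A" "k' \<in> A" and p: "p \<in> fst k" "p \<in> fst k'"
  shows "g k (snd k p) u v = g k' (snd k' p) (frechet_derivative (transition_map k k') (at (snd k p)) u)
     (frechet_derivative (transition_map k k') (at (snd k p)) v)"
  using metric k p unfolding riemannian_metric_def Let_def by blast

text \<open>By the transformation rule for the metric, the arbitrary chart in the definition of the speed may
be replaced by any other one.\<close>

lemma curve_speed_eq:
  assumes t: "a < t" "t < b" and c: "continuous_on {a..b} c"
    and k: "k \<in> A" "c t \<in> fst k" and d: "((snd k \<circ> c) has_vector_derivative d) (at t)"
  shows "curve_speed A g c t = sqrt (g k (snd k (c t)) d d)"
proof -
  define k' where "k' = (SOME k. k \<in> A \<and> c t \<in> fst k)"
  have k': "k' \<in> A" "c t \<in> fst k'"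
    using someI_ex[of "\<lambda>k. k \<in> A \<and> c t \<in> fst k"] ex_chart[of "c t"] unfolding k'_def by blast+
  let ?T = "frechet_derivative (transition_map k k') (at (snd k (c t)))"
  have der: "(transition_map k k' has_derivative ?T) (at ((snd k \<circ> c) t))"
    using transition_has_derivative[OF k(1) k'(1) k(2) k'(2)] by simp
  have "((transition_map k k' \<circ> (snd k \<circ> c)) has_vector_derivative ?T d) (at t)"
    by (rule vector_derivative_diff_chain_within[OF d]) (use der has_derivative_at_withinI in blast)
  moreover have "\<forall>\<^sub>F s in nhds t. (transition_map k k' \<circ> (snd k \<circ> c)) s = (snd k' \<circ> c) s"
  proof -
    have "isCont c t" using c t by (simp add: continuous_on_interior)
    then have "\<forall>\<^sub>F s in at t. c s \<in> fst k"
      unfolding continuous_at by (rule topological_tendstoD[OF _ open_chart[OF k(1)] k(2)])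
    then have "\<forall>\<^sub>F s in nhds t. c s \<in> fst k"
      unfolding eventually_at_filter by eventually_elim (use k in auto)
    then show ?thesis by eventually_elim (simp add: transition_map_def k(1))
  qed
  ultimately have "((snd k' \<circ> c) has_vector_derivative ?T d) (at t)"
    by (subst has_vector_derivative_cong_ev[symmetric]) (auto dest: eventually_nhds_x_imp_x)
  then have "curve_speed A g c t = sqrt (g k' (snd k' (c t)) (?T d) (?T d))"
    unfolding curve_speed_def Let_def k'_def[symmetric] by (simp add: vector_derivative_at)
  then show ?thesis using change_of_chart[OF k(1) k'(1) k(2) k'(2)] by simp
qed

lemma curve_speed_nonneg: "0 \<le> curve_speed A g c t"
proof -
  define k where "k = (SOME k. k \<in> A \<and> c t \<in> fst k)"
  have k: "k \<in> A" "c t \<in> fst k"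
    using someI_ex[of "\<lambda>k. k \<in> A \<and> c t \<in> fst k"] ex_chart[of "c t"] unfolding k_def by blast+
  interpret coordinate_metric "g k" "snd k ` fst k" by (rule coordinate_metric[OF k(1)])
  show ?thesis unfolding curve_speed_def Let_def k_def[symmetric] using k by (simp add: nonneg)
qed

lemma C1_curve_derivative:
  assumes c: "C1_curve_on A a b c" and k: "k \<in> A"
  shows "\<exists>D. continuous_on ({a..b} \<inter> c -` fst k) D \<and>
    (\<forall>t\<in>{a<..<b} \<inter> c -` fst k. ((snd k \<circ> c) has_vector_derivative D t) (at t) \<and>
       curve_speed A g c t = sqrt (g k (snd k (c t)) (D t) (D t)))"
proof -
  obtain D where D: "continuous_on ({a..b} \<inter> c -` fst k) D"
    "\<And>t. t \<in> {a..b} \<inter> c -` fst k \<Longrightarrow> ((snd k \<circ> c) has_vector_derivative D t) (at t within {a..b})"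
    using c k unfolding C1_curve_on_def by (fastforce simp: case_prod_beta)
  have D': "((snd k \<circ> c) has_vector_derivative D t) (at t)" if "t \<in> {a<..<b} \<inter> c -` fst k" for t
    using D(2)[of t] that at_within_Icc_at[of a t b] by auto
  have "curve_speed A g c t = sqrt (g k (snd k (c t)) (D t) (D t))" if "t \<in> {a<..<b} \<inter> c -` fst k" for t
    using c D'[OF that] that k by (intro curve_speed_eq[of a t b]) (auto simp: C1_curve_on_def)
  then show ?thesis using D(1) D' by blast
qed

lemma curve_speed_integrable_piece:
  assumes c: "C1_curve_on A a b c" and k: "k \<in> A" and uv: "{u..v} \<subseteq> {a..b}" "c ` {u..v} \<subseteq> fst k"
  shows "curve_speed A g c integrable_on {u..v}"
proof (cases "u \<le> v")
  case True
  interpret coordinate_metric "g k" "snd k ` fst k" by (rule coordinate_metric[OF k(1)])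
  obtain D where D: "continuous_on ({a..b} \<inter> c -` fst k) D"
    "\<And>t. t \<in> {a<..<b} \<inter> c -` fst k \<Longrightarrow> curve_speed A g c t = sqrt (g k (snd k (c t)) (D t) (D t))"
    using C1_curve_derivative[OF c k] by blast
  have cont: "continuous_on {u..v} c" using c uv unfolding C1_curve_on_def by (blast intro: continuous_on_subset)
  have "continuous_on (c ` {u..v}) (snd k)"
    by (rule continuous_on_subset[OF homeomorphism_cont1[OF chart_homeomorphism[OF k]] uv(2)])
  then have "continuous_on {u..v} (\<lambda>t. snd k (c t))" using cont by (rule continuous_on_compose2) simp
  then have "continuous_on {u..v} (\<lambda>t. sqrt (g k (snd k (c t)) (D t) (D t)))"
    using uv by (intro continuous_intros continuous_G continuous_on_subset[OF D(1)]) auto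
  then have "(\<lambda>t. sqrt (g k (snd k (c t)) (D t) (D t))) integrable_on {u..v}"
    by (rule integrable_continuous_real)
  then show ?thesis
    by (rule integrable_spike_finite[of "{u,v}", rotated 2]) (use D(2) uv True in \<open>auto simp: image_subset_iff\<close>)
qed (simp add: integrable_on_empty)

text \<open>Integrability on small intervals suffices, and to either side of a parameter value a short arc lies
in a single chart and a single piece.\<close>

lemma curve_speed_integrable:
  assumes c: "piecewise_C1_curve A c"
  shows "curve_speed A g c integrable_on {0..1}"
proof -
  obtain S where S: "C1_breaks A c S" using c piecewise_C1_iff_breaks by blast
  then have finS: "finite S" unfolding C1_breaks_def by blast
  note P = C1_breaks_pieces[OF S]
  have cont: "continuous_on {0..1} c" by (rule piecewise_C1_continuous[OF c])
  have "curve_speed A g c integrable_on cbox 0 1"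
  proof (rule integrable_on_little_subintervals, rule ballI)
    fix x :: real assume "x \<in> cbox 0 1"
    then have x: "0 \<le> x" "x \<le> 1" by auto
    obtain k where k: "k \<in> A" "c x \<in> fst k" using ex_chart by blast
    have "\<exists>d>0. \<forall>t\<in>{0..1}. dist t x < d \<longrightarrow> c t \<in> fst k"
    proof -
      obtain e where e: "e > 0" "ball (c x) e \<subseteq> fst k" using open_chart[OF k(1)] k(2) open_contains_ball by blast
      then show ?thesis using cont x unfolding continuous_on_iff
        by (metis atLeastAtMost_iff dist_commute mem_ball subsetD)
    qed
    then obtain d where d: "d > 0" "\<And>t. t \<in> {0..1} \<Longrightarrow> dist t x < d \<Longrightarrow> c t \<in> fst k" by blast
    have "\<exists>d1>0. \<forall>v\<le>1. x \<le> v \<and> v < x + d1 \<longrightarrow> curve_speed A g c integrable_on {x..v}"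
    proof (cases "x < 1")
      case True
      obtain a b where ab: "a \<le> x" "x < b" "C1_curve_on A a b c" using P(1)[of x] x True by auto
      show ?thesis
        by (intro exI[of _ "min d (b - x)"] conjI allI impI curve_speed_integrable_piece[OF ab(3) k(1)])
          (use ab d x in \<open>auto simp: dist_real_def\<close>)
    qed (use x integrable_on_refl[of "curve_speed A g c" x] in \<open>auto intro!: exI[of _ 1]\<close>)
    then obtain d1 where d1: "d1 > 0" "\<And>v. v \<le> 1 \<Longrightarrow> x \<le> v \<Longrightarrow> v < x + d1 \<Longrightarrow> curve_speed A g c integrable_on {x..v}"
      by blast
    have "\<exists>d2>0. \<forall>u\<ge>0. u \<le> x \<and> x - d2 < u \<longrightarrow> curve_speed A g c integrable_on {u..x}"
    proof (cases "0 < x")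
      case True
      obtain a b where ab: "a < x" "x \<le> b" "C1_curve_on A a b c" using P(2)[of x] x True by auto
      show ?thesis
        by (intro exI[of _ "min d (x - a)"] conjI allI impI curve_speed_integrable_piece[OF ab(3) k(1)])
          (use ab d x in \<open>auto simp: dist_real_def\<close>)
    qed (use x integrable_on_refl[of "curve_speed A g c" x] in \<open>auto intro!: exI[of _ 1]\<close>)
    then obtain d2 where d2: "d2 > 0" "\<And>u. u \<ge> 0 \<Longrightarrow> u \<le> x \<Longrightarrow> x - d2 < u \<Longrightarrow> curve_speed A g c integrable_on {u..x}"
      by blast
    show "\<exists>d>0. \<forall>u v. x \<in> cbox u v \<and> cbox u v \<subseteq> ball x d \<and> cbox u v \<subseteq> cbox 0 1 \<longrightarrow>
             curve_speed A g c integrable_on cbox u v"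
    proof (intro exI[of _ "min d1 d2"] conjI allI impI)
      show "0 < min d1 d2" using d1 d2 by simp
      fix u v assume H: "x \<in> cbox u v \<and> cbox u v \<subseteq> ball x (min d1 d2) \<and> cbox u v \<subseteq> cbox 0 1"
      then have uv: "u \<le> x" "x \<le> v" by auto
      then have "u \<in> cbox u v" "v \<in> cbox u v" by auto
      then have "dist x u < min d1 d2" "dist x v < min d1 d2" "0 \<le> u" "v \<le> 1"
        using H unfolding subset_eq mem_ball by auto
      then show "curve_speed A g c integrable_on cbox u v"
        using d1(2)[of v] d2(2)[of u] uv by (auto simp: dist_real_def intro!: Henstock_Kurzweil_Integration.integrable_combine[OF uv])
    qed
  qed
  then show ?thesis by simp
qed

text \<open>Calibration: a linear functional that is dominated by the metric along the curve cannot grow by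
more than the length. Lower bounds for lengths, and thereby for the distance, are obtained
in this way.\<close>

lemma linear_displacement_le_length:
  assumes c: "piecewise_C1_curve A c" and k: "k \<in> A" and uv: "0 \<le> u" "u \<le> v" "v \<le> 1" "c ` {u..v} \<subseteq> fst k"
    and L: "bounded_linear L" "\<And>t w. t \<in> {u..v} \<Longrightarrow> L w \<le> M * sqrt (g k (snd k (c t)) w w)" and M: "M \<ge> 0"
  shows "L (snd k (c v) - snd k (c u)) \<le> M * integral {u..v} (curve_speed A g c)"
proof -
  obtain S where S: "C1_breaks A c S" using c piecewise_C1_iff_breaks by blast
  then have finS: "finite S" unfolding C1_breaks_def by blast
  let ?f = "snd k \<circ> c"
  have *: "(?f has_vector_derivative vector_derivative ?f (at t)) (at t) \<and>
      curve_speed A g c t = sqrt (g k (snd k (c t)) (vector_derivative ?f (at t)) (vector_derivative ?f (at t)))"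
    if t: "t \<in> {u<..<v} - S" for t
  proof -
    obtain a b where ab: "a \<in> S" "a \<le> t" "t < b" "C1_curve_on A a b c"
      using C1_breaks_pieces(1)[OF S, of t] t uv by auto
    then have "a \<noteq> t" using t by auto
    then have tt: "t \<in> {a<..<b} \<inter> c -` fst k" using ab t uv(4) by (auto simp: image_subset_iff)
    obtain D where D: "(?f has_vector_derivative D t) (at t)"
      "curve_speed A g c t = sqrt (g k (snd k (c t)) (D t) (D t))"
      using C1_curve_derivative[OF ab(4) k] tt by blast
    then show ?thesis using vector_derivative_at[OF D(1)] by simp
  qed
  have cont: "continuous_on {u..v} ?f"
  proof (rule continuous_on_compose)
    show "continuous_on {u..v} c"
      using piecewise_C1_continuous[OF c] uv by (auto intro: continuous_on_subset)
    show "continuous_on (c ` {u..v}) (snd k)"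
      by (rule continuous_on_subset[OF homeomorphism_cont1[OF chart_homeomorphism[OF k]] uv(4)])
  qed
  have "((\<lambda>t. vector_derivative ?f (at t)) has_integral (?f v - ?f u)) {u..v}"
    by (rule fundamental_theorem_of_calculus_interior_strong[OF finS uv(2) conjunct1[OF *] cont])
  from has_integral_linear[OF this L(1)]
  have 1: "((\<lambda>t. L (vector_derivative ?f (at t))) has_integral L (?f v - ?f u)) {u..v}" by (simp add: o_def)
  define h where "h t = (if t \<in> S \<union> {u,v} then 0 else L (vector_derivative ?f (at t)))" for t
  have 2: "(h has_integral L (?f v - ?f u)) {u..v}"
    by (rule has_integral_spike_finite[of "S \<union> {u,v}", OF _ _ 1]) (use finS in \<open>auto simp: h_def\<close>)
  have "curve_speed A g c integrable_on {u..v}"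
    using curve_speed_integrable[OF c] by (rule integrable_on_subinterval) (use uv in auto)
  then have 3: "((\<lambda>t. M * curve_speed A g c t) has_integral M * integral {u..v} (curve_speed A g c)) {u..v}"
    by (intro has_integral_mult_right integrable_integral)
  have "h t \<le> M * curve_speed A g c t" if "t \<in> {u..v}" for t
    using *[of t] L(2)[OF that, of "vector_derivative ?f (at t)"] that M curve_speed_nonneg[of c t]
    by (auto simp: h_def)
  then show ?thesis using has_integral_le[OF 2 3] by simp
qed

end

text \<open>The trace that lengths of curves leave in the metric space: \<open>L\<close> is a length function along \<open>c\<close>, and \<open>c\<close> is
at most \<open>e\<close> longer than the distance of its ends. The later arguments see the length structure
only through such curves.\<close>

definition almost_geodesic ::
  "(real \<Rightarrow> 'a::metric_space) \<Rightarrow> (real \<Rightarrow> real) \<Rightarrow> 'a \<Rightarrow> 'a \<Rightarrow> real \<Rightarrow> bool" where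
  "almost_geodesic c L p q e \<longleftrightarrow> continuous_on {0..1} c \<and> c 0 = p \<and> c 1 = q \<and>
     (\<forall>s t. 0 \<le> s \<and> s \<le> t \<and> t \<le> 1 \<longrightarrow> dist (c s) (c t) \<le> L t - L s) \<and> L 1 - L 0 \<le> dist p q + e"

lemma C1_breaks_join:
  assumes S1: "C1_breaks A c1 S1" and S2: "C1_breaks A c2 S2" and eq: "c1 1 = c2 0"
  shows "C1_breaks A (c1 +++ c2) ((\<lambda>s. s / 2) ` S1 \<union> (\<lambda>s. (s + 1) / 2) ` S2)" (is "C1_breaks A _ ?S")
proof -
  have b1: "finite S1" "0 \<in> S1" "1 \<in> S1" "\<And>s. s \<in> S1 \<Longrightarrow> 0 \<le> s \<and> s \<le> 1"
    and b2: "finite S2" "0 \<in> S2" "1 \<in> S2" "\<And>s. s \<in> S2 \<Longrightarrow> 0 \<le> s \<and> s \<le> 1"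
    using S1 S2 unfolding C1_breaks_def by (auto simp: subset_eq)
  have half: "1/2 \<in> ?S" by (rule UnI1, rule image_eqI[OF _ b1(3)]) simp
  have "C1_curve_on A a b (c1 +++ c2)"
    if ab: "a \<in> ?S" "b \<in> ?S" "a < b" "{a<..<b} \<inter> ?S = {}" for a b
  proof (cases "b \<le> 1/2")
    case True
    have m: "2 * s \<in> S1" if "s \<in> ?S" "s \<le> 1/2" for s
    proof -
      from that(1) consider r where "r \<in> S1" "s = r / 2" | r where "r \<in> S2" "s = (r + 1) / 2" by auto
      then show ?thesis
      proof cases
        case 2
        then have "r = 0" using that(2) b2(4)[of r] by auto
        then have "2 * s = 1" using 2 by simp
        then show ?thesis using b1(3) by simp
      next
        case 1
        then have "2 * s = r" by simp
        then show ?thesis using 1(1) by (simp only:)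
      qed
    qed
    have "{2*a<..<2*b} \<inter> S1 = {}"
    proof -
      have False if "s \<in> S1" "2*a < s" "s < 2*b" for s
      proof -
        have "s/2 \<in> {a<..<b} \<inter> ?S" using that by auto
        then show False using ab(4) by blast
      qed
      then show ?thesis by auto
    qed
    then have "C1_curve_on A (2*a) (2*b) c1"
      using S1 m[OF ab(1)] m[OF ab(2)] ab True unfolding C1_breaks_def by auto
    then have "C1_curve_on A a b (\<lambda>t. c1 (2 * t + 0))" by (rule C1_curve_on_affine) auto
    then show ?thesis by (rule C1_curve_on_cong) (use True in \<open>auto simp: joinpaths_def\<close>)
  next
    case False
    have a: "1/2 \<le> a"
    proof (rule ccontr)
      assume "\<not> 1/2 \<le> a"
      then have "1/2 \<in> {a<..<b} \<inter> ?S" using False half by simp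
      then show False using ab(4) by blast
    qed
    have m: "2 * s - 1 \<in> S2" if "s \<in> ?S" "1/2 \<le> s" for s
    proof -
      from that(1) consider r where "r \<in> S1" "s = r / 2" | r where "r \<in> S2" "s = (r + 1) / 2" by auto
      then show ?thesis
      proof cases
        case 1
        then have "r = 1" using that(2) b1(4)[of r] by auto
        then have "2 * s - 1 = 0" using 1 by simp
        then show ?thesis using b2(2) by simp
      next
        case 2
        then have "2 * s - 1 = r" by simp
        then show ?thesis using 2(1) by (simp only:)
      qed
    qed
    have "{2*a-1<..<2*b-1} \<inter> S2 = {}"
    proof -
      have False if "s \<in> S2" "2*a-1 < s" "s < 2*b-1" for s
      proof -
        have "(s+1)/2 \<in> {a<..<b} \<inter> ?S" using that by auto
        then show False using ab(4) by blast
      qed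
      then show ?thesis by auto
    qed
    then have "C1_curve_on A (2*a-1) (2*b-1) c2"
      using S2 m[OF ab(1)] m[OF ab(2)] ab a unfolding C1_breaks_def by auto
    then have "C1_curve_on A a b (\<lambda>t. c2 (2 * t + (-1)))" by (rule C1_curve_on_affine) auto
    then show ?thesis
    proof (rule C1_curve_on_cong)
      fix t assume "t \<in> {a..b}"
      then consider "t = 1/2" | "t > 1/2" using a by fastforce
      then show "(c1 +++ c2) t = c2 (2 * t + (-1))"
      proof cases
        case 1
        show ?thesis unfolding 1 using eq by (simp add: joinpaths_def)
      qed (simp add: joinpaths_def)
    qed
  qed
  moreover have "finite ?S" using b1(1) b2(1) by simp
  moreover have "0 \<in> ?S" by (rule UnI1, rule image_eqI[OF _ b1(2)]) simp
  moreover have "1 \<in> ?S" by (rule UnI2, rule image_eqI[OF _ b2(3)]) simp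
  moreover have "?S \<subseteq> {0..1}"
  proof -
    have "s / 2 \<in> {0..1}" if "s \<in> S1" for s using b1(4)[OF that] by simp
    moreover have "(s + 1) / 2 \<in> {0..1}" if "s \<in> S2" for s using b2(4)[OF that] by simp
    ultimately show ?thesis by blast
  qed
  ultimately show ?thesis unfolding C1_breaks_def by blast
qed

context riemannian_space
begin

lemma dist_le_curve_length:
  assumes "piecewise_C1_curve A c"
  shows "dist (c 0) (c 1) \<le> curve_length A g c"
proof -
  have "bdd_below (curve_length A g ` {c'. piecewise_C1_curve A c' \<and> c' 0 = c 0 \<and> c' 1 = c 1})"
    unfolding curve_length_def
    by (intro bdd_belowI2[where m = 0] integral_nonneg curve_speed_integrable) (auto intro: curve_speed_nonneg)
  then show ?thesis unfolding dist_eq riemannian_distance_def by (rule cINF_lower) (use assms in simp)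
qed

lemma regular_point:
  assumes S: "C1_breaks A c S" and t: "0 < t" "t < 1" "t \<notin> S"
  shows "\<exists>k d. k \<in> A \<and> c t \<in> fst k \<and> ((snd k \<circ> c) has_vector_derivative d) (at t)"
proof -
  obtain a b where ab: "a \<in> S" "a \<le> t" "t < b" "C1_curve_on A a b c"
    using C1_breaks_pieces(1)[OF S, of t] t by auto
  obtain k where k: "k \<in> A" "c t \<in> fst k" using ex_chart by blast
  have "a \<noteq> t" using ab t by auto
  then have "t \<in> {a<..<b} \<inter> c -` fst k" using ab k by auto
  then show ?thesis using C1_curve_derivative[OF ab(4) k(1)] k by blast
qed

text \<open>The arc between \<open>s\<close> and \<open>t\<close>, parametrized affinely over the unit interval, competes in the infimum
that defines the distance of its ends.\<close>

lemma dist_le_partial_length: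
  assumes c: "piecewise_C1_curve A c" and st: "0 \<le> s" "s \<le> t" "t \<le> 1"
  shows "dist (c s) (c t) \<le> integral {s..t} (curve_speed A g c)"
proof (cases "s = t")
  case False
  define m where "m = t - s"
  have m: "m > 0" using False st by (simp add: m_def)
  define c' where "c' r = c (m * r + s)" for r
  obtain S where S: "C1_breaks A c S" using c piecewise_C1_iff_breaks by blast
  then have Sb: "finite S" "\<And>s. s \<in> S \<Longrightarrow> 0 \<le> s \<and> s \<le> 1" unfolding C1_breaks_def by auto
  define S' where "S' = insert 0 (insert 1 {r\<in>{0..1}. m * r + s \<in> S})"
  have "finite {r\<in>{0..1}. m * r + s \<in> S}"
  proof (rule finite_subset)
    show "{r\<in>{0..1}. m * r + s \<in> S} \<subseteq> (\<lambda>u. (u - s) / m) ` S"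
    proof
      fix r assume "r \<in> {r\<in>{0..1}. m * r + s \<in> S}"
      then show "r \<in> (\<lambda>u. (u - s) / m) ` S" using m by (intro image_eqI[of _ _ "m * r + s"]) auto
    qed
  qed (use Sb in simp)
  then have finS': "finite S'" by (simp add: S'_def)
  have breaks: "C1_breaks A c' S'"
    unfolding C1_breaks_def
  proof (intro conjI ballI impI finS')
    show "{0,1} \<subseteq> S'" "S' \<subseteq> {0..1}" by (auto simp: S'_def)
    fix a b assume ab: "a \<in> S'" "b \<in> S'" "a < b \<and> {a<..<b} \<inter> S' = {}"
    have ab01: "0 \<le> a" "b \<le> 1" using ab(1,2) by (auto simp: S'_def)
    let ?a = "m * a + s" and ?b = "m * b + s"
    have lt: "?a < ?b" using ab m by simp
    have "m * b \<le> m" using ab01 m mult_left_mono[of b 1 m] by simp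
    then have b1: "?b \<le> t" using m_def by linarith
    have a0: "0 \<le> ?a" using ab01 m st by simp
    obtain a' b' where p: "b' \<in> S" "a' \<le> ?a" "?a < b'" "C1_curve_on A a' b' c"
      using C1_breaks_pieces(1)[OF S a0] lt b1 st by auto
    have "?b \<le> b'"
    proof (rule ccontr)
      assume "\<not> ?b \<le> b'"
      then have "a < (b' - s) / m" "(b' - s) / m < b" using p m by (simp_all add: field_simps)
      moreover have "m * ((b' - s) / m) + s = b'" using m by simp
      ultimately have "(b' - s) / m \<in> {a<..<b} \<inter> S'" using p(1) ab01 by (auto simp: S'_def)
      then show False using ab by blast
    qed
    then have "C1_curve_on A ?a ?b c" using p by (intro C1_curve_on_subinterval[OF p(4)]) auto
    then show "C1_curve_on A a b c'" unfolding c'_def by (rule C1_curve_on_affine[OF _ m]) auto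
  qed
  then have pc': "piecewise_C1_curve A c'" using piecewise_C1_iff_breaks by blast
  have speed: "curve_speed A g c' r = m * curve_speed A g c (m * r + s)" if r: "r \<in> {0..1} - S'" for r
  proof -
    have r01: "0 < r" "r < 1" "m * r + s \<notin> S" using r by (auto simp: S'_def order.strict_iff_order)
    have u: "0 < m * r + s" "m * r + s < 1"
      using st mult_strict_left_mono[OF r01(2) m] mult_pos_pos[OF m r01(1)] m_def by linarith+
    obtain k d where k: "k \<in> A" "c (m * r + s) \<in> fst k"
      "((snd k \<circ> c) has_vector_derivative d) (at (m * r + s))"
      using regular_point[OF S u r01(3)] by blast
    interpret coordinate_metric "g k" "snd k ` fst k" by (rule coordinate_metric[OF k(1)])
    have s1: "curve_speed A g c (m * r + s) = sqrt (g k (snd k (c (m * r + s))) d d)"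
      using k u piecewise_C1_continuous[OF c] by (intro curve_speed_eq[of 0 _ 1]) auto
    have "((\<lambda>r. m * r + s) has_vector_derivative m) (at r)"
      by (auto intro!: derivative_eq_intros simp: has_real_derivative_iff_has_vector_derivative[symmetric])
    then have "(((snd k \<circ> c) \<circ> (\<lambda>r. m * r + s)) has_vector_derivative m *\<^sub>R d) (at r)"
      by (rule vector_diff_chain_at) (rule k(3))
    moreover have "(snd k \<circ> c) \<circ> (\<lambda>r. m * r + s) = snd k \<circ> c'" by (auto simp: c'_def)
    ultimately have "curve_speed A g c' r = sqrt (g k (snd k (c' r)) (m *\<^sub>R d) (m *\<^sub>R d))"
      using k r01 piecewise_C1_continuous[OF pc'] by (intro curve_speed_eq[of 0 _ 1]) (auto simp: c'_def)
    also have "\<dots> = sqrt (m\<^sup>2 * g k (snd k (c (m * r + s))) d d)"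
      using k by (simp add: c'_def G_simps power2_eq_square mult.assoc)
    also have "\<dots> = m * curve_speed A g c (m * r + s)"
      using m s1 by (simp add: real_sqrt_mult)
    finally show ?thesis .
  qed
  let ?I = "integral {s..t} (curve_speed A g c)"
  have "curve_speed A g c integrable_on {s..t}"
    using curve_speed_integrable[OF c] by (rule integrable_on_subinterval) (use st in auto)
  then have "(curve_speed A g c has_integral ?I) (cbox s t)" by (simp add: integrable_integral)
  from has_integral_affinity'[OF this m, of s]
  have "((\<lambda>r. curve_speed A g c (m * r + s)) has_integral ?I / m) {0..1}"
    using m by (simp add: m_def divide_inverse mult.commute)
  then have "((\<lambda>r. m * curve_speed A g c (m * r + s)) has_integral m * (?I / m)) {0..1}"
    by (rule has_integral_mult_right)
  then have "(curve_speed A g c' has_integral m * (?I / m)) {0..1}"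
    by (rule has_integral_spike_finite[OF finS', rotated]) (use speed in simp)
  then have "curve_length A g c' = ?I" using m unfolding curve_length_def by (simp add: integral_unique)
  then show ?thesis using dist_le_curve_length[OF pc'] by (simp add: c'_def m_def)
qed simp

abbreviation chart_inv :: "('a, 'e) chart \<Rightarrow> 'e \<Rightarrow> 'a" where
  "chart_inv k \<equiv> inv_into (fst k) (snd k)"

lemma
  assumes k: "k \<in> A" and seg: "closed_segment x y \<subseteq> snd k ` fst k"
  shows segment_piecewise_C1: "piecewise_C1_curve A (\<lambda>t. chart_inv k (x + t *\<^sub>R (y - x)))"
    and dist_le_segment: "(\<And>z. z \<in> closed_segment x y \<Longrightarrow> sqrt (g k z (y - x) (y - x)) \<le> M) \<Longrightarrow>
      dist (chart_inv k x) (chart_inv k y) \<le> M"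
proof -
  let ?l = "\<lambda>t::real. x + t *\<^sub>R (y - x)" and ?c = "\<lambda>t. chart_inv k (x + t *\<^sub>R (y - x))"
  have in_seg: "?l t \<in> closed_segment x y" if "t \<in> {0..1}" for t
    using that by (auto simp: in_segment algebra_simps intro!: exI[of _ t])
  then have l: "?l t \<in> snd k ` fst k" if "t \<in> {0..1}" for t using seg that by blast
  have dl: "(?l has_vector_derivative (y - x)) (at t within T)" for t T
    by (auto intro!: derivative_eq_intros)
  have cont: "continuous_on {0..1} ?c"
    by (rule continuous_on_compose2[OF homeomorphism_cont2[OF chart_homeomorphism[OF k]]])
      (use l in \<open>auto intro!: continuous_intros\<close>)
  have "C1_curve_on A 0 1 ?c"
    unfolding C1_curve_on_def
  proof (intro conjI ballI cont)
    fix k' assume k': "k' \<in> A"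
    let ?f = "transition_map k k'" and ?W = "snd k ` (fst k \<inter> fst k')"
    let ?D = "\<lambda>t. frechet_derivative ?f (at (?l t)) (y - x)"
    have C1: "C1_on ?f ?W"
      using atlas k k' unfolding smooth_atlas_def smooth_on_def by blast
    have W: "?l t \<in> ?W" if "t \<in> {0..1} \<inter> ?c -` fst k'" for t
    proof -
      have "snd k (?c t) = ?l t" "?c t \<in> fst k" "?c t \<in> fst k'" using l that k by auto
      then show ?thesis by (metis IntI image_eqI)
    qed
    have "continuous_on ({0..1} \<inter> ?c -` fst k') ?D"
    proof (rule continuous_on_compose2[OF C1_on_continuous_derivative[OF C1]])
      show "continuous_on ({0..1} \<inter> ?c -` fst k') ?l" by (intro continuous_intros)
      show "?l ` ({0..1} \<inter> ?c -` fst k') \<subseteq> ?W" using W by blast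
    qed
    moreover have "((snd k' \<circ> ?c) has_vector_derivative ?D t) (at t within {0..1})"
      if t: "t \<in> {0..1} \<inter> ?c -` fst k'" for t
    proof -
      have "(?f has_derivative frechet_derivative ?f (at (?l t))) (at (?l t) within ?l ` {0..1})"
        using C1_on_has_derivative[OF C1 W[OF t]] by (rule has_derivative_at_withinI)
      from vector_derivative_diff_chain_within[OF dl this]
      have "((?f \<circ> ?l) has_vector_derivative ?D t) (at t within {0..1})" .
      then show ?thesis by (simp add: transition_map_def o_def)
    qed
    ultimately show "case k' of (U, \<phi>) \<Rightarrow> \<exists>D. continuous_on ({0..1} \<inter> ?c -` U) D \<and>
        (\<forall>t\<in>{0..1} \<inter> ?c -` U. ((\<phi> \<circ> ?c) has_vector_derivative D t) (at t within {0..1}))"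
      unfolding case_prod_beta by blast
  qed
  then have br: "C1_breaks A ?c {0,1}" unfolding C1_breaks_def by auto
  then show pc: "piecewise_C1_curve A ?c" using piecewise_C1_iff_breaks by blast
  show "dist (chart_inv k x) (chart_inv k y) \<le> M"
    if M: "\<And>z. z \<in> closed_segment x y \<Longrightarrow> sqrt (g k z (y - x) (y - x)) \<le> M"
  proof -
    have sp: "curve_speed A g ?c t \<le> M" if t: "t \<in> {0<..<1}" for t
    proof -
      have t': "t \<in> {0..1}" using t by auto
      have "((snd k \<circ> ?c) has_vector_derivative (y - x)) (at t)"
      proof (rule has_vector_derivative_transform_within_open[OF dl, where S = "{0<..<1}"])
        show "?l s = (snd k \<circ> ?c) s" if "s \<in> {0<..<1}" for s using l[of s] that k by auto
      qed (use t in auto)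
      then have "curve_speed A g ?c t = sqrt (g k (snd k (?c t)) (y - x) (y - x))"
        using t cont l[OF t'] k by (intro curve_speed_eq[of 0 t 1]) auto
      also have "\<dots> \<le> M" using M[OF in_seg[OF t']] l[OF t'] k by simp
      finally show ?thesis .
    qed
    define h where "h t = (if t \<in> {0,1} then M else curve_speed A g ?c t)" for t
    have "(curve_speed A g ?c has_integral curve_length A g ?c) {0..1}"
      unfolding curve_length_def by (intro integrable_integral curve_speed_integrable pc)
    then have "(h has_integral curve_length A g ?c) {0..1}"
      by (rule has_integral_spike_finite[of "{0,1}", rotated 2]) (auto simp: h_def)
    moreover have "((\<lambda>t. M) has_integral M) {0..1::real}" using has_integral_const_real[of M 0 1] by simp
    moreover have "h t \<le> M" if "t \<in> {0..1}" for t using sp[of t] that by (auto simp: h_def)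
    ultimately have "curve_length A g ?c \<le> M" by (rule has_integral_le)
    then show ?thesis using dist_le_curve_length[OF pc] by simp
  qed
qed

text \<open>Being joined by such a curve is an equivalence relation whose classes are open. In particular
the distance is an infimum over a nonempty set.\<close>

lemma piecewise_C1_connected:
  assumes conn: "connected (UNIV :: 'a set)"
  shows "\<exists>c. piecewise_C1_curve A c \<and> c 0 = p \<and> c 1 = q"
proof -
  define reach where "reach p q \<longleftrightarrow> (\<exists>c. piecewise_C1_curve A c \<and> c 0 = p \<and> c 1 = q)" for p q
  have trans: "reach p r" if pq: "reach p q" and qr: "reach q r" for p q r
  proof -
    obtain c1 where c1: "piecewise_C1_curve A c1" "c1 0 = p" "c1 1 = q"
      using pq unfolding reach_def by blast
    obtain c2 where c2: "piecewise_C1_curve A c2" "c2 0 = q" "c2 1 = r"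
      using qr unfolding reach_def by blast
    note c = c1 c2
    from c obtain S1 S2 where "C1_breaks A c1 S1" "C1_breaks A c2 S2" using piecewise_C1_iff_breaks by blast
    from C1_breaks_join[OF this] c have "piecewise_C1_curve A (c1 +++ c2)"
      using piecewise_C1_iff_breaks by metis
    then show ?thesis unfolding reach_def using c by (intro exI[of _ "c1 +++ c2"]) (auto simp: joinpaths_def)
  qed
  have nbhd: "\<exists>V. open V \<and> q \<in> V \<and> (\<forall>q'\<in>V. reach q q' \<and> reach q' q)" for q
  proof -
    obtain k where k: "k \<in> A" "q \<in> fst k" using ex_chart by blast
    obtain r where r: "r > 0" "ball (snd k q) r \<subseteq> snd k ` fst k"
      using open_chart_image[OF k(1)] k(2) open_contains_ball by blast
    have re: "reach (chart_inv k x) (chart_inv k y)" if "x \<in> ball (snd k q) r" "y \<in> ball (snd k q) r" for x y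
    proof -
      have "closed_segment x y \<subseteq> snd k ` fst k"
        using that r(2) closed_segment_subset[OF that convex_ball] by blast
      from segment_piecewise_C1[OF k(1) this] show ?thesis unfolding reach_def
        by (intro exI[of _ "\<lambda>t. chart_inv k (x + t *\<^sub>R (y - x))"]) auto
    qed
    have q: "chart_inv k (snd k q) = q" using k by simp
    have c: "snd k q \<in> ball (snd k q) r" using r by simp
    have "reach q q' \<and> reach q' q" if "q' \<in> chart_inv k ` ball (snd k q) r" for q'
      using re[OF c] re[OF _ c] that q by auto
    then show ?thesis
      using open_inv_image[OF k(1) open_ball r(2)] c q
      by (intro exI[of _ "chart_inv k ` ball (snd k q) r"]) (auto intro!: image_eqI[of q _ "snd k q"])
  qed
  have "open {q. reach p q}"
    unfolding open_subopen[of "{q. reach p q}"] using nbhd trans by (metis mem_Collect_eq subsetI)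
  moreover have "open (- {q. reach p q})"
    unfolding open_subopen[of "- {q. reach p q}"] using nbhd trans by (metis ComplD ComplI mem_Collect_eq subsetI)
  moreover have "reach p p" using nbhd by blast
  ultimately have "{q. reach p q} = UNIV"
    using conn connected_clopen[of "UNIV :: 'a set"] by (metis closed_def closed_closedin empty_iff mem_Collect_eq open_openin subtopology_UNIV)
  then show ?thesis unfolding reach_def by blast
qed

lemma almost_minimizing_curve:
  fixes p q :: 'a
  assumes conn: "connected (UNIV :: 'a set)" and e: "e > 0"
  shows "\<exists>c. piecewise_C1_curve A c \<and> c 0 = p \<and> c 1 = q \<and> curve_length A g c < dist p q + e"
proof -
  let ?X = "{c. piecewise_C1_curve A c \<and> c 0 = p \<and> c 1 = q}"
  have "?X \<noteq> {}" using piecewise_C1_connected[OF conn] by blast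
  moreover have "(INF c\<in>?X. curve_length A g c) < dist p q + e"
    unfolding dist_eq riemannian_distance_def using e by simp
  ultimately show ?thesis using cInf_lessD[of "curve_length A g ` ?X"] by auto
qed

lemma ex_almost_geodesic:
  fixes p q :: 'a
  assumes conn: "connected (UNIV :: 'a set)" and e: "e > 0"
  shows "\<exists>c L. almost_geodesic c L p q e"
proof -
  obtain c where c: "piecewise_C1_curve A c" "c 0 = p" "c 1 = q" "curve_length A g c < dist p q + e"
    using almost_minimizing_curve[OF conn e] by blast
  let ?L = "\<lambda>t. integral {0..t} (curve_speed A g c)"
  have "dist (c s) (c t) \<le> ?L t - ?L s" if "0 \<le> s" "s \<le> t" "t \<le> 1" for s t
  proof -
    have "curve_speed A g c integrable_on {0..t}"
      using curve_speed_integrable[OF c(1)] by (rule integrable_on_subinterval) (use that in auto)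
    from Henstock_Kurzweil_Integration.integral_combine[OF that(1,2) this]
    show ?thesis using dist_le_partial_length[OF c(1) that] by simp
  qed
  then show ?thesis
    using c piecewise_C1_continuous[OF c(1)] unfolding almost_geodesic_def curve_length_def
    by (intro exI[of _ c] exI[of _ ?L]) auto
qed

text \<open>To first order the distance is the norm of the metric at a point. The straight segment gives the
upper bound, as the metric varies by \<open>O(|y - x|)\<close> along it. For the lower bound, a curve from \<open>x\<close> to \<open>y\<close>
that stays in a ball of radius comparable to \<open>|y - x|\<close> is calibrated by the inner product at \<open>x\<close> with
the unit vector in the direction of \<open>y - x\<close>, and a curve that leaves this ball is too long anyway.\<close>

lemma chart_distance:
  assumes k: "k \<in> A" and x0: "x0 \<in> snd k ` fst k" and conn: "connected (UNIV :: 'a set)"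
  shows "\<exists>R>0. \<exists>C\<ge>0. cball x0 R \<subseteq> snd k ` fst k \<and> (\<forall>x\<in>cball x0 R. \<forall>y\<in>cball x0 R.
     \<bar>dist (chart_inv k x) (chart_inv k y) - sqrt (g k x (y - x) (y - x))\<bar> \<le> C * (norm (y - x))\<^sup>2)"
proof -
  let ?\<Omega> = "snd k ` fst k" and ?n = "\<lambda>x w. sqrt (g k x w w)"
  interpret coordinate_metric "g k" ?\<Omega> by (rule coordinate_metric[OF k(1)])
  obtain R1 where R1: "R1 > 0" "cball x0 R1 \<subseteq> ?\<Omega>" using open_chart_image[OF k] x0 open_contains_cball by blast
  define K where "K = cball x0 R1"
  have K: "compact K" "convex K" "K \<subseteq> ?\<Omega>" using R1 by (auto simp: K_def)
  obtain l where l: "l > 0" "\<And>x v. x \<in> K \<Longrightarrow> l * (norm v)\<^sup>2 \<le> g k x v v"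
    using uniformly_positive[OF K(1,3)] by blast
  obtain C where C: "C \<ge> 0" "\<And>x u v. x \<in> K \<Longrightarrow> norm (g k x u v) \<le> C * norm u * norm v"
    "\<And>x y u v. x \<in> K \<Longrightarrow> y \<in> K \<Longrightarrow> norm (g k y u v - g k x u v) \<le> C * norm (y - x) * norm u * norm v"
    using G.uniform_bound[OF K] by blast
  have n0: "0 \<le> ?n x w" if "x \<in> K" for x w using nonneg K that by auto
  have nl: "sqrt l * norm w \<le> ?n x w" if "x \<in> K" for x w
  proof -
    have "sqrt (l * (norm w)\<^sup>2) \<le> ?n x w" using l(2)[OF that] by (rule real_sqrt_le_mono)
    then show ?thesis by (simp add: real_sqrt_mult)
  qed
  have nu: "?n x w \<le> sqrt C * norm w" if "x \<in> K" for x w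
  proof -
    have "g k x w w \<le> C * (norm w)\<^sup>2" using C(2)[OF that, of w w] by (simp add: power2_eq_square mult.assoc)
    then have "?n x w \<le> sqrt (C * (norm w)\<^sup>2)" by (rule real_sqrt_le_mono)
    then show ?thesis by (simp add: real_sqrt_mult)
  qed
  have compare: "?n x v \<le> (1 + C * r / l) * ?n z v" if "x \<in> K" "z \<in> K" "norm (z - x) \<le> r" for x z v r
  proof -
    have r: "r \<ge> 0" using that(3) norm_ge_zero order_trans by blast
    have "g k x v v - g k z v v \<le> C * norm (x - z) * norm v * norm v"
      using C(3)[OF that(2,1), of v v] by simp
    also have "\<dots> \<le> C * r * (norm v)\<^sup>2"
      using that(3) C(1) by (simp add: power2_eq_square mult.assoc mult_left_mono mult_right_mono norm_minus_commute)
    also have "\<dots> = C * r / l * (l * (norm v)\<^sup>2)" using l(1) by simp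
    also have "\<dots> \<le> C * r / l * g k z v v"
      using l C r that by (intro mult_left_mono) auto
    finally have "g k x v v \<le> (1 + C * r / l) * g k z v v" by (simp add: distrib_right)
    also have "\<dots> \<le> (1 + C * r / l)\<^sup>2 * g k z v v"
    proof (rule mult_right_mono)
      have "0 \<le> C * r / l" using C r l by simp
      moreover have "1 + a \<le> (1 + a)\<^sup>2" if "0 \<le> a" for a :: real
        using that by (simp add: power2_eq_square algebra_simps)
      ultimately show "1 + C * r / l \<le> (1 + C * r / l)\<^sup>2" by blast
      show "0 \<le> g k z v v" using nonneg K that by auto
    qed
    finally have "?n x v \<le> sqrt ((1 + C * r / l)\<^sup>2 * g k z v v)" by (rule real_sqrt_le_mono)
    also have "\<dots> = \<bar>1 + C * r / l\<bar> * ?n z v" by (simp add: real_sqrt_mult)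
    also have "\<bar>1 + C * r / l\<bar> = 1 + C * r / l" using C r l by simp
    finally show ?thesis .
  qed
  \<comment> \<open>Leaving the ball of radius \<open>\<kappa> * norm w\<close> costs at least \<open>sqrt l * \<kappa> * norm w\<close>, which is no less than the
       length of \<open>w\<close> in the metric at \<open>x\<close>. The radius \<open>R\<close> below keeps all these balls inside \<open>K\<close>.\<close>
  define \<kappa> where "\<kappa> = sqrt C / sqrt l + 1"
  have \<kappa>: "\<kappa> \<ge> 1" "sqrt C \<le> sqrt l * \<kappa>" using C l by (auto simp: \<kappa>_def distrib_left)
  define R where "R = R1 / (1 + 2 * \<kappa>)"
  have R: "R > 0" "R * (1 + 2 * \<kappa>) = R1" "R \<le> R1" using R1 \<kappa> by (auto simp: R_def divide_le_eq mult_left_mono)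
  define C' where "C' = C * sqrt C * (1 + \<kappa>) / l"
  have C': "C' \<ge> 0" using C \<kappa> l by (simp add: C'_def)
  have RK: "x \<in> K" if "x \<in> cball x0 R" for x using that R by (auto simp: K_def)
  have main: "\<bar>dist (chart_inv k x) (chart_inv k y) - ?n x (y - x)\<bar> \<le> C' * (norm (y - x))\<^sup>2"
    if xy: "x \<in> cball x0 R" "y \<in> cball x0 R" for x y
  proof (cases "x = y")
    case False
    define w where "w = y - x"
    have w0: "w \<noteq> 0" using False by (simp add: w_def)
    have wR: "norm w \<le> 2 * R" using xy norm_triangle_ineq4[of "y - x0" "x - x0"]
      by (simp add: w_def dist_norm norm_minus_commute)
    define \<rho> where "\<rho> = \<kappa> * norm w"
    have \<rho>0: "\<rho> > 0" using \<kappa> w0 by (simp add: \<rho>_def)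
    have ballK: "cball x \<rho> \<subseteq> K"
    proof
      fix z assume z: "z \<in> cball x \<rho>"
      have "dist x0 z \<le> dist x0 x + dist x z" by (rule dist_triangle)
      also have "dist x0 x + dist x z \<le> R + \<kappa> * (2 * R)"
      proof (rule add_mono)
        have "dist x z \<le> \<kappa> * norm w" using z by (simp add: \<rho>_def)
        also have "\<dots> \<le> \<kappa> * (2 * R)" using wR \<kappa> by (intro mult_left_mono) auto
        finally show "dist x z \<le> \<kappa> * (2 * R)" .
      qed (use xy in simp)
      also have "\<dots> = R1" using R(2) by (simp add: algebra_simps)
      finally show "z \<in> K" by (simp add: K_def)
    qed
    have xK: "x \<in> K" "y \<in> K" using xy RK by auto
    have bound1: "C * norm w / l * ?n x w \<le> C' * (norm w)\<^sup>2" and bound2: "C * \<rho> / l * ?n x w \<le> C' * (norm w)\<^sup>2"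
    proof -
      have "C * norm w / l * ?n x w \<le> C * norm w / l * (sqrt C * norm w)"
        using nu[OF xK(1)] C l by (intro mult_left_mono) auto
      also have "\<dots> = (C * sqrt C / l * (norm w)\<^sup>2) * 1" by (simp add: power2_eq_square)
      also have "\<dots> \<le> (C * sqrt C / l * (norm w)\<^sup>2) * (1 + \<kappa>)"
        using C l \<kappa> by (intro mult_left_mono) auto
      also have "\<dots> = C' * (norm w)\<^sup>2" by (simp add: C'_def)
      finally show "C * norm w / l * ?n x w \<le> C' * (norm w)\<^sup>2" .
      have "C * \<rho> / l * ?n x w \<le> C * \<rho> / l * (sqrt C * norm w)"
        using nu[OF xK(1)] C l \<rho>0 by (intro mult_left_mono) auto
      also have "\<dots> = (C * sqrt C / l * (norm w)\<^sup>2) * \<kappa>" by (simp add: power2_eq_square \<rho>_def)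
      also have "\<dots> \<le> (C * sqrt C / l * (norm w)\<^sup>2) * (1 + \<kappa>)"
        using C l \<kappa> by (intro mult_left_mono) auto
      also have "\<dots> = C' * (norm w)\<^sup>2" by (simp add: C'_def)
      finally show "C * \<rho> / l * ?n x w \<le> C' * (norm w)\<^sup>2" .
    qed
    have seg: "closed_segment x y \<subseteq> K" using xK K(2) closed_segment_subset by blast
    have upper: "dist (chart_inv k x) (chart_inv k y) \<le> ?n x w + C' * (norm w)\<^sup>2"
    proof -
      have "dist (chart_inv k x) (chart_inv k y) \<le> (1 + C * norm w / l) * ?n x w"
      proof (rule dist_le_segment[OF k])
        show "closed_segment x y \<subseteq> ?\<Omega>" using seg K by blast
        fix z assume z: "z \<in> closed_segment x y"
        then have "norm (x - z) \<le> norm w" using dist_in_closed_segment[OF z]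
          by (simp add: w_def dist_norm norm_minus_commute)
        then show "?n z (y - x) \<le> (1 + C * norm w / l) * ?n x w"
          using compare[of z x "norm w" w] z seg xK by (auto simp: w_def)
      qed
      then show ?thesis using bound1 by (simp add: distrib_right)
    qed
    have lower: "?n x w - C' * (norm w)\<^sup>2 \<le> curve_length A g c"
      if c: "piecewise_C1_curve A c" "c 0 = chart_inv k x" "c 1 = chart_inv k y" for c
    proof -
      define V where "V = chart_inv k ` ball x \<rho>"
      have ballO: "ball x \<rho> \<subseteq> ?\<Omega>" using ballK K(3) ball_subset_cball by blast
      have Vopen: "open V" unfolding V_def by (rule open_inv_image[OF k open_ball ballO])
      have cont: "continuous_on {0..1} c" by (rule piecewise_C1_continuous[OF c(1)])
      have cballO: "cball x \<rho> \<subseteq> ?\<Omega>" using ballK K(3) by blast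
      have VU: "p \<in> fst k \<and> snd k p \<in> cball x \<rho>" if "p \<in> chart_inv k ` cball x \<rho>" for p
        using that cballO k by auto
      have Vsub: "V \<subseteq> chart_inv k ` cball x \<rho>" unfolding V_def by (intro image_mono ball_subset_cball)
      have len0: "0 \<le> integral {0..1} (curve_speed A g c)"
        by (intro integral_nonneg curve_speed_integrable c) (auto intro: curve_speed_nonneg)
      show ?thesis
      proof (cases "c ` {0..1} \<subseteq> V")
        case True
        have mem: "c t \<in> fst k" "snd k (c t) \<in> cball x \<rho>" if "t \<in> {0..1}" for t
          using True that Vsub VU by blast+
        have np: "?n x w > 0" using pos[of x w] xK K w0 by auto
        have xO: "x \<in> ?\<Omega>" using xK K by auto
        have "g k x (snd k (c 1) - snd k (c 0)) w / ?n x w \<le> (1 + C * \<rho> / l) * integral {0..1} (curve_speed A g c)"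
        proof (rule linear_displacement_le_length[OF c(1) k])
          show "c ` {0..1} \<subseteq> fst k" using mem by auto
          show "bounded_linear (\<lambda>v. g k x v w / ?n x w)"
            unfolding linear_conv_bounded_linear[symmetric]
            by (intro linearI) (simp_all add: G_simps[OF xO] add_divide_distrib)
          show "0 \<le> 1 + C * \<rho> / l" using C \<rho>0 l by simp
          fix t v assume t: "t \<in> {0..1::real}"
          have "g k x v w \<le> sqrt ((g k x v w)\<^sup>2)" by simp
          also have "\<dots> \<le> sqrt (g k x v v * g k x w w)" by (rule real_sqrt_le_mono[OF Cauchy_Schwarz[OF xO]])
          finally have "g k x v w / ?n x w \<le> ?n x v" using np by (simp add: real_sqrt_mult field_simps)
          also have "\<dots> \<le> (1 + C * \<rho> / l) * ?n (snd k (c t)) v"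
            using mem(2)[OF t] ballK by (intro compare xK) (auto simp: dist_norm norm_minus_commute)
          finally show "g k x v w / ?n x w \<le> (1 + C * \<rho> / l) * ?n (snd k (c t)) v" .
        qed simp_all
        moreover have "snd k (c 1) - snd k (c 0) = w" using c xK K k by (simp add: w_def subset_eq)
        moreover have "g k x w w / ?n x w = ?n x w" using nonneg[OF xO, of w] np by (simp add: real_div_sqrt)
        ultimately have 1: "?n x w \<le> (1 + C * \<rho> / l) * curve_length A g c" by (simp add: curve_length_def)
        show ?thesis
        proof (cases "curve_length A g c \<le> ?n x w")
          case True
          then have "C * \<rho> / l * curve_length A g c \<le> C * \<rho> / l * ?n x w"
            using C \<rho>0 l by (intro mult_left_mono) auto
          then show ?thesis using 1 bound2 by (simp add: distrib_right)
        next
          case False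
          have "0 \<le> C' * (norm w)\<^sup>2" using C' by simp
          then show ?thesis using False by linarith
        qed
      next
        case False
        \<comment> \<open>The curve leaves the ball; \<open>s\<close> is the first time at which it does.\<close>
        define T where "T = {0..1} \<inter> c -` (- V)"
        have "closed T" unfolding T_def
          by (rule continuous_closed_preimage[OF cont closed_real_atLeastAtMost]) (use Vopen in \<open>simp add: closed_Compl\<close>)
        moreover have "bounded T" by (rule bounded_subset[of "{0..1}"]) (auto simp: T_def)
        ultimately have "compact T" by (simp add: compact_eq_bounded_closed)
        moreover have "T \<noteq> {}" using False by (auto simp: T_def)
        ultimately obtain s where s: "s \<in> T" "\<And>t. t \<in> T \<Longrightarrow> s \<le> t" using compact_attains_inf[of T] by blast
        have s01: "0 \<le> s" "s \<le> 1" "c s \<notin> V" using s(1) by (auto simp: T_def)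
        have before: "c t \<in> V" if "0 \<le> t" "t < s" for t
        proof (rule ccontr)
          assume "c t \<notin> V"
          then have "t \<in> T" using that s01 by (simp add: T_def)
          then show False using s(2)[of t] that by simp
        qed
        have "c 0 \<in> V" using c(2) \<rho>0 by (auto simp: V_def)
        then have "s \<noteq> 0" using s01(3) by auto
        then have s0: "s > 0" using s01(1) by simp
        have cs: "c t \<in> chart_inv k ` cball x \<rho>" if t: "t \<in> {0..s}" for t
        proof -
          have "compact (chart_inv k ` cball x \<rho>)"
            by (intro compact_continuous_image compact_cball
                continuous_on_subset[OF homeomorphism_cont2[OF chart_homeomorphism[OF k]] cballO])
          then have cl: "closed (chart_inv k ` cball x \<rho>)" by (rule compact_imp_closed)
          have cont': "continuous_on (closure {0..<s}) c"
            using cont s0 s01 by (auto intro: continuous_on_subset)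
          have "c ` closure {0..<s} \<subseteq> chart_inv k ` cball x \<rho>"
          proof (rule image_closure_subset[OF cont' cl], rule image_subsetI)
            show "c u \<in> chart_inv k ` cball x \<rho>" if "u \<in> {0..<s}" for u
              using before[of u] that Vsub by auto
          qed
          then show ?thesis using t s0 by auto
        qed
        then have mem: "c t \<in> fst k" "snd k (c t) \<in> cball x \<rho>" if "t \<in> {0..s}" for t
          using VU that by blast+
        define z where "z = snd k (c s) - x"
        have z: "norm z \<ge> \<rho>"
        proof (rule ccontr)
          assume "\<not> norm z \<ge> \<rho>"
          then have "snd k (c s) \<in> ball x \<rho>" by (simp add: z_def dist_norm norm_minus_commute)
          moreover have "chart_inv k (snd k (c s)) = c s" using mem(1)[of s] s0 k by simp
          ultimately show False using s01(3) unfolding V_def by (metis image_eqI)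
        qed
        have nz: "norm z > 0" using z \<rho>0 by linarith
        have "(snd k (c s) - snd k (c 0)) \<bullet> z / norm z \<le> (1 / sqrt l) * integral {0..s} (curve_speed A g c)"
        proof (rule linear_displacement_le_length[OF c(1) k])
          show "c ` {0..s} \<subseteq> fst k" using mem by auto
          show "bounded_linear (\<lambda>v. v \<bullet> z / norm z)"
            by (rule bounded_linear_compose[OF bounded_linear_divide bounded_linear_inner_left])
          fix t v assume t: "t \<in> {0..s}"
          have "v \<bullet> z / norm z \<le> norm v" using nz norm_cauchy_schwarz[of v z] by (simp add: divide_le_eq)
          also have "\<dots> \<le> (1 / sqrt l) * ?n (snd k (c t)) v"
            using nl[of "snd k (c t)" v] mem(2)[OF t] ballK l by (auto simp: field_simps)
          finally show "v \<bullet> z / norm z \<le> (1 / sqrt l) * ?n (snd k (c t)) v" .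
        qed (use s0 s01 l in auto)
        moreover have "snd k (c s) - snd k (c 0) = z" using c xK K k by (simp add: z_def subset_eq)
        moreover have "z \<bullet> z / norm z = norm z" using nz by (simp add: dot_square_norm power2_eq_square)
        ultimately have "norm z \<le> (1 / sqrt l) * integral {0..s} (curve_speed A g c)" by simp
        also have "\<dots> \<le> (1 / sqrt l) * curve_length A g c"
          unfolding curve_length_def using l s01 s0 curve_speed_nonneg[of c] curve_speed_integrable[OF c(1)]
          by (intro mult_left_mono integral_subset_le integrable_on_subinterval[OF curve_speed_integrable[OF c(1)]]) auto
        finally have "norm z \<le> (1 / sqrt l) * curve_length A g c" .
        then have "sqrt l * norm z \<le> curve_length A g c" using l by (simp add: field_simps)
        moreover have "sqrt l * \<rho> \<le> sqrt l * norm z" using z l by (intro mult_left_mono) auto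
        ultimately have "sqrt l * \<rho> \<le> curve_length A g c" by linarith
        moreover have "?n x w \<le> sqrt l * \<rho>"
          using nu[OF xK(1), of w] \<kappa>(2) mult_right_mono[OF \<kappa>(2), of "norm w"] by (simp add: \<rho>_def mult.assoc)
        moreover have "0 \<le> C' * (norm w)\<^sup>2" using C' by simp
        ultimately show ?thesis by linarith
      qed
    qed
    have "?n x w - C' * (norm w)\<^sup>2 \<le> dist (chart_inv k x) (chart_inv k y)"
      unfolding dist_eq riemannian_distance_def
    proof (rule cINF_greatest)
      show "{c. piecewise_C1_curve A c \<and> c 0 = chart_inv k x \<and> c 1 = chart_inv k y} \<noteq> {}"
        using piecewise_C1_connected[OF conn, of "chart_inv k x" "chart_inv k y"] by blast
    qed (use lower in blast)
    then show ?thesis using upper by (simp add: w_def abs_le_iff)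
  next
    case True
    have "x \<in> ?\<Omega>" using xy RK K by blast
    then show ?thesis using True by (simp add: G_simps)
  qed
  have "cball x0 R \<subseteq> ?\<Omega>" using RK K by blast
  then have "\<exists>C\<ge>0. cball x0 R \<subseteq> snd k ` fst k \<and> (\<forall>x\<in>cball x0 R. \<forall>y\<in>cball x0 R.
     \<bar>dist (chart_inv k x) (chart_inv k y) - sqrt (g k x (y - x) (y - x))\<bar> \<le> C * (norm (y - x))\<^sup>2)"
    using C' main by blast
  then show ?thesis using R(1) by blast
qed

end

section \<open>Geodesics as solutions of a boundary value problem\<close>

lemma vector_derivative_bound:
  fixes f :: "real \<Rightarrow> 'b::real_normed_vector"
  assumes f: "\<And>t. t \<in> {a..b} \<Longrightarrow> (f has_vector_derivative f' t) (at t within {a..b})"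
    and M: "\<And>t. t \<in> {a..b} \<Longrightarrow> norm (f' t) \<le> M" and st: "s \<in> {a..b}" "t \<in> {a..b}"
  shows "norm (f t - f s) \<le> M * \<bar>t - s\<bar>"
proof -
  have "norm (f t - f s) \<le> M * norm (t - s)"
  proof (rule differentiable_bound[where S = "{a..b}" and f' = "\<lambda>t h. h *\<^sub>R f' t"])
    show "(f has_derivative (\<lambda>h. h *\<^sub>R f' t)) (at t within {a..b})" if "t \<in> {a..b}" for t
      using f[OF that] unfolding has_vector_derivative_def .
    show "onorm (\<lambda>h. h *\<^sub>R f' t) \<le> M" if "t \<in> {a..b}" for t
    proof (rule onorm_bound)
      show "0 \<le> M" using M[OF that] norm_ge_zero order_trans by blast
      show "norm (h *\<^sub>R f' t) \<le> M * norm h" for h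
        using mult_left_mono[OF M[OF that] abs_ge_zero[of h]] by (simp add: mult.commute)
    qed
  qed (use st in auto)
  then show ?thesis by simp
qed

text \<open>The data for the geodesic equation \<open>c'' = - B c c' c'\<close> on a ball: a single constant \<open>C\<close> bounds \<open>B\<close> and its
variation.\<close>

locale spray =
  fixes B :: "'e::euclidean_space \<Rightarrow> 'e \<Rightarrow> 'e \<Rightarrow> 'e" and x0 :: 'e and R C :: real
  assumes R: "R > 0" and C: "C \<ge> 0"
    and bilinear_B: "x \<in> cball x0 R \<Longrightarrow> bilinear (B x)"
    and bound_B: "x \<in> cball x0 R \<Longrightarrow> norm (B x u v) \<le> C * norm u * norm v"
    and Lipschitz_B: "x \<in> cball x0 R \<Longrightarrow> y \<in> cball x0 R \<Longrightarrow>
          norm (B y u v - B x u v) \<le> C * norm (y - x) * norm u * norm v"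
begin

text \<open>The velocity is a separate component, so that the equation of second order becomes a system of
first order.\<close>

definition geodesic :: "(real \<Rightarrow> 'e) \<Rightarrow> (real \<Rightarrow> 'e) \<Rightarrow> bool" where
  "geodesic c v \<longleftrightarrow> (\<forall>t\<in>{0..1}. c t \<in> cball x0 R \<and> (c has_vector_derivative v t) (at t within {0..1}) \<and>
      (v has_vector_derivative - B (c t) (v t) (v t)) (at t within {0..1}))"

text \<open>The scale \<open>m\<close> bounds distances of end points, and \<open>3 * m\<close> bounds velocities. With the numerical
constants chosen here the right-hand side of the geodesic equation changes by at
most \<open>15 / 100\<close> of the change of position and velocity, and a solution that starts in the ball of
radius \<open>R / 2\<close> stays in the ball of radius \<open>R\<close>.\<close>

definition small :: "real \<Rightarrow> bool" where
  "small m \<longleftrightarrow> 0 < m \<and> 100 * C * m \<le> 1 \<and> m \<le> 1 \<and> 6 * m \<le> R"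

lemma small_mono: "small m \<Longrightarrow> 0 < m' \<Longrightarrow> m' \<le> m \<Longrightarrow> small m'"
  unfolding small_def using C by (smt (verit) mult_left_mono)

lemma ex_small: "\<exists>m. small m"
proof (intro exI[of _ "min (1 / (100 * (C + 1))) (min 1 (R / 6))"])
  let ?m = "min (1 / (100 * (C + 1))) (min 1 (R / 6))"
  have "?m \<le> 1" "?m \<le> R / 6" by (simp_all add: min.coboundedI2)
  moreover have "0 < ?m" using C R by simp
  moreover have "100 * C * (1 / (100 * (C + 1))) \<le> 1" using C by (simp add: field_simps)
  then have "100 * C * min (1 / (100 * (C + 1))) (min 1 (R / 6)) \<le> 1"
    using C mult_left_mono[of "min (1 / (100 * (C + 1))) (min 1 (R / 6))" "1 / (100 * (C + 1))" "100 * C"] by linarith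
  ultimately show "small ?m" unfolding small_def by linarith
qed

lemma B_diff_bound:
  assumes x: "x \<in> cball x0 R" "y \<in> cball x0 R" and v: "norm v \<le> 3 * m" "norm w \<le> 3 * m" and m: "small m"
    and d: "norm (y - x) \<le> d" and e: "norm (w - v) \<le> e"
  shows "norm (B y w w - B x v v) \<le> (15 / 100) * (d + e)"
proof -
  have m0: "0 < m" "100 * C * m \<le> 1" "m \<le> 1" using m by (auto simp: small_def)
  have de: "0 \<le> d" "0 \<le> e" using d e norm_ge_zero order_trans by blast+
  have eq: "B y w w - B x v v = (B y w w - B x w w) + (B x w (w - v) + B x (w - v) v)"
    using bilinear_B[OF x(1)] by (simp add: bilinear_rsub bilinear_lsub)
  have "norm (B y w w - B x w w) \<le> C * norm (y - x) * norm w * norm w" by (rule Lipschitz_B[OF x])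
  also have "\<dots> \<le> C * d * (3 * m) * (3 * m)"
    using C d v m0 de by (intro mult_mono mult_nonneg_nonneg) auto
  also have "\<dots> = (9 * (C * m) * m) * d" by simp
  also have "\<dots> \<le> (9 / 100) * d"
  proof (rule mult_right_mono[OF _ de(1)])
    have "C * m * m \<le> C * m * 1" using C m0 by (intro mult_left_mono) auto
    then show "9 * (C * m) * m \<le> 9 / 100" using m0 by simp
  qed
  finally have 1: "norm (B y w w - B x w w) \<le> (9 / 100) * d" .
  have "norm (B x w (w - v)) \<le> C * norm w * norm (w - v)" by (rule bound_B[OF x(1)])
  also have "\<dots> \<le> C * (3 * m) * e" using C v e m0 by (intro mult_mono mult_nonneg_nonneg) auto
  also have "\<dots> = (3 * (C * m)) * e" by simp
  also have "\<dots> \<le> (3 / 100) * e" using m0 by (intro mult_right_mono de) auto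
  finally have 2: "norm (B x w (w - v)) \<le> (3 / 100) * e" .
  have "norm (B x (w - v) v) \<le> C * norm (w - v) * norm v" by (rule bound_B[OF x(1)])
  also have "\<dots> \<le> C * e * (3 * m)" using C v e m0 de by (intro mult_mono mult_nonneg_nonneg) auto
  also have "\<dots> = (3 * (C * m)) * e" by simp
  also have "\<dots> \<le> (3 / 100) * e" using m0 by (intro mult_right_mono de) auto
  finally have 3: "norm (B x (w - v) v) \<le> (3 / 100) * e" .
  have "norm (B y w w - B x v v) \<le> norm (B y w w - B x w w) + (norm (B x w (w - v)) + norm (B x (w - v) v))"
    unfolding eq by (intro norm_triangle_le add_left_mono norm_triangle_ineq)
  then show ?thesis using 1 2 3 de by simp
qed

lemma geodesic_continuous:
  assumes "geodesic c v" shows "continuous_on {0..1} c" "continuous_on {0..1} v"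
  using assms unfolding geodesic_def
  by (auto intro!: continuous_on_vector_derivative)

text \<open>The maxima of the differences of position and velocity bound the difference of the accelerations
with a small factor. Conversely, the mean value inequality bounds these maxima by the
differences at the two ends and the difference of the accelerations, and the latter can be absorbed.
The lemma contains the uniqueness of the solution with given ends and takes the place of
smooth dependence on the ends.\<close>

lemma geodesic_compare:
  assumes g1: "geodesic c1 v1" and g2: "geodesic c2 v2" and m: "small m"
    and v: "\<And>t. t \<in> {0..1} \<Longrightarrow> norm (v1 t) \<le> 3 * m" "\<And>t. t \<in> {0..1} \<Longrightarrow> norm (v2 t) \<le> 3 * m"
    and e: "norm (c2 0 - c1 0) \<le> e" "norm (c2 1 - c1 1) \<le> e" and t: "t \<in> {0..1}"
  shows "norm (c2 t - c1 t) \<le> 10 * e" "norm (v2 t - v1 t) \<le> 10 * e"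
proof -
  let ?d = "\<lambda>t. c2 t - c1 t" and ?w = "\<lambda>t. v2 t - v1 t"
  have dd: "(?d has_vector_derivative ?w t) (at t within {0..1})" if "t \<in> {0..1}" for t
    using g1 g2 that unfolding geodesic_def by (auto intro!: derivative_intros)
  have dw: "(?w has_vector_derivative - (B (c2 t) (v2 t) (v2 t) - B (c1 t) (v1 t) (v1 t))) (at t within {0..1})"
    if "t \<in> {0..1}" for t
    using g1 g2 that unfolding geodesic_def by (auto intro!: derivative_eq_intros)
  have "continuous_on {0..1} (\<lambda>t. norm (?d t))" "continuous_on {0..1} (\<lambda>t. norm (?w t))"
    using geodesic_continuous[OF g1] geodesic_continuous[OF g2] by (auto intro!: continuous_intros)
  then obtain s r where s: "s \<in> {0..1}" "\<And>t. t \<in> {0..1} \<Longrightarrow> norm (?d t) \<le> norm (?d s)"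
    and r: "r \<in> {0..1}" "\<And>t. t \<in> {0..1} \<Longrightarrow> norm (?w t) \<le> norm (?w r)"
    using continuous_attains_sup[of "{0..1::real}" "\<lambda>t. norm (?d t)"]
      continuous_attains_sup[of "{0..1::real}" "\<lambda>t. norm (?w t)"] by auto
  define m0 m1 where "m0 = norm (?d s)" and "m1 = norm (?w r)"
  define m2 where "m2 = (15 / 100) * (m0 + m1)"
  have dw': "norm (- (B (c2 t) (v2 t) (v2 t) - B (c1 t) (v1 t) (v1 t))) \<le> m2" if "t \<in> {0..1}" for t
    unfolding norm_minus_cancel m2_def
  proof (rule B_diff_bound[OF _ _ _ _ m])
    show "c1 t \<in> cball x0 R" "c2 t \<in> cball x0 R" using g1 g2 that unfolding geodesic_def by blast+
  qed (use v s(2) r(2) that in \<open>auto simp: m0_def m1_def\<close>)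
  have m2: "0 \<le> m2" by (simp add: m2_def m0_def m1_def)
  have "norm (?w r - (?d 1 - ?d 0)) \<le> m2"
  proof -
    have "norm ((?d 1 - 1 *\<^sub>R ?w r) - (?d 0 - 0 *\<^sub>R ?w r)) \<le> m2 * \<bar>1 - 0\<bar>"
    proof (rule vector_derivative_bound[where f = "\<lambda>t. ?d t - t *\<^sub>R ?w r" and f' = "\<lambda>t. ?w t - ?w r" and a = 0 and b = 1])
      show "((\<lambda>t. ?d t - t *\<^sub>R ?w r) has_vector_derivative ?w t - ?w r) (at t within {0..1})" if "t \<in> {0..1}" for t
        by (rule has_vector_derivative_diff[OF dd[OF that]]) (auto intro!: derivative_eq_intros)
      fix t :: real assume t: "t \<in> {0..1}"
      have "norm (?w t - ?w r) \<le> m2 * \<bar>t - r\<bar>"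
        using vector_derivative_bound[where f = ?w and a = 0 and b = 1, OF dw dw' r(1) t] .
      also have "\<dots> \<le> m2 * 1" using t r(1) by (intro mult_left_mono m2) auto
      finally show "norm (?w t - ?w r) \<le> m2" by simp
    qed auto
    then have "norm ((?d 1 - 1 *\<^sub>R ?w r) - (?d 0 - 0 *\<^sub>R ?w r)) \<le> m2" by simp
    moreover have "(?d 1 - 1 *\<^sub>R ?w r) - (?d 0 - 0 *\<^sub>R ?w r) = - (?w r - (?d 1 - ?d 0))" by simp
    ultimately show ?thesis by (metis norm_minus_cancel)
  qed
  moreover have "norm (?w r) \<le> norm (?w r - (?d 1 - ?d 0)) + norm (?d 1 - ?d 0)"
    using norm_triangle_sub[of "?w r" "?d 1 - ?d 0"] by linarith
  moreover have "norm (?d 1 - ?d 0) \<le> norm (?d 1) + norm (?d 0)" by (rule norm_triangle_ineq4)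
  ultimately have m1: "m1 \<le> 2 * e + m2" using e by (simp add: m1_def)
  have "norm (?d s - ?d 0) \<le> m1 * \<bar>s - 0\<bar>"
    by (rule vector_derivative_bound[where f = ?d and a = 0 and b = 1, OF dd])
      (use r(2) s(1) in \<open>auto simp: m1_def\<close>)
  also have "\<dots> \<le> m1 * 1" using s(1) by (intro mult_left_mono) (auto simp: m1_def)
  finally have "norm (?d s - ?d 0) \<le> m1" by simp
  moreover have "norm (?d s) \<le> norm (?d s - ?d 0) + norm (?d 0)"
    using norm_triangle_sub[of "?d s" "?d 0"] by linarith
  ultimately have "m0 \<le> e + m1" using e by (simp add: m0_def)
  moreover have "0 \<le> e" using e(1) norm_ge_zero order_trans by blast
  ultimately have le: "m0 + m1 \<le> 10 * e" using m1 unfolding m2_def by argo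
  have "0 \<le> m0" "0 \<le> m1" by (simp_all add: m0_def m1_def)
  then show "norm (?d t) \<le> 10 * e" "norm (?w t) \<le> 10 * e"
    using s(2)[OF t] r(2)[OF t] le m0_def m1_def by linarith+
qed

text \<open>A curve with given ends is determined by its acceleration \<open>a\<close>: it is the second iterated integral
of \<open>a\<close>, corrected by an affine function. This turns the boundary value problem into a fixed point
problem for \<open>a\<close> in a Banach space of continuous functions.\<close>

abbreviation A1 :: "(real \<Rightarrow>\<^sub>C 'e) \<Rightarrow> real \<Rightarrow> 'e" where
  "A1 a t \<equiv> integral {0..t} (apply_bcontfun a)"

abbreviation A2 :: "(real \<Rightarrow>\<^sub>C 'e) \<Rightarrow> real \<Rightarrow> 'e" where
  "A2 a t \<equiv> integral {0..t} (A1 a)"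

lemma cont_a: "continuous_on S (apply_bcontfun (a :: real \<Rightarrow>\<^sub>C 'e))"
  by (intro continuous_on_apply_bcontfun continuous_on_id)

lemma dA1: "t \<in> {0..1} \<Longrightarrow> (A1 a has_vector_derivative a t) (at t within {0..1})"
  by (rule integral_has_vector_derivative[OF cont_a])

lemma cont_A1: "continuous_on {0..1} (A1 a)"
  using dA1 by (rule continuous_on_vector_derivative)

lemma dA2: "t \<in> {0..1} \<Longrightarrow> (A2 a has_vector_derivative A1 a t) (at t within {0..1})"
  by (rule integral_has_vector_derivative[OF cont_A1])

lemma A1_diff_bound: assumes t: "t \<in> {0..1}" shows "norm (A1 a t - A1 b t) \<le> dist a b"
proof -
  have "norm ((A1 a t - A1 b t) - (A1 a 0 - A1 b 0)) \<le> dist a b * \<bar>t - 0\<bar>"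
    by (rule vector_derivative_bound[where a = 0 and b = 1 and f = "\<lambda>t. A1 a t - A1 b t" and f' = "\<lambda>t. a t - b t"])
      (use t in \<open>auto intro!: derivative_intros dA1 simp: dist_norm[symmetric] dist_bounded\<close>)
  also have "\<dots> \<le> dist a b * 1" using t by (intro mult_left_mono) auto
  finally show ?thesis by simp
qed

lemma A2_diff_bound: assumes t: "t \<in> {0..1}" shows "norm (A2 a t - A2 b t) \<le> dist a b"
proof -
  have "norm ((A2 a t - A2 b t) - (A2 a 0 - A2 b 0)) \<le> dist a b * \<bar>t - 0\<bar>"
    by (rule vector_derivative_bound[where a = 0 and b = 1 and f = "\<lambda>t. A2 a t - A2 b t" and f' = "\<lambda>t. A1 a t - A1 b t"])
      (use t in \<open>auto intro!: derivative_intros dA2 A1_diff_bound\<close>)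
  also have "\<dots> \<le> dist a b * 1" using t by (intro mult_left_mono) auto
  finally show ?thesis by simp
qed

lemma A1_bound: "t \<in> {0..1} \<Longrightarrow> norm (A1 a t) \<le> norm a" and A2_bound: "t \<in> {0..1} \<Longrightarrow> norm (A2 a t) \<le> norm a"
  using A1_diff_bound[of t a 0] A2_diff_bound[of t a 0] by simp_all

definition curve :: "'e \<Rightarrow> 'e \<Rightarrow> (real \<Rightarrow>\<^sub>C 'e) \<Rightarrow> real \<Rightarrow> 'e" where
  "curve x y a t = x + t *\<^sub>R (y - x) + A2 a t - t *\<^sub>R A2 a 1"

definition velocity :: "'e \<Rightarrow> 'e \<Rightarrow> (real \<Rightarrow>\<^sub>C 'e) \<Rightarrow> real \<Rightarrow> 'e" where
  "velocity x y a t = (y - x) + A1 a t - A2 a 1"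

lemma curve_deriv: "t \<in> {0..1} \<Longrightarrow> (curve x y a has_vector_derivative velocity x y a t) (at t within {0..1})"
  unfolding curve_def[abs_def] velocity_def
  by (rule derivative_eq_intros dA2 refl | assumption | simp)+

lemma velocity_deriv: "t \<in> {0..1} \<Longrightarrow> (velocity x y a has_vector_derivative a t) (at t within {0..1})"
  unfolding velocity_def[abs_def] by (auto intro!: derivative_eq_intros dA1)

lemma curve_ends: "curve x y a 0 = x" "curve x y a 1 = y"
  by (simp_all add: curve_def)

lemma curve_velocity_bounds:
  assumes x: "x \<in> cball x0 (R / 2)" "norm (y - x) \<le> m" and m: "small m" and a: "norm a \<le> m" and t: "t \<in> {0..1}"
  shows "curve x y a t \<in> cball x0 R" "norm (velocity x y a t) \<le> 3 * m"
proof -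
  have t1: "\<bar>t\<bar> \<le> 1" using t by auto
  have "norm (curve x y a t - x) \<le> norm (t *\<^sub>R (y - x)) + norm (A2 a t) + norm (t *\<^sub>R A2 a 1)"
    unfolding curve_def by (rule order_trans[OF _ order_trans[OF norm_triangle_ineq4 add_right_mono[OF norm_triangle_ineq]]]) simp
  also have "\<dots> \<le> m + m + m"
    using mult_mono[OF t1 x(2)] mult_mono[OF t1 A2_bound[of 1 a]] A2_bound[OF t, of a] a by simp
  finally have "dist x (curve x y a t) \<le> 3 * m" by (simp add: dist_norm norm_minus_commute)
  moreover have "6 * m \<le> R" using m by (simp add: small_def)
  ultimately show "curve x y a t \<in> cball x0 R"
    using x(1) dist_triangle[of x0 "curve x y a t" x] by simp
  have "norm (velocity x y a t) \<le> norm (y - x) + norm (A1 a t) + norm (A2 a 1)"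
    unfolding velocity_def by (rule order_trans[OF norm_triangle_ineq4 add_right_mono[OF norm_triangle_ineq]])
  then show "norm (velocity x y a t) \<le> 3 * m"
    using x(2) A1_bound[OF t, of a] A2_bound[of 1 a] a by simp
qed

lemma geodesic_exists:
  assumes x: "x \<in> cball x0 (R / 2)" "norm (y - x) \<le> m" and m: "small m"
  shows "\<exists>c v. geodesic c v \<and> c 0 = x \<and> c 1 = y \<and> (\<forall>t\<in>{0..1}. norm (v t) \<le> 3 * m)"
proof -
  \<comment> \<open>Stopping the time at \<open>0\<close> and \<open>1\<close> extends an acceleration on the unit interval to a bounded continuous
       function on the line.\<close>
  define cl :: "real \<Rightarrow> real" where "cl t = max 0 (min 1 t)" for t
  have cl: "cl t \<in> {0..1}" for t by (auto simp: cl_def)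
  have cl_cont: "continuous_on UNIV cl" unfolding cl_def[abs_def] by (intro continuous_intros)
  have cl_id: "cl t = t" if "t \<in> {0..1}" for t using that by (auto simp: cl_def)
  define F where "F a t = - B (curve x y a (cl t)) (velocity x y a (cl t)) (velocity x y a (cl t))" for a t
  have m0: "0 < m" "100 * C * m \<le> 1" using m by (auto simp: small_def)
  have bound: "norm (F a t) \<le> m" if a: "norm a \<le> m" for a t
  proof -
    note b = curve_velocity_bounds[OF x m a cl, of t]
    have "norm (F a t) \<le> C * norm (velocity x y a (cl t)) * norm (velocity x y a (cl t))"
      unfolding F_def norm_minus_cancel by (rule bound_B[OF b(1)])
    also have "\<dots> \<le> C * (3 * m) * (3 * m)" using b(2) C m0 by (intro mult_mono mult_nonneg_nonneg) auto
    also have "\<dots> = 9 * (C * m) * m" by simp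
    also have "\<dots> \<le> 1 * m" using m0 by (intro mult_right_mono) auto
    finally show ?thesis by simp
  qed
  have cont: "continuous_on UNIV (F a)" if a: "norm a \<le> m" for a
  proof -
    have cc: "continuous_on UNIV (\<lambda>t. curve x y a (cl t))" "continuous_on UNIV (\<lambda>t. velocity x y a (cl t))"
      using continuous_on_compose2[OF continuous_on_vector_derivative[OF curve_deriv[of _ x y a]] cl_cont]
        continuous_on_compose2[OF continuous_on_vector_derivative[OF velocity_deriv[of _ x y a]] cl_cont] cl by blast+
    have "((F a) \<longlongrightarrow> F a t) (at t)" for t
    proof -
      have "((\<lambda>s. curve x y a (cl s)) \<longlongrightarrow> curve x y a (cl t)) (at t)" "((\<lambda>s. velocity x y a (cl s)) \<longlongrightarrow> velocity x y a (cl t)) (at t)"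
        using cc by (auto simp: continuous_on_eq_continuous_at isCont_def)
      then have lim: "((\<lambda>s. (15/100) * (norm (curve x y a (cl s) - curve x y a (cl t)) + norm (velocity x y a (cl s) - velocity x y a (cl t))))
         \<longlongrightarrow> (15/100) * (norm (curve x y a (cl t) - curve x y a (cl t)) + norm (velocity x y a (cl t) - velocity x y a (cl t)))) (at t)"
        by (intro tendsto_intros)
      have "((\<lambda>s. F a s - F a t) \<longlongrightarrow> 0) (at t)"
      proof (rule Lim_null_comparison)
        show "\<forall>\<^sub>F s in at t. norm (F a s - F a t) \<le> (15/100) * (norm (curve x y a (cl s) - curve x y a (cl t)) + norm (velocity x y a (cl s) - velocity x y a (cl t)))"
        proof (rule always_eventually, rule allI)
          fix s
          have "norm (F a s - F a t) = norm (B (curve x y a (cl s)) (velocity x y a (cl s)) (velocity x y a (cl s)) -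
             B (curve x y a (cl t)) (velocity x y a (cl t)) (velocity x y a (cl t)))"
            unfolding F_def by (simp add: norm_minus_commute)
          also have "\<dots> \<le> (15/100) * (norm (curve x y a (cl s) - curve x y a (cl t)) + norm (velocity x y a (cl s) - velocity x y a (cl t)))"
            by (rule B_diff_bound[OF _ _ _ _ m]) (use curve_velocity_bounds[OF x m a cl] in auto)
          finally show "norm (F a s - F a t) \<le> (15/100) * (norm (curve x y a (cl s) - curve x y a (cl t)) + norm (velocity x y a (cl s) - velocity x y a (cl t)))" .
        qed
      qed (use lim in simp)
      then show ?thesis by (simp add: LIM_zero_iff)
    qed
    then show ?thesis by (simp add: continuous_on_eq_continuous_at isCont_def)
  qed
  define \<Phi> where "\<Phi> a = Bcontfun (F a)" for a
  have \<Phi>: "apply_bcontfun (\<Phi> a) t = F a t" if a: "norm a \<le> m" for a t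
  proof -
    have "F a \<in> bcontfun" using cont[OF a] bound[OF a] by (intro bcontfun_normI) auto
    then show ?thesis by (simp add: \<Phi>_def Bcontfun_inverse)
  qed
  have "\<exists>!a. a \<in> cball 0 m \<and> \<Phi> a = a"
  proof (rule Banach_fix[where c = "6/10"])
    show "complete (cball (0 :: real \<Rightarrow>\<^sub>C 'e) m)" by (simp add: complete_eq_closed)
    show "cball (0 :: real \<Rightarrow>\<^sub>C 'e) m \<noteq> {}" using m0 by auto
    show "\<Phi> ` cball 0 m \<subseteq> cball 0 m"
      using \<Phi> bound by (auto intro!: norm_bound)
    show "dist (\<Phi> a) (\<Phi> b) \<le> 6/10 * dist a b" if "a \<in> cball 0 m" "b \<in> cball 0 m" for a b
    proof (rule dist_bound)
      fix t
      have a: "norm a \<le> m" "norm b \<le> m" using that by auto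
      have "norm (curve x y a (cl t) - curve x y b (cl t)) \<le> 2 * dist a b"
      proof -
        have 1: "norm (A2 a (cl t) - A2 b (cl t)) \<le> dist a b" by (rule A2_diff_bound[OF cl])
        have "\<bar>cl t\<bar> \<le> 1" using cl[of t] by auto
        moreover have "norm (A2 a 1 - A2 b 1) \<le> dist a b" by (rule A2_diff_bound) simp
        ultimately have 2: "norm (cl t *\<^sub>R (A2 a 1 - A2 b 1)) \<le> 1 * dist a b"
          unfolding norm_scaleR by (rule mult_mono) simp_all
        have eq: "curve x y a (cl t) - curve x y b (cl t) = (A2 a (cl t) - A2 b (cl t)) - cl t *\<^sub>R (A2 a 1 - A2 b 1)"
          by (simp add: curve_def algebra_simps)
        show ?thesis unfolding eq
          by (rule order_trans[OF norm_triangle_ineq4]) (use 1 2 in linarith)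
      qed
      moreover have "norm (velocity x y a (cl t) - velocity x y b (cl t)) \<le> 2 * dist a b"
      proof -
        have 1: "norm (A1 a (cl t) - A1 b (cl t)) \<le> dist a b" by (rule A1_diff_bound[OF cl])
        have 2: "norm (A2 a 1 - A2 b 1) \<le> dist a b" by (rule A2_diff_bound) simp
        have eq: "velocity x y a (cl t) - velocity x y b (cl t) = (A1 a (cl t) - A1 b (cl t)) - (A2 a 1 - A2 b 1)"
          by (simp add: velocity_def algebra_simps)
        show ?thesis unfolding eq
          by (rule order_trans[OF norm_triangle_ineq4]) (use 1 2 in linarith)
      qed
      ultimately have "norm (F a t - F b t) \<le> (15/100) * (2 * dist a b + 2 * dist a b)"
        unfolding F_def minus_diff_minus norm_minus_cancel
        by (intro B_diff_bound[OF _ _ _ _ m]) (use curve_velocity_bounds[OF x m _ cl] a in auto)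
      then show "dist (\<Phi> a t) (\<Phi> b t) \<le> 6/10 * dist a b"
        using \<Phi>[OF a(1)] \<Phi>[OF a(2)] by (simp add: dist_norm)
    qed
  qed simp_all
  then obtain a where a: "norm a \<le> m" "\<Phi> a = a" by auto
  have "a t = - B (curve x y a t) (velocity x y a t) (velocity x y a t)" if "t \<in> {0..1}" for t
    using \<Phi>[OF a(1), of t] a(2) cl_id[OF that] by (simp add: F_def)
  then have "geodesic (curve x y a) (velocity x y a)"
    unfolding geodesic_def using curve_velocity_bounds[OF x m a(1)] curve_deriv velocity_deriv by metis
  then show ?thesis using curve_ends curve_velocity_bounds(2)[OF x m a(1)] by blast
qed

end

section \<open>The second variation\<close>

lemma (in C1_bilinear_field) has_vector_derivative_along:
  assumes c: "(c has_vector_derivative c') (at t within S)" and S: "\<And>s. s \<in> S \<Longrightarrow> c s \<in> \<Omega>" "t \<in> S"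
    and u: "(u has_vector_derivative u') (at t within S)" and v: "(v has_vector_derivative v') (at t within S)"
  shows "((\<lambda>s. F (c s) (u s) (v s)) has_vector_derivative
     partial_derivative F (c t) c' (u t) (v t) + F (c t) u' (v t) + F (c t) (u t) v') (at t within S)"
proof -
  have ct: "c t \<in> \<Omega>" using S by blast
  have Fc: "((\<lambda>s. F (c s) i j) has_vector_derivative partial_derivative F (c t) c' i j) (at t within S)" for i j
    using vector_derivative_diff_chain_within[OF c has_derivative_at_withinI[OF has_derivative[OF ct]]]
    by (simp add: o_def)
  have ui: "((\<lambda>s. u s \<bullet> i) has_real_derivative u' \<bullet> i) (at t within S)"
    and vi: "((\<lambda>s. v s \<bullet> i) has_real_derivative v' \<bullet> i) (at t within S)" for i
    using bounded_linear.has_vector_derivative[OF bounded_linear_inner_left u, of i]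
      bounded_linear.has_vector_derivative[OF bounded_linear_inner_left v, of i]
    by (simp_all add: has_real_derivative_iff_has_vector_derivative)
  have "((\<lambda>s. \<Sum>i\<in>Basis. \<Sum>j\<in>Basis. ((u s \<bullet> i) * (v s \<bullet> j)) *\<^sub>R F (c s) i j) has_vector_derivative
     (\<Sum>i\<in>Basis. \<Sum>j\<in>Basis. ((u t \<bullet> i) * (v t \<bullet> j)) *\<^sub>R partial_derivative F (c t) c' i j
        + ((u' \<bullet> i) * (v t \<bullet> j) + (v' \<bullet> j) * (u t \<bullet> i)) *\<^sub>R F (c t) i j)) (at t within S)"
    by (intro has_vector_derivative_sum has_vector_derivative_scaleR Fc DERIV_mult ui vi)
  moreover have "(\<Sum>i\<in>Basis. \<Sum>j\<in>Basis. ((u t \<bullet> i) * (v t \<bullet> j)) *\<^sub>R partial_derivative F (c t) c' i j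
        + ((u' \<bullet> i) * (v t \<bullet> j) + (v' \<bullet> j) * (u t \<bullet> i)) *\<^sub>R F (c t) i j)
     = partial_derivative F (c t) c' (u t) (v t) + F (c t) u' (v t) + F (c t) (u t) v'"
    unfolding expand[OF ct, of u' "v t"] expand[OF ct, of "u t" v'] expand_derivative[OF ct, of "u t" "v t" c']
    by (simp add: sum.distrib scaleR_add_left mult.commute add.assoc)
  ultimately have "((\<lambda>s. \<Sum>i\<in>Basis. \<Sum>j\<in>Basis. ((u s \<bullet> i) * (v s \<bullet> j)) *\<^sub>R F (c s) i j) has_vector_derivative
     partial_derivative F (c t) c' (u t) (v t) + F (c t) u' (v t) + F (c t) (u t) v') (at t within S)" by simp
  then show ?thesis
    by (rule has_vector_derivative_transform[OF S(2), rotated]) (use S expand in simp)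
qed

text \<open>Adding \<open>M * s\<^sup>2 / 2\<close> makes the function convex.\<close>

lemma almost_convex:
  fixes f :: "real \<Rightarrow> real"
  assumes f: "\<And>t. t \<in> {0..1} \<Longrightarrow> (f has_real_derivative f' t) (at t within {0..1})"
    and f': "\<And>t. t \<in> {0..1} \<Longrightarrow> (f' has_real_derivative f'' t) (at t within {0..1})"
    and M: "\<And>t. t \<in> {0..1} \<Longrightarrow> - M \<le> f'' t" "0 \<le> M" and t: "t \<in> {0..1}"
  shows "f t \<le> (1 - t) * f 0 + t * f 1 + M"
proof (cases "t = 0 \<or> t = 1")
  case False
  then have t01: "0 < t" "t < 1" using t by auto
  define h where "h s = f s + M * s\<^sup>2 / 2" for s
  define h' where "h' s = f' s + M * s" for s
  have h: "(h has_derivative (\<lambda>x. x * h' s)) (at s within {a..b})" if "s \<in> {a..b}" "0 \<le> a" "b \<le> 1" for s a b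
  proof -
    have "(h has_real_derivative h' s) (at s within {0..1})"
      unfolding h_def[abs_def] h'_def using f[of s] that by (auto intro!: derivative_eq_intros)
    then have "(h has_real_derivative h' s) (at s within {a..b})" by (rule DERIV_subset) (use that in auto)
    then show ?thesis by (simp add: has_field_derivative_def mult.commute[of _ "h' s"])
  qed
  have h': "(h' has_derivative (\<lambda>x. x * (f'' s + M))) (at s within {a..b})" if "s \<in> {a..b}" "0 \<le> a" "b \<le> 1" for s a b
  proof -
    have "(h' has_real_derivative f'' s + M) (at s within {0..1})"
      unfolding h'_def[abs_def] using f'[of s] that by (auto intro!: derivative_eq_intros)
    then have "(h' has_real_derivative f'' s + M) (at s within {a..b})" by (rule DERIV_subset) (use that in auto)
    then show ?thesis by (simp add: has_field_derivative_def mult.commute[of _ "f'' s + M"])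
  qed
  obtain x where x: "x \<in> {0<..<t}" "h t - h 0 = (t - 0) * h' x"
    using mvt_simple[OF t01(1), of h "\<lambda>s x. x * h' s"] h[of _ 0 t] t01 by auto
  obtain y where y: "y \<in> {t<..<1}" "h 1 - h t = (1 - t) * h' y"
    using mvt_simple[OF t01(2), of h "\<lambda>s x. x * h' s"] h[of _ t 1] t01 by auto
  have xy: "x < y" using x y by auto
  obtain z where z: "z \<in> {x<..<y}" "h' y - h' x = (y - x) * (f'' z + M)"
    using mvt_simple[OF xy, of h' "\<lambda>s r. r * (f'' s + M)"] h'[of _ x y] x y by auto
  have "0 \<le> f'' z + M" using M(1)[of z] z x y by auto
  then have "h' x \<le> h' y" using z xy by (smt (verit) mult_nonneg_nonneg)
  then have "t * (1 - t) * h' x \<le> t * (1 - t) * h' y" using t01 by (intro mult_left_mono) auto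
  then have "(1 - t) * (h t - h 0) \<le> t * (h 1 - h t)" using x(2) y(2) by (simp add: mult_ac)
  then have "h t \<le> (1 - t) * h 0 + t * h 1" by (simp add: algebra_simps)
  also have "\<dots> = (1 - t) * f 0 + t * f 1 + t * (M / 2)" by (simp add: h_def algebra_simps)
  finally have "h t \<le> (1 - t) * f 0 + t * f 1 + t * (M / 2)" .
  moreover have "f t \<le> h t" using M(2) by (simp add: h_def)
  moreover have "t * (M / 2) \<le> 1 * M" using t01 M(2) by (intro mult_mono) auto
  ultimately show ?thesis by linarith
qed (use M in auto)

locale nonpositive_ball = coordinate_metric G \<Omega> + spray "christoffel G" x0 R C
  for G :: "'e::euclidean_space \<Rightarrow> 'e \<Rightarrow> 'e \<Rightarrow> real" and \<Omega> x0 R C +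
  assumes ball_subset: "cball x0 R \<subseteq> \<Omega>"
    and curvature: "x \<in> \<Omega> \<Longrightarrow> 0 \<le> G x (riemann_curvature G x u v u) v"
begin

lemma in_\<Omega>: "x \<in> cball x0 R \<Longrightarrow> x \<in> \<Omega>"
  using ball_subset by blast

abbreviation gnorm :: "'e \<Rightarrow> 'e \<Rightarrow> real" where "gnorm x v \<equiv> sqrt (G x v v)"

lemma abs_G_le: "x \<in> \<Omega> \<Longrightarrow> \<bar>G x u v\<bar> \<le> gnorm x u * gnorm x v"
  using real_sqrt_le_mono[OF Cauchy_Schwarz, of x u v] by (simp add: real_sqrt_mult)

text \<open>Let \<open>d = b - a\<close> be the difference of two geodesics in the chart, \<open>D\<close> its covariant derivative along \<open>a\<close>
and \<open>J\<close> the second one. If the distance were infinitesimal, \<open>d\<close> would be a Jacobi field, that is, \<open>J\<close> would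
equal \<open>R(v,d)v\<close>. The assumption bounds the defect \<open>J - R(v,d)v\<close> by \<open>M\<close>. As the curvature is
nonpositive, the norm of \<open>d\<close> then has second derivative at least \<open>- M\<close>, by the Cauchy-Schwarz
inequality for \<open>D\<close> and \<open>d\<close>.\<close>

lemma Jacobi_convexity_bound:
  assumes g: "geodesic a v" "geodesic b w" and t: "t \<in> {0..1}"
    and M: "\<And>s. s \<in> {0..1} \<Longrightarrow> gnorm (a s) (- (\<Gamma> (b s) (w s) (w s) - \<Gamma> (a s) (v s) (v s))
        + partial_derivative \<Gamma> (a s) (b s - a s) (v s) (v s) + \<Gamma> (a s) (w s - v s) (v s) + \<Gamma> (a s) (v s) (w s - v s)) \<le> M"
  shows "gnorm (a t) (b t - a t) \<le> (1 - t) * gnorm (a 0) (b 0 - a 0) + t * gnorm (a 1) (b 1 - a 1) + M"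
proof -
  define d where "d s = b s - a s" for s
  define e where "e s = w s - v s" for s
  define D where "D s = e s + \<Gamma> (a s) (d s) (v s)" for s
  define e' where "e' s = - (\<Gamma> (b s) (w s) (w s) - \<Gamma> (a s) (v s) (v s))" for s
  define D' where "D' s = e' s + (partial_derivative \<Gamma> (a s) (v s) (d s) (v s) + \<Gamma> (a s) (e s) (v s)
     + \<Gamma> (a s) (d s) (- \<Gamma> (a s) (v s) (v s)))" for s
  define J where "J s = D' s + \<Gamma> (a s) (v s) (D s)" for s
  have aO: "a s \<in> \<Omega>" if "s \<in> {0..1}" for s using g(1) that in_\<Omega> unfolding geodesic_def by blast
  have da: "(a has_vector_derivative v s) (at s within {0..1})"
    and dv: "(v has_vector_derivative - \<Gamma> (a s) (v s) (v s)) (at s within {0..1})" if "s \<in> {0..1}" for s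
    using g(1) that unfolding geodesic_def by blast+
  have db: "(b has_vector_derivative w s) (at s within {0..1})"
    and dw: "(w has_vector_derivative - \<Gamma> (b s) (w s) (w s)) (at s within {0..1})" if "s \<in> {0..1}" for s
    using g(2) that unfolding geodesic_def by blast+
  have dd: "(d has_vector_derivative e s) (at s within {0..1})" if "s \<in> {0..1}" for s
    unfolding d_def[abs_def] e_def by (rule has_vector_derivative_diff[OF db[OF that] da[OF that]])
  have de: "(e has_vector_derivative e' s) (at s within {0..1})" if "s \<in> {0..1}" for s
    using has_vector_derivative_diff[OF dw[OF that] dv[OF that]]
    unfolding e_def[abs_def] e'_def by (simp add: algebra_simps)
  have dD: "(D has_vector_derivative D' s) (at s within {0..1})" if s: "s \<in> {0..1}" for s
    unfolding D_def[abs_def] D'_def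
    by (rule has_vector_derivative_add[OF de[OF s] Ch.has_vector_derivative_along[OF da[OF s] aO s dd[OF s] dv[OF s]]])
  define N where "N s = G (a s) (d s) (d s)" for s
  define P where "P s = G (a s) (D s) (d s)" for s
  have N0: "0 \<le> N s" if "s \<in> {0..1}" for s unfolding N_def by (rule nonneg[OF aO[OF that]])
  have dN: "(N has_real_derivative 2 * P s) (at s within {0..1})" if s: "s \<in> {0..1}" for s
  proof -
    note O = aO[OF s]
    have "(N has_vector_derivative (partial_derivative G (a s) (v s) (d s) (d s) + G (a s) (e s) (d s) + G (a s) (d s) (e s)))
        (at s within {0..1})"
      unfolding N_def[abs_def] by (rule G.has_vector_derivative_along[OF da[OF s] aO s dd[OF s] dd[OF s]])
    moreover have "partial_derivative G (a s) (v s) (d s) (d s) + G (a s) (e s) (d s) + G (a s) (d s) (e s) = 2 * P s"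
      unfolding metric_compatible[OF O] P_def D_def G_simps[OF O]
      using sym[OF O, of "d s" "e s"] sym[OF O, of "d s" "\<Gamma> (a s) (v s) (d s)"] christoffel_sym[OF O, of "d s" "v s"] by simp
    ultimately show ?thesis by (simp add: has_real_derivative_iff_has_vector_derivative)
  qed
  have dP: "(P has_real_derivative G (a s) (D s) (D s) + G (a s) (J s) (d s)) (at s within {0..1})" if s: "s \<in> {0..1}" for s
  proof -
    note O = aO[OF s]
    have "(P has_vector_derivative (partial_derivative G (a s) (v s) (D s) (d s) + G (a s) (D' s) (d s) + G (a s) (D s) (e s)))
        (at s within {0..1})"
      unfolding P_def[abs_def] by (rule G.has_vector_derivative_along[OF da[OF s] aO s dD[OF s] dd[OF s]])
    moreover have "partial_derivative G (a s) (v s) (D s) (d s) + G (a s) (D' s) (d s) + G (a s) (D s) (e s)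
        = G (a s) (D s) (D s) + G (a s) (J s) (d s)"
    proof -
      have "G (a s) (D s) (D s) = G (a s) (D s) (e s) + G (a s) (D s) (\<Gamma> (a s) (v s) (d s))"
        using G_simps(2)[OF O, of "D s" "e s"] christoffel_sym[OF O, of "d s" "v s"] by (simp add: D_def)
      then show ?thesis unfolding metric_compatible[OF O] J_def G_simps[OF O] by simp
    qed
    ultimately show ?thesis by (simp add: has_real_derivative_iff_has_vector_derivative)
  qed
  have z01: "(0::real) \<in> {0..1}" by simp
  have M0: "0 \<le> M" by (rule order_trans[OF real_sqrt_ge_zero[OF nonneg[OF aO[OF z01]]] M[OF z01]])
  have GJ: "- (M * sqrt (N s)) \<le> G (a s) (J s) (d s)" if s: "s \<in> {0..1}" for s
  proof -
    note O = aO[OF s]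
    define E where "E = e' s + partial_derivative \<Gamma> (a s) (d s) (v s) (v s) + \<Gamma> (a s) (e s) (v s) + \<Gamma> (a s) (v s) (e s)"
    have "J s = riemann_curvature G (a s) (v s) (d s) (v s) + E"
      unfolding J_def D'_def D_def E_def riemann_curvature_def by (simp add: Ch_simps[OF O])
    then have "G (a s) (J s) (d s) = G (a s) (riemann_curvature G (a s) (v s) (d s) (v s)) (d s) + G (a s) E (d s)"
      by (simp add: G_simps[OF O])
    moreover have "0 \<le> G (a s) (riemann_curvature G (a s) (v s) (d s) (v s)) (d s)" by (rule curvature[OF O])
    moreover have "\<bar>G (a s) E (d s)\<bar> \<le> gnorm (a s) E * gnorm (a s) (d s)" by (rule abs_G_le[OF O])
    moreover have "gnorm (a s) E * gnorm (a s) (d s) \<le> M * gnorm (a s) (d s)"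
      using M[OF s] real_sqrt_ge_zero[OF nonneg[OF O, of "d s"]]
      unfolding E_def e'_def d_def e_def by (rule mult_right_mono)
    ultimately show ?thesis unfolding N_def by linarith
  qed
  \<comment> \<open>The norm is not differentiable at zeros of \<open>d\<close>; the positive number \<open>k\<close> regularizes it.\<close>
  have main: "sqrt (N t + k\<^sup>2) \<le> (1 - t) * sqrt (N 0 + k\<^sup>2) + t * sqrt (N 1 + k\<^sup>2) + M" if k: "k > 0" for k
  proof -
    define n where "n s = sqrt (N s + k\<^sup>2)" for s
    have pos: "0 < N s + k\<^sup>2" if "s \<in> {0..1}" for s using N0[OF that] k by (simp add: add_nonneg_pos)
    have n: "0 < n s" "(n s)\<^sup>2 = N s + k\<^sup>2" if "s \<in> {0..1}" for s
      unfolding n_def using pos[OF that] by simp_all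
    have dn: "(n has_real_derivative P s / n s) (at s within {0..1})" if s: "s \<in> {0..1}" for s
      unfolding n_def[abs_def] using pos[OF s] dN[OF s]
      by (auto intro!: derivative_eq_intros simp: field_simps)
    have "n t \<le> (1 - t) * n 0 + t * n 1 + M"
    proof (rule almost_convex[OF dn _ _ M0 t])
      fix s :: real assume s: "s \<in> {0..1}"
      let ?f = "(G (a s) (D s) (D s) + G (a s) (J s) (d s)) / n s - (P s)\<^sup>2 / (n s)^3"
      show "((\<lambda>s. P s / n s) has_real_derivative ?f) (at s within {0..1})"
        using n(1)[OF s]
        by (auto intro!: derivative_eq_intros dP[OF s] dn[OF s] simp: field_simps power2_eq_square power3_eq_cube)
      note O = aO[OF s]
      have "(P s)\<^sup>2 \<le> G (a s) (D s) (D s) * N s" unfolding P_def N_def by (rule Cauchy_Schwarz[OF O])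
      also have "\<dots> \<le> G (a s) (D s) (D s) * (n s)\<^sup>2"
        unfolding n(2)[OF s] by (intro mult_left_mono nonneg[OF O]) simp
      finally have "(P s)\<^sup>2 / (n s)^3 \<le> G (a s) (D s) (D s) / n s"
        using n(1)[OF s] by (simp add: field_simps power2_eq_square power3_eq_cube)
      moreover have "- M \<le> G (a s) (J s) (d s) / n s"
      proof -
        have "sqrt (N s) \<le> n s" unfolding n_def by simp
        then have "M * sqrt (N s) \<le> M * n s" by (rule mult_left_mono[OF _ M0])
        then have "- M * n s \<le> G (a s) (J s) (d s)" using GJ[OF s] by simp
        then show ?thesis using n(1)[OF s] by (simp add: pos_le_divide_eq)
      qed
      ultimately show "- M \<le> ?f" by (simp add: add_divide_distrib)
    qed
    then show ?thesis by (simp add: n_def)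
  qed
  have "((\<lambda>k. sqrt (N t + k\<^sup>2)) \<longlongrightarrow> sqrt (N t + 0\<^sup>2)) (at_right 0)"
    "((\<lambda>k. (1 - t) * sqrt (N 0 + k\<^sup>2) + t * sqrt (N 1 + k\<^sup>2) + M) \<longlongrightarrow> (1 - t) * sqrt (N 0 + 0\<^sup>2) + t * sqrt (N 1 + 0\<^sup>2) + M) (at_right 0)"
    by (intro tendsto_intros)+
  from tendsto_le[OF _ this(2,1)] main
  have "sqrt (N t + 0\<^sup>2) \<le> (1 - t) * sqrt (N 0 + 0\<^sup>2) + t * sqrt (N 1 + 0\<^sup>2) + M"
    by (auto simp: eventually_at_right_less eventually_at_filter)
  then show ?thesis by (simp add: N_def d_def)
qed

text \<open>The defect in the Jacobi equation consists of the remainder in the linearization of the Christoffel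
symbols and of terms quadratic in the differences of position and velocity. All of these are of smaller
order than \<open>h\<close>, since \<open>geodesic_compare\<close> bounds the differences by \<open>10 * h\<close>.\<close>

lemma Jacobi_convexity:
  assumes eps: "eps > 0" and m: "small m"
  shows "\<exists>h0>0. \<forall>a v b w h t. geodesic a v \<and> geodesic b w \<and> (\<forall>s\<in>{0..1}. norm (v s) \<le> 3 * m \<and> norm (w s) \<le> 3 * m) \<and>
     norm (b 0 - a 0) \<le> h \<and> norm (b 1 - a 1) \<le> h \<and> h \<le> h0 \<and> t \<in> {0..1} \<longrightarrow>
     gnorm (a t) (b t - a t) \<le> (1 - t) * gnorm (a 0) (b 0 - a 0) + t * gnorm (a 1) (b 1 - a 1) + eps * h"
proof -
  let ?K = "cball x0 R"
  have K: "compact ?K" "convex ?K" "?K \<subseteq> \<Omega>" using ball_subset by auto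
  obtain CG where CG: "CG \<ge> 0" "\<And>x u v. x \<in> ?K \<Longrightarrow> norm (G x u v) \<le> CG * norm u * norm v"
    using G.uniform_bound[OF K] by blast
  obtain CC where CC: "CC \<ge> 0" "\<And>x u v. x \<in> ?K \<Longrightarrow> norm (\<Gamma> x u v) \<le> CC * norm u * norm v"
     "\<And>x h u v. x \<in> ?K \<Longrightarrow> norm (partial_derivative \<Gamma> x h u v) \<le> CC * norm h * norm u * norm v"
    using Ch.uniform_bound[OF K] by blast
  define q where "q = eps / (sqrt CG + 1)"
  have q: "q > 0" using eps CG by (simp add: q_def add_nonneg_pos)
  have q_le: "sqrt CG * q \<le> eps"
  proof -
    have "0 < sqrt CG + 1" using CG(1) by (simp add: add_nonneg_pos)
    then have "sqrt CG * q * (sqrt CG + 1) \<le> eps * (sqrt CG + 1)" using eps by (simp add: q_def)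
    with \<open>0 < sqrt CG + 1\<close> show ?thesis by simp
  qed
  obtain r where r: "r > 0" "\<And>x y u v. x \<in> ?K \<Longrightarrow> y \<in> ?K \<Longrightarrow> norm (y - x) < r \<Longrightarrow>
      norm (\<Gamma> y u v - \<Gamma> x u v - partial_derivative \<Gamma> x (y - x) u v) \<le> (q / 180) * norm (y - x) * norm u * norm v"
    using Ch.uniform_linearization[OF K, of "q / 180"] q by auto
  define h0 where "h0 = min (r / 20) (q / (1400 * (CC + 1)))"
  have h0: "h0 > 0" "h0 \<le> r / 20" "h0 \<le> q / (1400 * (CC + 1))"
  proof -
    show "h0 > 0" using r(1) q CC(1) by (simp add: h0_def)
    show "h0 \<le> r / 20" "h0 \<le> q / (1400 * (CC + 1))"
      unfolding h0_def by (rule min.cobounded1, rule min.cobounded2)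
  qed
  have m1: "0 < m" "m \<le> 1" using m by (auto simp: small_def)
  have "gnorm (a t) (b t - a t) \<le> (1 - t) * gnorm (a 0) (b 0 - a 0) + t * gnorm (a 1) (b 1 - a 1) + eps * h"
    if g: "geodesic a v" "geodesic b w" and vw: "\<forall>s\<in>{0..1}. norm (v s) \<le> 3 * m \<and> norm (w s) \<le> 3 * m"
      and e: "norm (b 0 - a 0) \<le> h" "norm (b 1 - a 1) \<le> h" and hh: "h \<le> h0" and t: "t \<in> {0..1}" for a v b w h t
  proof (rule Jacobi_convexity_bound[OF g t])
    fix s :: real assume s: "s \<in> {0..1}"
    have hpos: "0 \<le> h" using e(1) norm_ge_zero order_trans by blast
    have aK: "a s \<in> ?K" and bK: "b s \<in> ?K" using g s unfolding geodesic_def by blast+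
    note O = in_\<Omega>[OF aK]
    have vn: "norm (v s) \<le> 3" and wn: "norm (w s) \<le> 3" using vw s m1 by fastforce+
    define d where "d = b s - a s"
    define z where "z = w s - v s"
    have dz: "norm d \<le> 10 * h" "norm z \<le> 10 * h"
      using geodesic_compare[OF g m _ _ e s] vw by (auto simp: d_def z_def)
    define X where "X = - (\<Gamma> (b s) (w s) (w s) - \<Gamma> (a s) (v s) (v s))
        + partial_derivative \<Gamma> (a s) d (v s) (v s) + \<Gamma> (a s) z (v s) + \<Gamma> (a s) (v s) z"
    define X1 where "X1 = \<Gamma> (b s) (w s) (w s) - \<Gamma> (a s) (w s) (w s) - partial_derivative \<Gamma> (a s) d (w s) (w s)"
    have w: "w s = v s + z" by (simp add: z_def)
    have X: "X = - (X1 + (partial_derivative \<Gamma> (a s) d z (w s) + partial_derivative \<Gamma> (a s) d (v s) z) + \<Gamma> (a s) z z)"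
      unfolding X_def X1_def w by (simp add: Ch_simps[OF O] Ch.derivative_simps[OF O] algebra_simps)
    have "norm X1 \<le> (q / 180) * norm d * norm (w s) * norm (w s)"
      unfolding X1_def d_def using dz(1) hh h0(2) r(1) h0(1)
      by (intro r(2)[OF aK bK]) (auto simp: d_def)
    also have "\<dots> \<le> (q / 180) * (10 * h) * 3 * 3"
      using dz wn q hpos by (intro mult_mono mult_nonneg_nonneg) auto
    also have "\<dots> = q / 2 * h" by simp
    finally have b1: "norm X1 \<le> q / 2 * h" .
    have "norm (partial_derivative \<Gamma> (a s) d z (w s)) \<le> CC * norm d * norm z * norm (w s)" by (rule CC(3)[OF aK])
    also have "\<dots> \<le> CC * (10 * h) * (10 * h) * 3"
      using dz wn CC(1) hpos by (intro mult_mono mult_nonneg_nonneg) auto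
    finally have b2: "norm (partial_derivative \<Gamma> (a s) d z (w s)) \<le> 300 * (CC * h * h)" by simp
    have "norm (partial_derivative \<Gamma> (a s) d (v s) z) \<le> CC * norm d * norm (v s) * norm z" by (rule CC(3)[OF aK])
    also have "\<dots> \<le> CC * (10 * h) * 3 * (10 * h)"
      using dz vn CC(1) hpos by (intro mult_mono mult_nonneg_nonneg) auto
    finally have b3: "norm (partial_derivative \<Gamma> (a s) d (v s) z) \<le> 300 * (CC * h * h)" by simp
    have "norm (\<Gamma> (a s) z z) \<le> CC * norm z * norm z" by (rule CC(2)[OF aK])
    also have "\<dots> \<le> CC * (10 * h) * (10 * h)"
      using dz CC(1) hpos by (intro mult_mono mult_nonneg_nonneg) auto
    finally have b4: "norm (\<Gamma> (a s) z z) \<le> 100 * (CC * h * h)" by simp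
    have "norm X \<le> norm X1 + (norm (partial_derivative \<Gamma> (a s) d z (w s)) + norm (partial_derivative \<Gamma> (a s) d (v s) z)) + norm (\<Gamma> (a s) z z)"
      unfolding X norm_minus_cancel by (intro norm_triangle_le add_mono norm_triangle_ineq order_refl)
    then have "norm X \<le> q / 2 * h + 700 * (CC * h * h)" using b1 b2 b3 b4 by linarith
    also have "700 * (CC * h * h) \<le> q / 2 * h"
    proof -
      have "(CC + 1) * h \<le> (CC + 1) * (q / (1400 * (CC + 1)))" using hh h0(3) CC(1) by (intro mult_left_mono) auto
      also have "\<dots> = q / 1400" using CC(1) by (simp add: field_simps)
      finally have "CC * h \<le> q / 1400" using hpos by (simp add: distrib_right)
      from mult_right_mono[OF this hpos] show ?thesis by simp
    qed
    finally have Xq: "norm X \<le> q * h" by (simp add: mult.commute)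
    have "gnorm (a s) X \<le> sqrt CG * norm X"
    proof -
      have "G (a s) X X \<le> CG * (norm X)\<^sup>2" using CG(2)[OF aK, of X X] by (simp add: power2_eq_square mult.assoc)
      then have "gnorm (a s) X \<le> sqrt (CG * (norm X)\<^sup>2)" by (rule real_sqrt_le_mono)
      then show ?thesis by (simp add: real_sqrt_mult)
    qed
    also have "\<dots> \<le> sqrt CG * (q * h)" using Xq CG(1) by (intro mult_left_mono) auto
    also have "\<dots> \<le> eps * h" using mult_right_mono[OF q_le hpos] by (simp add: mult.assoc)
    finally show "gnorm (a s) (- (\<Gamma> (b s) (w s) (w s) - \<Gamma> (a s) (v s) (v s))
        + partial_derivative \<Gamma> (a s) (b s - a s) (v s) (v s) + \<Gamma> (a s) (w s - v s) (v s) + \<Gamma> (a s) (v s) (w s - v s)) \<le> eps * h"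
      unfolding X_def d_def z_def .
  qed
  then show ?thesis using h0(1) by blast
qed

end

section \<open>Local convexity of the distance\<close>

definition metric_midpoint :: "'a::metric_space \<Rightarrow> 'a \<Rightarrow> 'a \<Rightarrow> bool" where
  "metric_midpoint m x y \<longleftrightarrow> dist x m = dist x y / 2 \<and> dist m y = dist x y / 2"

text \<open>Midpoints of points of \<open>S\<close> exist, but they may lie outside \<open>S\<close>. They are unique, by the inequality
with \<open>x = x'\<close> and \<open>y = y'\<close>.\<close>

definition Busemann_convex :: "'a::metric_space set \<Rightarrow> bool" where
  "Busemann_convex S \<longleftrightarrow> (\<forall>x\<in>S. \<forall>y\<in>S. \<exists>m. metric_midpoint m x y) \<and>
     (\<forall>x\<in>S. \<forall>y\<in>S. \<forall>x'\<in>S. \<forall>y'\<in>S. \<forall>m m'. metric_midpoint m x y \<and> metric_midpoint m' x' y' \<longrightarrow>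
        dist m m' \<le> (dist x x' + dist y y') / 2)"

lemma has_vector_derivative_Un:
  assumes "(f has_vector_derivative d) (at t within S)" "(f has_vector_derivative d) (at t within T)"
  shows "(f has_vector_derivative d) (at t within S \<union> T)"
  using assms unfolding has_vector_derivative_def has_derivative_within by (auto intro: Lim_Un)

lemma has_vector_derivative_isolated:
  assumes "t \<notin> closure S"
  shows "(f has_vector_derivative d) (at t within S)"
proof -
  have "t \<notin> closure (S - {t})" using assms closure_mono[of "S - {t}" S] by blast
  then have "at t within S = bot" by (simp add: at_within_eq_bot_iff)
  then show ?thesis
    unfolding has_vector_derivative_def has_derivative_within by (simp add: bounded_linear_scaleR_left)
qed

lemma concat_has_vector_derivative:
  fixes f1 f2 :: "real \<Rightarrow> 'b::real_normed_vector"
  assumes f1: "\<And>s. s \<in> {0..1} \<Longrightarrow> (f1 has_vector_derivative d1 s) (at s within {0..1})"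
    and f2: "\<And>s. s \<in> {0..1} \<Longrightarrow> (f2 has_vector_derivative d2 s) (at s within {0..1})"
    and eq: "f1 1 = f2 0" "d1 1 = d2 0" and t: "t \<in> {0..1}"
  shows "((\<lambda>t. if t \<le> 1/2 then f1 (2 * t) else f2 (2 * t - 1)) has_vector_derivative
     (if t \<le> 1/2 then 2 *\<^sub>R d1 (2 * t) else 2 *\<^sub>R d2 (2 * t - 1))) (at t within {0..1})" (is "(?h has_vector_derivative ?d) _")
proof -
  have half: "2 * s - 1 = 0" if "s = 1/2" for s :: real using that by simp
  have L: "(?h has_vector_derivative ?d) (at t within {0..1/2})"
  proof (cases "t \<le> 1/2")
    case True
    have im: "(\<lambda>s. 2 * s) ` {0..1/2} = {0..1::real}"
      using image_mult_atLeastAtMost[of 2 0 "1/2::real"] by simp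
    have "((\<lambda>s. 2 * s) has_vector_derivative 2) (at t within {0..1/2})"
      by (auto intro!: derivative_eq_intros simp: has_real_derivative_iff_has_vector_derivative[symmetric])
    moreover have "(f1 has_vector_derivative d1 (2 * t)) (at (2 * t) within (\<lambda>s. 2 * s) ` {0..1/2})"
      unfolding im by (rule f1) (use t True in auto)
    ultimately have "(f1 \<circ> (\<lambda>s. 2 * s) has_vector_derivative 2 *\<^sub>R d1 (2 * t)) (at t within {0..1/2})"
      by (rule vector_diff_chain_within)
    then have "(?h has_vector_derivative 2 *\<^sub>R d1 (2 * t)) (at t within {0..1/2})"
      by (rule has_vector_derivative_transform[rotated 2]) (use True t in auto)
    then show ?thesis using True by simp
  next
    case False
    then show ?thesis by (intro has_vector_derivative_isolated) auto
  qed
  have Rr: "(?h has_vector_derivative ?d) (at t within {1/2..1})"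
  proof (cases "1/2 \<le> t")
    case True
    have im: "(\<lambda>s. 2 * s - 1) ` {1/2..1} = {0..1::real}"
      using image_affinity_atLeastAtMost_diff[of 2 1 "1/2::real" 1] by simp
    have "((\<lambda>s. 2 * s - 1) has_vector_derivative 2) (at t within {1/2..1})"
      by (auto intro!: derivative_eq_intros simp: has_real_derivative_iff_has_vector_derivative[symmetric])
    moreover have "(f2 has_vector_derivative d2 (2 * t - 1)) (at (2 * t - 1) within (\<lambda>s. 2 * s - 1) ` {1/2..1})"
      unfolding im by (rule f2) (use t True in auto)
    ultimately have "(f2 \<circ> (\<lambda>s. 2 * s - 1) has_vector_derivative 2 *\<^sub>R d2 (2 * t - 1)) (at t within {1/2..1})"
      by (rule vector_diff_chain_within)
    then have "(?h has_vector_derivative 2 *\<^sub>R d2 (2 * t - 1)) (at t within {1/2..1})"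
    proof (rule has_vector_derivative_transform[rotated 2])
      fix s :: real assume "s \<in> {1/2..1}"
      then consider "s = 1/2" | "s > 1/2" by fastforce
      then show "?h s = (f2 \<circ> (\<lambda>s. 2 * s - 1)) s"
      proof cases
        case 1
        show ?thesis unfolding 1 using eq by simp
      qed simp
    qed (use True t in auto)
    moreover have "2 *\<^sub>R d2 (2 * t - 1) = ?d"
    proof (cases "t = 1/2")
      case True
      show ?thesis unfolding True using eq by simp
    qed (use True in auto)
    ultimately show ?thesis by simp
  next
    case False
    then show ?thesis by (intro has_vector_derivative_isolated) auto
  qed
  have "{0..1/2} \<union> {1/2..1} = {0..1::real}" by auto
  then show ?thesis using has_vector_derivative_Un[OF L Rr] by simp
qed

lemma dist_chain_le: "dist (f 0) (f n) \<le> (\<Sum>i<n. dist (f i) (f (Suc i)))" for f :: "nat \<Rightarrow> 'a::metric_space"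
proof (induction n)
  case (Suc n)
  have "dist (f 0) (f (Suc n)) \<le> dist (f 0) (f n) + dist (f n) (f (Suc n))" by (rule dist_triangle)
  then show ?case using Suc by simp
qed simp

lemma almost_geodesic_sum_le:
  assumes "almost_geodesic c L p q e" "n > 0"
  shows "(\<Sum>i<n. dist (c (real i / real n)) (c (real (Suc i) / real n))) \<le> dist p q + e"
proof -
  have "(\<Sum>i<n. dist (c (real i / real n)) (c (real (Suc i) / real n)))
      \<le> (\<Sum>i<n. L (real (Suc i) / real n) - L (real i / real n))"
  proof (rule sum_mono)
    fix i assume "i \<in> {..<n}"
    then have "0 \<le> real i / real n" "real i / real n \<le> real (Suc i) / real n" "real (Suc i) / real n \<le> 1"
      by (auto simp: divide_simps)
    then show "dist (c (real i / real n)) (c (real (Suc i) / real n)) \<le> L (real (Suc i) / real n) - L (real i / real n)"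
      using assms(1) unfolding almost_geodesic_def by blast
  qed
  also have "\<dots> = L 1 - L 0" using sum_lessThan_telescope[of "\<lambda>i. L (real i / real n)" n] assms(2) by simp
  also have "\<dots> \<le> dist p q + e" using assms(1) unfolding almost_geodesic_def by blast
  finally show ?thesis .
qed

lemma almost_geodesic_dist_le:
  assumes "almost_geodesic c L p q e" "0 \<le> s" "s \<le> 1"
  shows "dist p (c s) \<le> dist p q + e"
proof -
  have "dist (c 0) (c s) \<le> L s - L 0" "dist (c s) (c 1) \<le> L 1 - L s" "L 1 - L 0 \<le> dist p q + e" "c 0 = p"
    using assms unfolding almost_geodesic_def by auto
  moreover from this(2) have "0 \<le> L 1 - L s" using zero_le_dist order_trans by blast
  ultimately have "dist (c 0) (c s) \<le> dist p q + e" by linarith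
  then show ?thesis using \<open>c 0 = p\<close> by simp
qed

text \<open>The point \<open>\<psi> x\<close> of the metric space has coordinates \<open>x\<close>. The distance is given by the metric to first
order, it is comparable to the Euclidean one, and it is a length distance. Curves and their
lengths do not occur any more.\<close>

locale metric_ball = nonpositive_ball G \<Omega> x0 R C
  for G :: "'e::euclidean_space \<Rightarrow> 'e \<Rightarrow> 'e \<Rightarrow> real" and \<Omega> x0 R C +
  fixes \<psi> :: "'e \<Rightarrow> 'a::metric_space" and Cd La :: real
  assumes Cd: "Cd \<ge> 0" and La: "La > 0"
    and crude: "x \<in> cball x0 R \<Longrightarrow> y \<in> cball x0 R \<Longrightarrow>
       \<bar>dist (\<psi> x) (\<psi> y) - gnorm x (y - x)\<bar> \<le> Cd * (norm (y - x))\<^sup>2"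
    and bilipschitz: "x \<in> cball x0 R \<Longrightarrow> y \<in> cball x0 R \<Longrightarrow> norm (y - x) \<le> La * dist (\<psi> x) (\<psi> y)"
    and open_ball_image: "0 < r \<Longrightarrow> r \<le> R \<Longrightarrow> open (\<psi> ` ball x0 r)"
    and ex_almost: "0 < e \<Longrightarrow> \<exists>c L. almost_geodesic c L (p :: 'a) q e"
begin

lemma geodesic_in_ball: "geodesic c v \<Longrightarrow> t \<in> {0..1} \<Longrightarrow> c t \<in> cball x0 R"
  unfolding geodesic_def by blast

text \<open>The quadratic error of the first-order formula for the distance is a small fraction of the gap
between the two geodesics, once this gap is small enough.\<close>

lemma convexity_step:
  assumes eps: "eps > 0" and m: "small m"
  shows "\<exists>h1>0. \<forall>a v b w t. geodesic a v \<and> geodesic b w \<and> (\<forall>s\<in>{0..1}. norm (v s) \<le> 3 * m \<and> norm (w s) \<le> 3 * m) \<and>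
     dist (\<psi> (a 0)) (\<psi> (b 0)) \<le> h1 \<and> dist (\<psi> (a 1)) (\<psi> (b 1)) \<le> h1 \<and> t \<in> {0..1} \<longrightarrow>
     dist (\<psi> (a t)) (\<psi> (b t)) \<le> (1 - t) * dist (\<psi> (a 0)) (\<psi> (b 0)) + t * dist (\<psi> (a 1)) (\<psi> (b 1))
       + eps * (dist (\<psi> (a 0)) (\<psi> (b 0)) + dist (\<psi> (a 1)) (\<psi> (b 1)))"
proof -
  define q where "q = eps / (2 * La)"
  have q: "q > 0" using eps La by (simp add: q_def)
  obtain h0 where h0: "h0 > 0" "\<And>a v b w h t. geodesic a v \<Longrightarrow> geodesic b w \<Longrightarrow>
       (\<forall>s\<in>{0..1}. norm (v s) \<le> 3 * m \<and> norm (w s) \<le> 3 * m) \<Longrightarrow>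
     norm (b 0 - a 0) \<le> h \<Longrightarrow> norm (b 1 - a 1) \<le> h \<Longrightarrow> h \<le> h0 \<Longrightarrow> t \<in> {0..1} \<Longrightarrow>
     gnorm (a t) (b t - a t) \<le> (1 - t) * gnorm (a 0) (b 0 - a 0) + t * gnorm (a 1) (b 1 - a 1) + q * h"
    using Jacobi_convexity[OF q m] by metis
  define h2 where "h2 = min h0 (q / (101 * (Cd + 1)))"
  have h2: "h2 > 0" "h2 \<le> h0" "h2 \<le> q / (101 * (Cd + 1))"
  proof -
    show "h2 > 0" using h0(1) q Cd by (simp add: h2_def)
    show "h2 \<le> h0" "h2 \<le> q / (101 * (Cd + 1))"
      unfolding h2_def by (rule min.cobounded1, rule min.cobounded2)
  qed
  have "dist (\<psi> (a t)) (\<psi> (b t)) \<le> (1 - t) * dist (\<psi> (a 0)) (\<psi> (b 0)) + t * dist (\<psi> (a 1)) (\<psi> (b 1))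
       + eps * (dist (\<psi> (a 0)) (\<psi> (b 0)) + dist (\<psi> (a 1)) (\<psi> (b 1)))"
    if g: "geodesic a v" "geodesic b w" and vw: "\<forall>s\<in>{0..1}. norm (v s) \<le> 3 * m \<and> norm (w s) \<le> 3 * m"
      and d: "dist (\<psi> (a 0)) (\<psi> (b 0)) \<le> h2 / (2 * La)" "dist (\<psi> (a 1)) (\<psi> (b 1)) \<le> h2 / (2 * La)"
      and t: "t \<in> {0..1}" for a v b w t
  proof -
    have z: "(0::real) \<in> {0..1}" "(1::real) \<in> {0..1}" by auto
    note a0 = geodesic_in_ball[OF g(1) z(1)] and a1 = geodesic_in_ball[OF g(1) z(2)]
      and b0 = geodesic_in_ball[OF g(2) z(1)] and b1 = geodesic_in_ball[OF g(2) z(2)]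
    let ?D0 = "dist (\<psi> (a 0)) (\<psi> (b 0))" and ?D1 = "dist (\<psi> (a 1)) (\<psi> (b 1))"
    define h where "h = La * (?D0 + ?D1)"
    have "La * ?D0 \<le> h" "La * ?D1 \<le> h" using La by (auto simp: h_def)
    then have e: "norm (b 0 - a 0) \<le> h" "norm (b 1 - a 1) \<le> h"
      using bilipschitz[OF a0 b0] bilipschitz[OF a1 b1] by linarith+
    have hpos: "0 \<le> h" using e(1) norm_ge_zero order_trans by blast
    have "La * (?D0 + ?D1) \<le> La * (h2 / (2 * La) + h2 / (2 * La))" using d La by (intro mult_left_mono) auto
    then have hh: "h \<le> h2" using La by (simp add: h_def field_simps)
    have small_h: "101 * Cd * h\<^sup>2 \<le> q * h"
    proof -
      have "(101 * (Cd + 1)) * h \<le> (101 * (Cd + 1)) * (q / (101 * (Cd + 1)))"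
        using hh h2(3) Cd by (intro mult_left_mono) auto
      also have "\<dots> = q" using Cd by simp
      finally have "101 * Cd * h \<le> q" using hpos by (simp add: algebra_simps)
      from mult_right_mono[OF this hpos] show ?thesis by (simp add: power2_eq_square mult.assoc)
    qed
    have dt: "norm (b t - a t) \<le> 10 * h"
      by (rule geodesic_compare(1)[OF g m _ _ e t]) (use vw in auto)
    have sq: "(norm (b t - a t))\<^sup>2 \<le> (10 * h)\<^sup>2" "(norm (b 0 - a 0))\<^sup>2 \<le> h\<^sup>2" "(norm (b 1 - a 1))\<^sup>2 \<le> h\<^sup>2"
      by (rule power_mono[OF dt norm_ge_zero], rule power_mono[OF e(1) norm_ge_zero], rule power_mono[OF e(2) norm_ge_zero])
    have g0: "gnorm (a 0) (b 0 - a 0) \<le> ?D0 + Cd * h\<^sup>2"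
      using crude[OF a0 b0] mult_left_mono[OF sq(2) Cd] by linarith
    have g1: "gnorm (a 1) (b 1 - a 1) \<le> ?D1 + Cd * h\<^sup>2"
      using crude[OF a1 b1] mult_left_mono[OF sq(3) Cd] by linarith
    have "dist (\<psi> (a t)) (\<psi> (b t)) \<le> gnorm (a t) (b t - a t) + Cd * (10 * h)\<^sup>2"
      using crude[OF geodesic_in_ball[OF g(1) t] geodesic_in_ball[OF g(2) t]] mult_left_mono[OF sq(1) Cd] by linarith
    also have "gnorm (a t) (b t - a t) \<le> (1 - t) * gnorm (a 0) (b 0 - a 0) + t * gnorm (a 1) (b 1 - a 1) + q * h"
      by (rule h0(2)[OF g vw e _ t]) (use hh h2 in linarith)
    also have "(1 - t) * gnorm (a 0) (b 0 - a 0) + t * gnorm (a 1) (b 1 - a 1)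
        \<le> (1 - t) * (?D0 + Cd * h\<^sup>2) + t * (?D1 + Cd * h\<^sup>2)"
      using g0 g1 t by (intro add_mono mult_left_mono) auto
    also have "\<dots> = (1 - t) * ?D0 + t * ?D1 + Cd * h\<^sup>2" by (simp add: algebra_simps)
    finally have "dist (\<psi> (a t)) (\<psi> (b t)) \<le> (1 - t) * ?D0 + t * ?D1 + 101 * Cd * h\<^sup>2 + q * h"
      by (simp add: power2_eq_square)
    also have "\<dots> \<le> (1 - t) * ?D0 + t * ?D1 + 2 * q * h" using small_h by linarith
    also have "2 * q * h = eps * (?D0 + ?D1)" using La by (simp add: q_def h_def)
    finally show ?thesis by simp
  qed
  then show ?thesis using h2(1) La by (intro exI[of _ "h2 / (2 * La)"]) auto
qed

text \<open>Join the initial points of the two geodesics by an almost geodesic curve, likewise the terminal points,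
cut both curves into many short steps and connect corresponding points by geodesics. Consecutive
geodesics are close, so \<open>convexity_step\<close> applies with an error at most \<open>e\<close> times their
gap at the ends. These gaps add up to little more than the distances of the given ends, hence the
total error tends to \<open>0\<close> with \<open>e\<close>.\<close>

lemma convexity:
  assumes m: "small m" and r1: "r1 > 0" "ball (\<psi> x0) r1 \<subseteq> \<psi> ` ball x0 (m / 2)"
    and g: "geodesic a v" "geodesic b w" and vw: "\<forall>s\<in>{0..1}. norm (v s) \<le> 3 * m \<and> norm (w s) \<le> 3 * m"
    and ends: "\<psi> (a 0) \<in> ball (\<psi> x0) (r1 / 4)" "\<psi> (a 1) \<in> ball (\<psi> x0) (r1 / 4)"
       "\<psi> (b 0) \<in> ball (\<psi> x0) (r1 / 4)" "\<psi> (b 1) \<in> ball (\<psi> x0) (r1 / 4)"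
    and t: "t \<in> {0..1}"
  shows "dist (\<psi> (a t)) (\<psi> (b t)) \<le> (1 - t) * dist (\<psi> (a 0)) (\<psi> (b 0)) + t * dist (\<psi> (a 1)) (\<psi> (b 1))"
proof -
  let ?D0 = "dist (\<psi> (a 0)) (\<psi> (b 0))" and ?D1 = "dist (\<psi> (a 1)) (\<psi> (b 1))"
  have mR: "0 < m" "6 * m \<le> R" using m by (auto simp: small_def)
  have approx: "dist (\<psi> (a t)) (\<psi> (b t)) \<le> (1 - t) * ?D0 + t * ?D1 + (e + e * (?D0 + ?D1 + 2 * e))"
    if e: "0 < e" "e < r1 / 4" for e
  proof -
    obtain h1 where h1: "h1 > 0" "\<And>a v b w t. geodesic a v \<Longrightarrow> geodesic b w \<Longrightarrow>
       (\<forall>s\<in>{0..1}. norm (v s) \<le> 3 * m \<and> norm (w s) \<le> 3 * m) \<Longrightarrow>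
       dist (\<psi> (a 0)) (\<psi> (b 0)) \<le> h1 \<Longrightarrow> dist (\<psi> (a 1)) (\<psi> (b 1)) \<le> h1 \<Longrightarrow> t \<in> {0..1} \<Longrightarrow>
       dist (\<psi> (a t)) (\<psi> (b t)) \<le> (1 - t) * dist (\<psi> (a 0)) (\<psi> (b 0)) + t * dist (\<psi> (a 1)) (\<psi> (b 1))
         + e * (dist (\<psi> (a 0)) (\<psi> (b 0)) + dist (\<psi> (a 1)) (\<psi> (b 1)))"
      using convexity_step[OF e(1) m] by metis
    obtain c0 L0 where c0: "almost_geodesic c0 L0 (\<psi> (a 0)) (\<psi> (b 0)) e" using ex_almost[OF e(1)] by blast
    obtain c1 L1 where c1: "almost_geodesic c1 L1 (\<psi> (a 1)) (\<psi> (b 1)) e" using ex_almost[OF e(1)] by blast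
    have stay: "c s \<in> \<psi> ` ball x0 (m / 2)"
      if c: "almost_geodesic c L p q e" and pq: "p \<in> ball (\<psi> x0) (r1 / 4)" "q \<in> ball (\<psi> x0) (r1 / 4)"
        and s: "0 \<le> s" "s \<le> 1" for c L p q s
    proof -
      have "dist (\<psi> x0) (c s) \<le> dist (\<psi> x0) p + dist p (c s)" by (rule dist_triangle)
      moreover have "dist p q \<le> dist (\<psi> x0) p + dist (\<psi> x0) q" by (metis dist_triangle dist_commute)
      ultimately have "dist (\<psi> x0) (c s) < r1"
        using almost_geodesic_dist_le[OF c s] pq e unfolding mem_ball by linarith
      then show ?thesis using r1(2) by auto
    qed
    have "uniformly_continuous_on {0..1} c0" "uniformly_continuous_on {0..1} c1"
      using c0 c1 by (auto simp: almost_geodesic_def intro: compact_uniformly_continuous)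
    then obtain d0 d1 where d0: "d0 > 0" "\<And>s s'. s \<in> {0..1} \<Longrightarrow> s' \<in> {0..1} \<Longrightarrow> dist s' s < d0 \<Longrightarrow> dist (c0 s') (c0 s) < h1"
       and d1: "d1 > 0" "\<And>s s'. s \<in> {0..1} \<Longrightarrow> s' \<in> {0..1} \<Longrightarrow> dist s' s < d1 \<Longrightarrow> dist (c1 s') (c1 s) < h1"
      using h1(1) unfolding uniformly_continuous_on_def by metis
    obtain d where d: "d > 0" "d \<le> d0" "d \<le> d1"
      using d0(1) d1(1) by (intro that[of "min d0 d1"]) auto
    obtain n where n: "real n > 1 / d" using reals_Archimedean2 by blast
    have "0 < 1 / d" using d(1) by simp
    then have "real n > 0" using n by linarith
    then have n0: "n > 0" by simp
    have "1 / real n < d" using n \<open>real n > 0\<close> d(1) by (simp add: field_simps)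
    then have n1: "1 / real n < d0" "1 / real n < d1" using d by auto
    have in01: "real i / real n \<in> {0..1}" if "i \<le> n" for i using that n0 by auto
    have "\<exists>x. x \<in> ball x0 (m / 2) \<and> \<psi> x = c0 (real i / real n)" if "i \<le> n" for i
      using stay[OF c0 ends(1,3)] in01[OF that] by (metis atLeastAtMost_iff imageE)
    then obtain xs where xs: "\<And>i. i \<le> n \<Longrightarrow> xs i \<in> ball x0 (m / 2)" "\<And>i. i \<le> n \<Longrightarrow> \<psi> (xs i) = c0 (real i / real n)"
      by metis
    have "\<exists>x. x \<in> ball x0 (m / 2) \<and> \<psi> x = c1 (real i / real n)" if "i \<le> n" for i
      using stay[OF c1 ends(2,4)] in01[OF that] by (metis atLeastAtMost_iff imageE)
    then obtain ys where ys: "\<And>i. i \<le> n \<Longrightarrow> ys i \<in> ball x0 (m / 2)" "\<And>i. i \<le> n \<Longrightarrow> \<psi> (ys i) = c1 (real i / real n)"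
      by metis
    have inR: "x \<in> cball x0 R" "x \<in> cball x0 (R / 2)" if "x \<in> ball x0 (m / 2)" for x using that mR by auto
    have inj: "x = y" if "x \<in> cball x0 R" "y \<in> cball x0 R" "\<psi> x = \<psi> y" for x y
      using bilipschitz[OF that(1,2)] that(3) by simp
    have "\<exists>c u. geodesic c u \<and> c 0 = xs i \<and> c 1 = ys i \<and> (\<forall>s\<in>{0..1}. norm (u s) \<le> 3 * m)" if "i \<le> n" for i
    proof (rule geodesic_exists[OF inR(2)[OF xs(1)[OF that]] _ m])
      show "norm (ys i - xs i) \<le> m"
        using xs(1)[OF that] ys(1)[OF that] norm_triangle_ineq4[of "ys i - x0" "xs i - x0"]
        by (simp add: dist_norm norm_minus_commute)
    qed
    then obtain gc gu where gc: "\<And>i. i \<le> n \<Longrightarrow> geodesic (gc i) (gu i) \<and> gc i 0 = xs i \<and> gc i 1 = ys i \<and> (\<forall>s\<in>{0..1}. norm (gu i s) \<le> 3 * m)"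
      by metis
    have unique: "c t = c' t" if "geodesic c u" "geodesic c' u'" "\<forall>s\<in>{0..1}. norm (u s) \<le> 3 * m" "\<forall>s\<in>{0..1}. norm (u' s) \<le> 3 * m"
      "c 0 = c' 0" "c 1 = c' 1" for c u c' u'
    proof -
      have "norm (c' t - c t) \<le> 10 * 0"
        by (rule geodesic_compare(1)[OF that(1,2) m _ _ _ _ t]) (use that in auto)
      then show ?thesis by simp
    qed
    have z: "(0::real) \<in> {0..1}" "(1::real) \<in> {0..1}" by auto
    have "xs 0 = a 0" "xs n = b 0" "ys 0 = a 1" "ys n = b 1"
      using xs ys n0 c0 c1 inR geodesic_in_ball[OF g(1)] geodesic_in_ball[OF g(2)]
      by (auto simp: almost_geodesic_def intro!: inj)
    then have first: "gc 0 t = a t" and last: "gc n t = b t"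
      using gc[of 0] gc[of n] g vw unique[of "gc 0" "gu 0" a v] unique[of "gc n" "gu n" b w] by auto
    let ?d = "\<lambda>i. dist (c0 (real i / real n)) (c0 (real (Suc i) / real n))"
    let ?d' = "\<lambda>i. dist (c1 (real i / real n)) (c1 (real (Suc i) / real n))"
    have "dist (\<psi> (a t)) (\<psi> (b t)) \<le> (\<Sum>i<n. dist (\<psi> (gc i t)) (\<psi> (gc (Suc i) t)))"
      using dist_chain_le[of "\<lambda>i. \<psi> (gc i t)" n] by (simp add: first last)
    also have "\<dots> \<le> (\<Sum>i<n. (1 - t) * ?d i + t * ?d' i + e * (?d i + ?d' i))"
    proof (rule sum_mono)
      fix i assume "i \<in> {..<n}"
      then have i: "i \<le> n" "Suc i \<le> n" by auto
      have "dist (real i / real n) (real (Suc i) / real n) = 1 / real n"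
        by (simp add: dist_real_def add_divide_distrib)
      then have "?d i < h1" "?d' i < h1" using d0(2)[OF in01[OF i(2)] in01[OF i(1)]] d1(2)[OF in01[OF i(2)] in01[OF i(1)]] n1 by auto
      then show "dist (\<psi> (gc i t)) (\<psi> (gc (Suc i) t)) \<le> (1 - t) * ?d i + t * ?d' i + e * (?d i + ?d' i)"
        using h1(2)[of "gc i" "gu i" "gc (Suc i)" "gu (Suc i)" t] gc[OF i(1)] gc[OF i(2)] xs(2)[OF i(1)] xs(2)[OF i(2)]
          ys(2)[OF i(1)] ys(2)[OF i(2)] t by simp
    qed
    also have "\<dots> = (1 - t) * (\<Sum>i<n. ?d i) + t * (\<Sum>i<n. ?d' i) + e * ((\<Sum>i<n. ?d i) + (\<Sum>i<n. ?d' i))"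
      by (simp add: sum.distrib sum_distrib_left distrib_left)
    also have "\<dots> \<le> (1 - t) * (?D0 + e) + t * (?D1 + e) + e * ((?D0 + e) + (?D1 + e))"
      using almost_geodesic_sum_le[OF c0 n0] almost_geodesic_sum_le[OF c1 n0] t e
      by (intro add_mono mult_left_mono) auto
    also have "\<dots> = (1 - t) * ?D0 + t * ?D1 + (e + e * (?D0 + ?D1 + 2 * e))" by (simp add: algebra_simps)
    finally show ?thesis .
  qed
  have lim: "((\<lambda>e. (1 - t) * ?D0 + t * ?D1 + (e + e * (?D0 + ?D1 + 2 * e))) \<longlongrightarrow> (1 - t) * ?D0 + t * ?D1 + (0 + 0 * (?D0 + ?D1 + 2 * 0))) (at_right 0)"
    by (intro tendsto_intros)
  have "\<forall>\<^sub>F e in at_right 0. dist (\<psi> (a t)) (\<psi> (b t)) \<le> (1 - t) * ?D0 + t * ?D1 + (e + e * (?D0 + ?D1 + 2 * e))"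
    using approx r1(1) eventually_at_right_real[of 0 "r1 / 4"] by (auto elim: eventually_mono)
  from tendsto_lowerbound[OF lim this] show ?thesis by simp
qed

lemma geodesic_const: "x \<in> cball x0 R \<Longrightarrow> geodesic (\<lambda>_. x) (\<lambda>_. 0)"
  unfolding geodesic_def using Ch_simps(7)[OF in_\<Omega>] by (auto intro!: derivative_eq_intros)

text \<open>Convexity for the geodesic and the constant geodesic at one of its ends.\<close>

lemma geodesic_minimizing:
  assumes m: "small m" and r1: "r1 > 0" "ball (\<psi> x0) r1 \<subseteq> \<psi> ` ball x0 (m / 2)"
    and g: "geodesic a v" and v: "\<forall>s\<in>{0..1}. norm (v s) \<le> 3 * m"
    and ends: "\<psi> (a 0) \<in> ball (\<psi> x0) (r1 / 4)" "\<psi> (a 1) \<in> ball (\<psi> x0) (r1 / 4)"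
    and t: "t \<in> {0..1}"
  shows "dist (\<psi> (a 0)) (\<psi> (a t)) \<le> t * dist (\<psi> (a 0)) (\<psi> (a 1))"
    "dist (\<psi> (a t)) (\<psi> (a 1)) \<le> (1 - t) * dist (\<psi> (a 0)) (\<psi> (a 1))"
proof -
  have m0: "0 < m" using m by (simp add: small_def)
  have z: "(0::real) \<in> {0..1}" "(1::real) \<in> {0..1}" by auto
  have c0: "geodesic (\<lambda>_. a 0) (\<lambda>_. 0)" and c1: "geodesic (\<lambda>_. a 1) (\<lambda>_. 0)"
    by (intro geodesic_const geodesic_in_ball[OF g] z)+
  show "dist (\<psi> (a 0)) (\<psi> (a t)) \<le> t * dist (\<psi> (a 0)) (\<psi> (a 1))"
    using convexity[OF m r1 c0 g _ ends(1,1,1,2) t] v m0 by simp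
  show "dist (\<psi> (a t)) (\<psi> (a 1)) \<le> (1 - t) * dist (\<psi> (a 0)) (\<psi> (a 1))"
    using convexity[OF m r1 g c1 _ ends(1,2,2,2) t] v m0 by simp
qed

lemma tendsto_gnorm:
  assumes "(f \<longlongrightarrow> x) F" "(u \<longlongrightarrow> a) F" "x \<in> \<Omega>" "\<forall>\<^sub>F s in F. f s \<in> \<Omega>"
  shows "((\<lambda>s. gnorm (f s) (u s)) \<longlongrightarrow> gnorm x a) F"
proof -
  have G: "((\<lambda>s. G (f s) i j) \<longlongrightarrow> G x i j) F" for i j
    using C1_on_continuous[OF C1_G, of i j] assms(1,3) open_\<Omega>
    by (auto simp: continuous_on_eq_continuous_at intro: isCont_tendsto_compose)
  have "((\<lambda>s. \<Sum>i\<in>Basis. \<Sum>j\<in>Basis. ((u s \<bullet> i) * (u s \<bullet> j)) *\<^sub>R G (f s) i j) \<longlongrightarrow>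
      (\<Sum>i\<in>Basis. \<Sum>j\<in>Basis. ((a \<bullet> i) * (a \<bullet> j)) *\<^sub>R G x i j)) F"
    by (intro tendsto_intros G assms)
  then have "((\<lambda>s. G (f s) (u s) (u s)) \<longlongrightarrow> G x a a) F"
    unfolding G.expand[OF assms(3), of a a, symmetric]
  proof (rule Lim_transform_eventually)
    show "\<forall>\<^sub>F s in F. (\<Sum>i\<in>Basis. \<Sum>j\<in>Basis. ((u s \<bullet> i) * (u s \<bullet> j)) *\<^sub>R G (f s) i j) = G (f s) (u s) (u s)"
      using assms(4) by eventually_elim (rule G.expand[symmetric])
  qed
  then show ?thesis by (intro tendsto_intros)
qed

lemma gnorm_scaleR: "x \<in> \<Omega> \<Longrightarrow> gnorm x (c *\<^sub>R v) = \<bar>c\<bar> * gnorm x v"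
proof -
  assume x: "x \<in> \<Omega>"
  have "G x (c *\<^sub>R v) (c *\<^sub>R v) = c\<^sup>2 * G x v v" by (simp add: G_simps[OF x] power2_eq_square)
  then show ?thesis by (simp add: real_sqrt_mult)
qed

lemma parallelogram:
  assumes x: "x \<in> \<Omega>" and "gnorm x u \<le> l / 2" "gnorm x w \<le> l / 2" "l \<le> gnorm x (u + w)"
  shows "u = w"
proof (rule ccontr)
  assume "u \<noteq> w"
  then have "0 < G x (u - w) (u - w)" using pos[OF x] by simp
  have l0: "0 \<le> l" using assms(2) real_sqrt_ge_zero[OF nonneg[OF x, of u]] by linarith
  have "(gnorm x u)\<^sup>2 \<le> (l / 2)\<^sup>2" "(gnorm x w)\<^sup>2 \<le> (l / 2)\<^sup>2" "l\<^sup>2 \<le> (gnorm x (u + w))\<^sup>2"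
    using assms(2,3,4) l0 by (auto intro!: power_mono real_sqrt_ge_zero nonneg[OF x])
  then have "G x u u \<le> l\<^sup>2 / 4" "G x w w \<le> l\<^sup>2 / 4" "l\<^sup>2 \<le> G x (u + w) (u + w)"
    using nonneg[OF x] by (simp_all add: power_divide)
  moreover have "G x (u - w) (u - w) = 2 * G x u u + 2 * G x w w - G x (u + w) (u + w)"
    by (simp add: G_simps[OF x])
  ultimately show False using \<open>0 < G x (u - w) (u - w)\<close> by linarith
qed

lemma difference_quotient:
  fixes f :: "real \<Rightarrow> 'b::real_normed_vector"
  assumes "(f has_vector_derivative d) (at 0 within {0..1})"
  shows "((\<lambda>s. (1 / s) *\<^sub>R (f s - f 0)) \<longlongrightarrow> d) (at 0 within {0..1})"
proof -
  have "((\<lambda>y. (1 / norm (y - 0)) *\<^sub>R (f y - (f 0 + (y - 0) *\<^sub>R d))) \<longlongrightarrow> 0) (at 0 within {0..1})"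
    using assms unfolding has_vector_derivative_def has_derivative_within by simp
  then have "((\<lambda>s. (1 / s) *\<^sub>R (f s - f 0) - d) \<longlongrightarrow> 0) (at 0 within {0..1})"
  proof (rule Lim_transform_eventually)
    have "\<forall>\<^sub>F y in at 0 within {0..1::real}. y \<noteq> 0 \<and> y \<in> {0..1}" by (auto simp: eventually_at_filter)
    then show "\<forall>\<^sub>F y in at 0 within {0..1}. (1 / norm (y - 0)) *\<^sub>R (f y - (f 0 + (y - 0) *\<^sub>R d)) = (1 / y) *\<^sub>R (f y - f 0) - d"
      by eventually_elim (auto simp: scaleR_diff_right scaleR_add_right divide_inverse)
  qed
  then show ?thesis by (simp add: LIM_zero_iff)
qed

text \<open>The first variation. Both curves leave \<open>z\<close> with speed at most \<open>l / 2\<close>, but their points separate with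
speed at least \<open>l\<close>; in the parallelogram law this leaves only opposite velocities.\<close>

lemma no_corner:
  assumes z: "z \<in> cball x0 R"
    and A: "(A has_vector_derivative u) (at 0 within {0..1})" "A 0 = z" "\<And>s. s \<in> {0..1} \<Longrightarrow> A s \<in> cball x0 R"
    and B: "(B' has_vector_derivative w) (at 0 within {0..1})" "B' 0 = z" "\<And>s. s \<in> {0..1} \<Longrightarrow> B' s \<in> cball x0 R"
    and dA: "\<And>s. s \<in> {0..1} \<Longrightarrow> dist (\<psi> z) (\<psi> (A s)) \<le> s * (l / 2)"
    and dB: "\<And>s. s \<in> {0..1} \<Longrightarrow> dist (\<psi> z) (\<psi> (B' s)) \<le> s * (l / 2)"
    and dAB: "\<And>s. s \<in> {0..1} \<Longrightarrow> s * l \<le> dist (\<psi> (A s)) (\<psi> (B' s))"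
  shows "w = - u"
proof -
  note zO = in_\<Omega>[OF z]
  let ?F = "at 0 within {0..1::real}"
  define X where "X s = (1 / s) *\<^sub>R (A s - z)" for s :: real
  define Y where "Y s = (1 / s) *\<^sub>R (B' s - z)" for s :: real
  have X: "(X \<longlongrightarrow> u) ?F" and Y: "(Y \<longlongrightarrow> w) ?F"
    using difference_quotient[OF A(1)] difference_quotient[OF B(1)] unfolding X_def[abs_def] Y_def[abs_def] A(2) B(2) .
  have nt: "?F \<noteq> bot" by (simp add: at_within_Icc_at_right trivial_limit_at_right_real)
  have ev: "\<forall>\<^sub>F s in ?F. s > 0 \<and> s \<in> {0..1}" by (auto simp: eventually_at_filter)
  have id0: "((\<lambda>s. s) \<longlongrightarrow> 0) ?F" by (rule tendsto_ident_at)
  have contA: "(A \<longlongrightarrow> z) ?F"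
    using has_vector_derivative_continuous[OF A(1)] A(2) unfolding continuous_within by simp
  have scale: "gnorm x ((1 / s) *\<^sub>R v) = gnorm x v / s" if "x \<in> \<Omega>" "s > 0" for x s v
    using gnorm_scaleR[OF that(1), of "1 / s" v] that(2) by simp
  have nrm: "(norm v)\<^sup>2 / s = s * (norm ((1 / s) *\<^sub>R v))\<^sup>2" if "s > 0" for s and v :: 'e
    using that by (simp add: power_mult_distrib power2_eq_square)
  have upper: "gnorm z d \<le> l / 2"
    if D: "((\<lambda>s. (1 / s) *\<^sub>R (D s - z)) \<longlongrightarrow> d) ?F" "\<And>s. s \<in> {0..1} \<Longrightarrow> D s \<in> cball x0 R"
      "\<And>s. s \<in> {0..1} \<Longrightarrow> dist (\<psi> z) (\<psi> (D s)) \<le> s * (l / 2)" for D d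
  proof -
    have 1: "((\<lambda>s. gnorm z ((1 / s) *\<^sub>R (D s - z))) \<longlongrightarrow> gnorm z d) ?F"
      by (rule tendsto_gnorm[OF tendsto_const D(1) zO]) (use zO in simp)
    have 2: "((\<lambda>s. l / 2 + Cd * (s * (norm ((1 / s) *\<^sub>R (D s - z)))\<^sup>2)) \<longlongrightarrow> l / 2 + Cd * (0 * (norm d)\<^sup>2)) ?F"
      by (intro tendsto_intros D(1) id0)
    have "\<forall>\<^sub>F s in ?F. gnorm z ((1 / s) *\<^sub>R (D s - z)) \<le> l / 2 + Cd * (s * (norm ((1 / s) *\<^sub>R (D s - z)))\<^sup>2)"
      using ev
    proof eventually_elim
      case (elim s)
      then have "gnorm z (D s - z) \<le> s * (l / 2) + Cd * (norm (D s - z))\<^sup>2"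
        using crude[OF z D(2)[of s]] D(3)[of s] by linarith
      then have "gnorm z (D s - z) / s \<le> (s * (l / 2) + Cd * (norm (D s - z))\<^sup>2) / s"
        using elim by (intro divide_right_mono) auto
      also have "\<dots> = l / 2 + Cd * ((norm (D s - z))\<^sup>2 / s)" using elim by (simp add: add_divide_distrib)
      also have "(norm (D s - z))\<^sup>2 / s = s * (norm ((1 / s) *\<^sub>R (D s - z)))\<^sup>2" using nrm elim by blast
      finally show ?case using scale[OF zO, of s "D s - z"] elim by simp
    qed
    from tendsto_le[OF nt 2 1 this] show ?thesis by simp
  qed
  have gu: "gnorm z u \<le> l / 2" by (rule upper[OF _ A(3) dA]) (use X X_def[abs_def] in simp_all)
  have gw: "gnorm z w \<le> l / 2" by (rule upper[OF _ B(3) dB]) (use Y Y_def[abs_def] in simp_all)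
  have "l \<le> gnorm z (w - u)"
  proof -
    have 1: "((\<lambda>s. gnorm (A s) (Y s - X s)) \<longlongrightarrow> gnorm z (w - u)) ?F"
      by (rule tendsto_gnorm[OF contA tendsto_diff[OF Y X] zO]) (use ev A(3) in_\<Omega> in \<open>auto elim!: eventually_mono\<close>)
    have 2: "((\<lambda>s. l - Cd * (s * (norm (Y s - X s))\<^sup>2)) \<longlongrightarrow> l - Cd * (0 * (norm (w - u))\<^sup>2)) ?F"
      by (intro tendsto_intros X Y id0)
    have "\<forall>\<^sub>F s in ?F. l - Cd * (s * (norm (Y s - X s))\<^sup>2) \<le> gnorm (A s) (Y s - X s)"
      using ev
    proof eventually_elim
      case (elim s)
      have YX: "Y s - X s = (1 / s) *\<^sub>R (B' s - A s)"
        by (simp add: X_def Y_def scaleR_diff_right)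
      have "s * l - Cd * (norm (B' s - A s))\<^sup>2 \<le> gnorm (A s) (B' s - A s)"
        using crude[OF A(3)[of s] B(3)[of s]] dAB[of s] elim by linarith
      then have "(s * l - Cd * (norm (B' s - A s))\<^sup>2) / s \<le> gnorm (A s) (B' s - A s) / s"
        using elim by (intro divide_right_mono) auto
      moreover have "(s * l - Cd * (norm (B' s - A s))\<^sup>2) / s = l - Cd * ((norm (B' s - A s))\<^sup>2 / s)"
        using elim by (simp add: diff_divide_distrib)
      moreover have "(norm (B' s - A s))\<^sup>2 / s = s * (norm (Y s - X s))\<^sup>2" unfolding YX using nrm elim by blast
      ultimately show ?case using scale[OF in_\<Omega>[OF A(3)[of s]], of s "B' s - A s"] elim by (simp add: YX)
    qed
    from tendsto_le[OF nt 1 2 this] show ?thesis by simp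
  qed
  moreover have "gnorm z (- u) = gnorm z u" by (simp add: G_simps[OF zO])
  ultimately show ?thesis using parallelogram[OF zO, of "- u" l w] gu gw by simp
qed

lemma psi_inj: "x \<in> cball x0 R \<Longrightarrow> y \<in> cball x0 R \<Longrightarrow> \<psi> x = \<psi> y \<Longrightarrow> x = y"
  using bilipschitz[of x y] by simp

text \<open>A midpoint \<open>z\<close> is joined to \<open>a 0\<close> and to \<open>a 1\<close> by geodesics. If they formed a corner at \<open>z\<close>, cutting it
would be shorter than the distance allows. Hence the velocities match, and the two halves,
run through at double speed, form a single geodesic. This is \<open>a\<close>, as geodesics with given ends
are unique.\<close>

lemma midpoint_on_geodesic:
  assumes m: "small m" and r1: "r1 > 0" "ball (\<psi> x0) r1 \<subseteq> \<psi> ` ball x0 (m / 4)"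
    and g: "geodesic a v" and v: "\<forall>s\<in>{0..1}. norm (v s) \<le> 3 * m"
    and ends: "\<psi> (a 0) \<in> ball (\<psi> x0) (r1 / 4)" "\<psi> (a 1) \<in> ball (\<psi> x0) (r1 / 4)"
    and z: "z \<in> ball (\<psi> x0) (r1 / 4)" "metric_midpoint z (\<psi> (a 0)) (\<psi> (a 1))"
  shows "z = \<psi> (a (1/2))"
proof -
  define m' where "m' = m / 2"
  have mR: "0 < m" "6 * m \<le> R" using m by (auto simp: small_def)
  have m': "small m'" by (rule small_mono[OF m]) (use mR in \<open>auto simp: m'_def\<close>)
  have r1': "ball (\<psi> x0) r1 \<subseteq> \<psi> ` ball x0 (m' / 2)" using r1(2) by (simp add: m'_def)
  have i01: "(0::real) \<in> {0..1}" "(1::real) \<in> {0..1}" "(1/2::real) \<in> {0..1}" by auto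
  have inR: "x \<in> cball x0 R" "x \<in> cball x0 (R / 2)" if "x \<in> ball x0 (m / 4)" for x using that mR by auto
  have lift: "\<exists>x. x \<in> ball x0 (m / 4) \<and> \<psi> x = p" if "p \<in> ball (\<psi> x0) (r1 / 4)" for p
  proof -
    have "p \<in> ball (\<psi> x0) r1" using that r1(1) by auto
    then show ?thesis using r1(2) by blast
  qed
  obtain \<zeta> where \<zeta>: "\<zeta> \<in> ball x0 (m / 4)" "\<psi> \<zeta> = z" using lift[OF z(1)] by blast
  have a0: "a 0 \<in> ball x0 (m / 4)" and a1: "a 1 \<in> ball x0 (m / 4)"
    using lift[OF ends(1)] lift[OF ends(2)] psi_inj inR geodesic_in_ball[OF g] i01 by metis+
  have near: "norm (y - x) \<le> m'" if "x \<in> ball x0 (m / 4)" "y \<in> ball x0 (m / 4)" for x y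
    using that norm_triangle_ineq4[of "y - x0" "x - x0"]
    by (simp add: dist_norm norm_minus_commute m'_def)
  obtain \<alpha> u where \<alpha>: "geodesic \<alpha> u" "\<alpha> 0 = a 0" "\<alpha> 1 = \<zeta>" "\<forall>t\<in>{0..1}. norm (u t) \<le> 3 * m'"
    using geodesic_exists[OF inR(2)[OF a0] near[OF a0 \<zeta>(1)] m'] by blast
  obtain \<beta> w where \<beta>: "geodesic \<beta> w" "\<beta> 0 = \<zeta>" "\<beta> 1 = a 1" "\<forall>t\<in>{0..1}. norm (w t) \<le> 3 * m'"
    using geodesic_exists[OF inR(2)[OF \<zeta>(1)] near[OF \<zeta>(1) a1] m'] by blast
  define l where "l = dist (\<psi> (a 0)) (\<psi> (a 1))"
  have half: "dist (\<psi> (a 0)) z = l / 2" "dist z (\<psi> (a 1)) = l / 2"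
    using z(2) by (auto simp: metric_midpoint_def l_def)
  have \<alpha>d: "dist (\<psi> (a 0)) (\<psi> (\<alpha> t)) \<le> t * (l / 2)" "dist (\<psi> (\<alpha> t)) z \<le> (1 - t) * (l / 2)" if "t \<in> {0..1}" for t
    using geodesic_minimizing[OF m' r1(1) r1' \<alpha>(1,4) _ _ that] \<alpha> ends z \<zeta> half by auto
  have \<beta>d: "dist z (\<psi> (\<beta> t)) \<le> t * (l / 2)" "dist (\<psi> (\<beta> t)) (\<psi> (a 1)) \<le> (1 - t) * (l / 2)" if "t \<in> {0..1}" for t
    using geodesic_minimizing[OF m' r1(1) r1' \<beta>(1,4) _ _ that] \<beta> ends z \<zeta> half by auto
  have d\<alpha>: "(\<alpha> has_vector_derivative u t) (at t within {0..1})" "(u has_vector_derivative - \<Gamma> (\<alpha> t) (u t) (u t)) (at t within {0..1})"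
    if "t \<in> {0..1}" for t using \<alpha>(1) that unfolding geodesic_def by blast+
  have d\<beta>: "(\<beta> has_vector_derivative w t) (at t within {0..1})" "(w has_vector_derivative - \<Gamma> (\<beta> t) (w t) (w t)) (at t within {0..1})"
    if "t \<in> {0..1}" for t using \<beta>(1) that unfolding geodesic_def by blast+
  \<comment> \<open>\<open>no_corner\<close> for the two curves that leave \<open>\<zeta>\<close>, the first half being reversed.\<close>
  have "w 0 = - (- u 1)"
  proof (rule no_corner[where l = l and z = \<zeta> and A = "\<lambda>s. \<alpha> (1 - s)" and B' = \<beta>])
    have im: "(\<lambda>s::real. 1 - s) ` {0..1} = {0..1}" by (auto intro!: image_eqI[of _ "\<lambda>s. 1 - s" "1 - x" for x])
    have "((\<lambda>s::real. 1 - s) has_vector_derivative -1) (at 0 within {0..1})"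
      by (auto intro!: derivative_eq_intros simp: has_real_derivative_iff_has_vector_derivative[symmetric])
    moreover have "(\<alpha> has_vector_derivative u 1) (at (1 - 0) within (\<lambda>s. 1 - s) ` {0..1})"
      unfolding im using d\<alpha>(1)[OF i01(2)] by simp
    ultimately have "(\<alpha> \<circ> (\<lambda>s. 1 - s) has_vector_derivative (-1) *\<^sub>R u 1) (at 0 within {0..1})"
      by (rule vector_diff_chain_within)
    then show "((\<lambda>s. \<alpha> (1 - s)) has_vector_derivative - u 1) (at 0 within {0..1})" by (simp add: o_def)
    show "(\<beta> has_vector_derivative w 0) (at 0 within {0..1})" by (rule d\<beta>(1)[OF i01(1)])
    fix s :: real assume s: "s \<in> {0..1}"
    then have s': "1 - s \<in> {0..1}" by auto
    show "\<alpha> (1 - s) \<in> cball x0 R" by (rule geodesic_in_ball[OF \<alpha>(1) s'])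
    show "\<beta> s \<in> cball x0 R" by (rule geodesic_in_ball[OF \<beta>(1) s])
    show "dist (\<psi> \<zeta>) (\<psi> (\<alpha> (1 - s))) \<le> s * (l / 2)"
      using \<alpha>d(2)[OF s'] \<zeta>(2) by (simp add: dist_commute)
    show "dist (\<psi> \<zeta>) (\<psi> (\<beta> s)) \<le> s * (l / 2)" using \<beta>d(1)[OF s] \<zeta>(2) by simp
    have "l \<le> dist (\<psi> (a 0)) (\<psi> (\<alpha> (1 - s))) + (dist (\<psi> (\<alpha> (1 - s))) (\<psi> (\<beta> s)) + dist (\<psi> (\<beta> s)) (\<psi> (a 1)))"
      unfolding l_def by (rule order_trans[OF dist_triangle add_left_mono[OF dist_triangle]])
    then show "s * l \<le> dist (\<psi> (\<alpha> (1 - s))) (\<psi> (\<beta> s))"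
      using \<alpha>d(1)[OF s'] \<beta>d(2)[OF s] by (simp add: algebra_simps)
  qed (use \<alpha> \<beta> \<zeta> inR in auto)
  then have corner: "u 1 = w 0" by simp
  define \<gamma> where "\<gamma> t = (if t \<le> 1/2 then \<alpha> (2 * t) else \<beta> (2 * t - 1))" for t
  define V where "V t = (if t \<le> 1/2 then 2 *\<^sub>R u (2 * t) else 2 *\<^sub>R w (2 * t - 1))" for t
  have "geodesic \<gamma> V"
    unfolding geodesic_def
  proof (intro ballI conjI)
    fix t :: real assume t: "t \<in> {0..1}"
    show \<gamma>t: "\<gamma> t \<in> cball x0 R"
      using geodesic_in_ball[OF \<alpha>(1), of "2 * t"] geodesic_in_ball[OF \<beta>(1), of "2 * t - 1"] t by (auto simp: \<gamma>_def)
    have "(\<gamma> has_vector_derivative (if t \<le> 1/2 then 2 *\<^sub>R u (2 * t) else 2 *\<^sub>R w (2 * t - 1))) (at t within {0..1})"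
      unfolding \<gamma>_def[abs_def] by (rule concat_has_vector_derivative[OF d\<alpha>(1) d\<beta>(1) _ corner t]) (simp_all only: \<alpha>(3) \<beta>(2))
    then show "(\<gamma> has_vector_derivative V t) (at t within {0..1})" by (simp add: V_def)
    have d2\<alpha>: "((\<lambda>t. 2 *\<^sub>R u t) has_vector_derivative 2 *\<^sub>R (- \<Gamma> (\<alpha> t) (u t) (u t))) (at t within {0..1})" if "t \<in> {0..1}" for t
      using d\<alpha>(2)[OF that] by (rule bounded_linear.has_vector_derivative[OF bounded_linear_scaleR_right])
    have d2\<beta>: "((\<lambda>t. 2 *\<^sub>R w t) has_vector_derivative 2 *\<^sub>R (- \<Gamma> (\<beta> t) (w t) (w t))) (at t within {0..1})" if "t \<in> {0..1}" for t
      using d\<beta>(2)[OF that] by (rule bounded_linear.has_vector_derivative[OF bounded_linear_scaleR_right])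
    have "(V has_vector_derivative (if t \<le> 1/2 then 2 *\<^sub>R (2 *\<^sub>R (- \<Gamma> (\<alpha> (2 * t)) (u (2 * t)) (u (2 * t))))
        else 2 *\<^sub>R (2 *\<^sub>R (- \<Gamma> (\<beta> (2 * t - 1)) (w (2 * t - 1)) (w (2 * t - 1)))))) (at t within {0..1})"
      unfolding V_def[abs_def] by (rule concat_has_vector_derivative[OF d2\<alpha> d2\<beta> _ _ t]) (use \<alpha> \<beta> corner in simp_all)
    moreover have "(if t \<le> 1/2 then 2 *\<^sub>R (2 *\<^sub>R (- \<Gamma> (\<alpha> (2 * t)) (u (2 * t)) (u (2 * t))))
        else 2 *\<^sub>R (2 *\<^sub>R (- \<Gamma> (\<beta> (2 * t - 1)) (w (2 * t - 1)) (w (2 * t - 1))))) = - \<Gamma> (\<gamma> t) (V t) (V t)"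
      using in_\<Omega>[OF \<gamma>t] by (auto simp: \<gamma>_def V_def Ch_simps)
    ultimately show "(V has_vector_derivative - \<Gamma> (\<gamma> t) (V t) (V t)) (at t within {0..1})" by simp
  qed
  moreover have "\<forall>t\<in>{0..1}. norm (V t) \<le> 3 * m"
  proof
    fix t :: real assume t: "t \<in> {0..1}"
    show "norm (V t) \<le> 3 * m"
    proof (cases "t \<le> 1/2")
      case True
      then have "norm (u (2 * t)) \<le> 3 * m'" using t \<alpha>(4) by auto
      then show ?thesis using True by (simp add: V_def m'_def)
    next
      case False
      then have "norm (w (2 * t - 1)) \<le> 3 * m'" using t \<beta>(4) by auto
      then show ?thesis using False by (simp add: V_def m'_def)
    qed
  qed
  moreover have "\<gamma> 0 = a 0" "\<gamma> 1 = a 1" "\<gamma> (1/2) = \<zeta>" using \<alpha> \<beta> by (auto simp: \<gamma>_def)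
  ultimately have "norm (a (1/2) - \<gamma> (1/2)) \<le> 10 * 0"
    using v by (intro geodesic_compare(1)[OF _ g m _ _ _ _ i01(3)]) auto
  then show ?thesis using \<open>\<gamma> (1/2) = \<zeta>\<close> \<zeta>(2) by simp
qed

text \<open>Near \<open>\<psi> x0\<close> the midpoints are exactly the middle points of geodesics, so the inequality is convexity at
the parameter \<open>1 / 2\<close>.\<close>

theorem locally_Busemann_convex: "\<exists>r>0. Busemann_convex (ball (\<psi> x0) r)"
proof -
  obtain m where m: "small m" using ex_small by blast
  have mR: "0 < m" "6 * m \<le> R" using m by (auto simp: small_def)
  have "open (\<psi> ` ball x0 (m / 4))" using mR by (intro open_ball_image) auto
  moreover have "\<psi> x0 \<in> \<psi> ` ball x0 (m / 4)" using mR by simp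
  ultimately obtain r1 where r1: "r1 > 0" "ball (\<psi> x0) r1 \<subseteq> \<psi> ` ball x0 (m / 4)"
    using open_contains_ball by blast
  have r1': "ball (\<psi> x0) r1 \<subseteq> \<psi> ` ball x0 (m / 2)"
    using r1(2) mR by (rule_tac order_trans[OF r1(2)]) (auto intro!: image_mono subset_ball)
  define r where "r = r1 / 8"
  let ?S = "ball (\<psi> x0) r"
  have i01: "(0::real) \<in> {0..1}" "(1::real) \<in> {0..1}" "(1/2::real) \<in> {0..1}" by auto
  have inR: "x \<in> cball x0 (R / 2)" if "x \<in> ball x0 (m / 4)" for x using that mR by auto
  have S4: "p \<in> ball (\<psi> x0) (r1 / 4)" if "p \<in> ?S" for p using that r1(1) by (auto simp: r_def)
  have ex: "\<exists>a v. geodesic a v \<and> (\<forall>s\<in>{0..1}. norm (v s) \<le> 3 * m) \<and> \<psi> (a 0) = p \<and> \<psi> (a 1) = q"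
    if pq: "p \<in> ?S" "q \<in> ?S" for p q
  proof -
    have "p \<in> ball (\<psi> x0) r1" "q \<in> ball (\<psi> x0) r1" using pq r1(1) by (auto simp: r_def)
    then obtain x y where xy: "x \<in> ball x0 (m / 4)" "\<psi> x = p" "y \<in> ball x0 (m / 4)" "\<psi> y = q" using r1(2) by blast
    have "norm (y - x) \<le> m"
      using xy(1,3) norm_triangle_ineq4[of "y - x0" "x - x0"] mR by (simp add: dist_norm norm_minus_commute)
    then show ?thesis using geodesic_exists[OF inR[OF xy(1)] _ m, of y] xy by metis
  qed
  have mid: "metric_midpoint (\<psi> (a (1/2))) (\<psi> (a 0)) (\<psi> (a 1))"
    if "geodesic a v" "\<forall>s\<in>{0..1}. norm (v s) \<le> 3 * m" "\<psi> (a 0) \<in> ?S" "\<psi> (a 1) \<in> ?S" for a v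
    using geodesic_minimizing[OF m r1(1) r1' that(1,2) S4[OF that(3)] S4[OF that(4)] i01(3)]
      dist_triangle[of "\<psi> (a 0)" "\<psi> (a 1)" "\<psi> (a (1/2))"]
    unfolding metric_midpoint_def by simp
  have uniq: "z = \<psi> (a (1/2))"
    if "geodesic a v" "\<forall>s\<in>{0..1}. norm (v s) \<le> 3 * m" "\<psi> (a 0) \<in> ?S" "\<psi> (a 1) \<in> ?S"
      "metric_midpoint z (\<psi> (a 0)) (\<psi> (a 1))" for a v z
  proof (rule midpoint_on_geodesic[OF m r1 that(1,2) S4[OF that(3)] S4[OF that(4)] _ that(5)])
    have "dist (\<psi> x0) z \<le> dist (\<psi> x0) (\<psi> (a 0)) + dist (\<psi> (a 0)) z" by (rule dist_triangle)
    moreover have "dist (\<psi> (a 0)) (\<psi> (a 1)) \<le> dist (\<psi> x0) (\<psi> (a 0)) + dist (\<psi> x0) (\<psi> (a 1))"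
      by (metis dist_triangle dist_commute)
    ultimately show "z \<in> ball (\<psi> x0) (r1 / 4)"
      using that(3-5) by (simp add: metric_midpoint_def r_def)
  qed
  have "dist z z' \<le> (dist p p' + dist q q') / 2"
    if S: "p \<in> ?S" "q \<in> ?S" "p' \<in> ?S" "q' \<in> ?S" and zz: "metric_midpoint z p q" "metric_midpoint z' p' q'" for p q p' q' z z'
  proof -
    obtain a v where a: "geodesic a v" "\<forall>s\<in>{0..1}. norm (v s) \<le> 3 * m" "\<psi> (a 0) = p" "\<psi> (a 1) = q"
      using ex[OF S(1,2)] by blast
    obtain b w where b: "geodesic b w" "\<forall>s\<in>{0..1}. norm (w s) \<le> 3 * m" "\<psi> (b 0) = p'" "\<psi> (b 1) = q'"
      using ex[OF S(3,4)] by blast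
    have "z = \<psi> (a (1/2))" "z' = \<psi> (b (1/2))"
      using uniq[OF a(1,2), of z] uniq[OF b(1,2), of z'] a b S zz by auto
    then show ?thesis
      using convexity[OF m r1(1) r1' a(1) b(1) _ _ _ _ _ i01(3)] a b S4[OF S(1)] S4[OF S(2)] S4[OF S(3)] S4[OF S(4)]
      by simp
  qed
  moreover have "\<exists>z. metric_midpoint z p q" if "p \<in> ?S" "q \<in> ?S" for p q
    using ex[OF that] mid that by metis
  ultimately have "Busemann_convex ?S" unfolding Busemann_convex_def by blast
  then show ?thesis using r1(1) by (intro exI[of _ r]) (auto simp: r_def)
qed

end

context riemannian_space
begin

lemma locally_Busemann_convex:
  assumes conn: "connected (UNIV :: 'a set)"
    and curv: "\<And>k x u v. k \<in> A \<Longrightarrow> x \<in> snd k ` fst k \<Longrightarrow> u \<noteq> v \<Longrightarrow> independent {u, v} \<Longrightarrow>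
      sectional_curvature (g k) x u v \<le> 0"
  shows "\<exists>r>0. Busemann_convex (ball (q::'a) r)"
proof -
  obtain k where k: "k \<in> A" "q \<in> fst k" using ex_chart by blast
  let ?\<Omega> = "snd k ` fst k"
  define x0 where "x0 = snd k q"
  have x0: "x0 \<in> ?\<Omega>" using k by (simp add: x0_def)
  interpret M: coordinate_metric "g k" ?\<Omega> by (rule coordinate_metric[OF k(1)])
  obtain R1 Cd where R1: "R1 > 0" "Cd \<ge> 0" "cball x0 R1 \<subseteq> ?\<Omega>"
    "\<And>x y. x \<in> cball x0 R1 \<Longrightarrow> y \<in> cball x0 R1 \<Longrightarrow>
      \<bar>dist (chart_inv k x) (chart_inv k y) - sqrt (g k x (y - x) (y - x))\<bar> \<le> Cd * (norm (y - x))\<^sup>2"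
    using chart_distance[OF k(1) x0 conn] by blast
  obtain l where l: "l > 0" "\<And>x v. x \<in> cball x0 R1 \<Longrightarrow> l * (norm v)\<^sup>2 \<le> g k x v v"
    using M.uniformly_positive[OF compact_cball R1(3)] by blast
  obtain C where C: "C \<ge> 0" "\<And>x u v. x \<in> cball x0 R1 \<Longrightarrow> norm (christoffel (g k) x u v) \<le> C * norm u * norm v"
    "\<And>x y u v. x \<in> cball x0 R1 \<Longrightarrow> y \<in> cball x0 R1 \<Longrightarrow>
       norm (christoffel (g k) y u v - christoffel (g k) x u v) \<le> C * norm (y - x) * norm u * norm v"
    using M.Ch.uniform_bound[OF compact_cball convex_cball R1(3)] by blast
  \<comment> \<open>On the ball of radius \<open>R\<close> the quadratic error is at most half of the first-order term, which
       makes the chart bi-Lipschitz.\<close>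
  define R where "R = min R1 (sqrt l / (4 * (Cd + 1)))"
  have R: "R > 0" "R \<le> R1" "R \<le> sqrt l / (4 * (Cd + 1))"
  proof -
    show "R > 0" using R1(1,2) l(1) by (simp add: R_def)
    show "R \<le> R1" "R \<le> sqrt l / (4 * (Cd + 1))" unfolding R_def by (rule min.cobounded1, rule min.cobounded2)
  qed
  have in1: "x \<in> cball x0 R1" if "x \<in> cball x0 R" for x using that R(2) by auto
  have bil: "norm (y - x) \<le> 2 / sqrt l * dist (chart_inv k x) (chart_inv k y)"
    if xy: "x \<in> cball x0 R" "y \<in> cball x0 R" for x y
  proof -
    let ?w = "norm (y - x)"
    have w: "?w \<le> 2 * R" using xy norm_triangle_ineq4[of "y - x0" "x - x0"] by (simp add: dist_norm norm_minus_commute)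
    have "sqrt (l * ?w\<^sup>2) \<le> sqrt (g k x (y - x) (y - x))" by (rule real_sqrt_le_mono[OF l(2)[OF in1[OF xy(1)]]])
    then have 1: "sqrt l * ?w \<le> sqrt (g k x (y - x) (y - x))" by (simp add: real_sqrt_mult)
    have "Cd * ?w\<^sup>2 \<le> (Cd + 1) * (2 * R) * ?w"
    proof -
      have "Cd * ?w \<le> (Cd + 1) * (2 * R)" using w R1(2) R(1) by (intro mult_mono) auto
      from mult_right_mono[OF this, of ?w] show ?thesis by (simp add: power2_eq_square mult.assoc)
    qed
    also have "\<dots> \<le> sqrt l / 2 * ?w"
    proof (rule mult_right_mono)
      have "(Cd + 1) * R \<le> (Cd + 1) * (sqrt l / (4 * (Cd + 1)))" using R(3) R1(2) by (intro mult_left_mono) auto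
      also have "\<dots> = sqrt l / 4" using R1(2) by (simp add: field_simps)
      finally show "(Cd + 1) * (2 * R) \<le> sqrt l / 2" by simp
    qed simp
    finally have "Cd * ?w\<^sup>2 \<le> sqrt l / 2 * ?w" .
    then have "sqrt l / 2 * ?w \<le> dist (chart_inv k x) (chart_inv k y)"
      using 1 R1(4)[OF in1[OF xy(1)] in1[OF xy(2)]] by linarith
    then have "2 / sqrt l * (sqrt l / 2 * ?w) \<le> 2 / sqrt l * dist (chart_inv k x) (chart_inv k y)"
      using l(1) by (intro mult_left_mono) auto
    then show ?thesis using l(1) by simp
  qed
  have "metric_ball (g k) ?\<Omega> x0 R C (chart_inv k) Cd (2 / sqrt l)"
  proof unfold_locales
    show "bilinear (christoffel (g k) x)" if "x \<in> cball x0 R" for x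
      using M.bilinear_christoffel R1(3) in1[OF that] by blast
    show "cball x0 R \<subseteq> ?\<Omega>" using R1(3) in1 by blast
    show "0 \<le> g k x (riemann_curvature (g k) x u v u) v" if "x \<in> ?\<Omega>" for x u v
      by (rule M.curvature_nonpos[OF that curv[OF k(1) that]])
    show "open (chart_inv k ` ball x0 r)" if "0 < r" "r \<le> R" for r
    proof (rule open_inv_image[OF k(1) open_ball])
      have "ball x0 r \<subseteq> cball x0 R1" using that R(2) by auto
      then show "ball x0 r \<subseteq> ?\<Omega>" using R1(3) by blast
    qed
    show "\<exists>c L. almost_geodesic c L p q e" if "0 < e" for e and p q :: 'a
      by (rule ex_almost_geodesic[OF conn that])
  qed (use R C R1 l in1 bil in auto)
  then have "\<exists>r>0. Busemann_convex (ball (chart_inv k x0) r)" by (rule metric_ball.locally_Busemann_convex)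
  then show ?thesis using k by (simp add: x0_def)
qed

lemma locally_compact: "\<exists>r>0. compact (cball (q::'a) r)"
proof -
  obtain k where k: "k \<in> A" "q \<in> fst k" using ex_chart by blast
  obtain R where R: "R > 0" "cball (snd k q) R \<subseteq> snd k ` fst k"
    using open_chart_image[OF k(1)] k(2) open_contains_cball by blast
  have "ball (snd k q) R \<subseteq> snd k ` fst k" using R(2) ball_subset_cball by blast
  then have "open (chart_inv k ` ball (snd k q) R)" by (rule open_inv_image[OF k(1) open_ball])
  moreover have "q \<in> chart_inv k ` ball (snd k q) R"
    by (rule image_eqI[of _ _ "snd k q"]) (use k R in auto)
  ultimately obtain r where r: "r > 0" "cball q r \<subseteq> chart_inv k ` ball (snd k q) R"
    using open_contains_cball by blast
  have "compact (chart_inv k ` cball (snd k q) R)"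
    by (intro compact_continuous_image compact_cball
        continuous_on_subset[OF homeomorphism_cont2[OF chart_homeomorphism[OF k(1)]] R(2)])
  moreover have "cball q r \<subseteq> chart_inv k ` cball (snd k q) R"
    by (rule order_trans[OF r(2) image_mono[OF ball_subset_cball]])
  ultimately have "compact (chart_inv k ` cball (snd k q) R \<inter> cball q r)" by (intro compact_Int_closed) auto
  moreover have "chart_inv k ` cball (snd k q) R \<inter> cball q r = cball q r"
    using \<open>cball q r \<subseteq> chart_inv k ` cball (snd k q) R\<close> by blast
  ultimately show ?thesis using r(1) by auto
qed

end

section \<open>Compactness of balls\<close>

text \<open>The intermediate value theorem for the distance from \<open>p\<close> along an almost geodesic curve.\<close>

lemma intermediate_point:
  fixes p q :: "'a::metric_space"
  assumes almost: "\<And>e. e > 0 \<Longrightarrow> \<exists>c L. almost_geodesic c L p q e"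
    and ab: "dist p q \<le> a + b" "0 \<le> a" "0 \<le> b" and e: "e > 0"
  shows "\<exists>z. dist p z \<le> a \<and> dist z q \<le> b + e"
proof (cases "dist p q \<le> a")
  case False
  obtain c L where c: "almost_geodesic c L p q e" using almost[OF e] by blast
  then have c': "continuous_on {0..1} c" "c 0 = p" "c 1 = q" "L 1 - L 0 \<le> dist p q + e"
    "\<And>s t. 0 \<le> s \<Longrightarrow> s \<le> t \<Longrightarrow> t \<le> 1 \<Longrightarrow> dist (c s) (c t) \<le> L t - L s"
    unfolding almost_geodesic_def by auto
  have "\<exists>t. 0 \<le> t \<and> t \<le> 1 \<and> dist p (c t) = a"
    by (rule IVT') (use c' ab False in \<open>auto intro!: continuous_intros\<close>)
  then obtain t where t: "0 \<le> t" "t \<le> 1" "dist p (c t) = a" by blast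
  have "dist (c t) (c 1) \<le> L 1 - L t" "dist (c 0) (c t) \<le> L t - L 0" using c'(5) t by auto
  then have "dist (c t) q \<le> b + e" using c' t ab by simp
  then show ?thesis using t by (intro exI[of _ "c t"]) auto
qed (use ab e in \<open>auto intro!: exI[of _ q]\<close>)

text \<open>Let \<open>s\<close> be the supremum of the radii with compact balls. The ball of radius \<open>s\<close> is totally bounded,
because all its points are close to smaller, compact balls. It is therefore covered by finitely
many compact balls, and these cover a slightly larger ball as well.\<close>

theorem Hopf_Rinow:
  fixes p :: "'a::metric_space"
  assumes complete: "complete (UNIV :: 'a set)"
    and almost: "\<And>p q e. e > 0 \<Longrightarrow> \<exists>c L. almost_geodesic c L (p::'a) q e"
    and lc: "\<And>q::'a. \<exists>r>0. compact (cball q r)"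
  shows "compact (cball p R)"
proof (rule ccontr)
  assume nR: "\<not> compact (cball p R)"
  define S where "S = {r. r \<ge> 0 \<and> compact (cball p r)}"
  have mono: "compact (cball p a)" if "compact (cball p b)" "a \<le> b" for a b
  proof -
    have "compact (cball p b \<inter> cball p a)" by (intro compact_Int_closed that) auto
    moreover have "cball p b \<inter> cball p a = cball p a" using that by auto
    ultimately show ?thesis by simp
  qed
  have bound: "r \<le> R" if "r \<in> S" for r using that mono[of r R] nR unfolding S_def by force
  have bdd: "bdd_above S" by (rule bdd_aboveI) (rule bound)
  have S0: "0 \<in> S" by (simp add: S_def)
  define s where "s = Sup S"
  have s0: "0 \<le> s" unfolding s_def using cSup_upper[OF S0 bdd] .
  have cs: "compact (cball p s)"
    unfolding compact_eq_totally_bounded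
  proof (intro conjI allI impI)
    have "complete (UNIV \<inter> cball p s)" by (intro complete_Int_closed complete) auto
    then show "complete (cball p s)" by simp
    fix e :: real assume e: "e > 0"
    obtain s' where s': "s' \<in> S" "s - e / 4 < s'"
      using less_cSupD[of S "s - e / 4"] S0 e unfolding s_def by auto
    then have "compact (cball p s')" "0 \<le> s'" by (auto simp: S_def)
    then obtain F where F: "finite F" "cball p s' \<subseteq> (\<Union>x\<in>F. ball x (e / 2))"
      unfolding compact_eq_totally_bounded using e by (meson half_gt_zero)
    have "cball p s \<subseteq> (\<Union>x\<in>F. ball x e)"
    proof
      fix y assume "y \<in> cball p s"
      then have "dist p y \<le> s' + e / 4" using s'(2) by simp
      then obtain z where z: "dist p z \<le> s'" "dist z y \<le> e / 4 + e / 8"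
        using intermediate_point[where p = p and q = y and a = s' and b = "e / 4" and e = "e / 8"] \<open>0 \<le> s'\<close> e by (auto intro: almost)
      then obtain x where "x \<in> F" "dist x z < e / 2" using F(2) by auto
      then have "dist x y < e" using z(2) dist_triangle[of x y z] e by linarith
      then show "y \<in> (\<Union>x\<in>F. ball x e)" using \<open>x \<in> F\<close> by auto
    qed
    then show "\<exists>k. finite k \<and> cball p s \<subseteq> (\<Union>x\<in>k. ball x e)" using F(1) by blast
  qed
  obtain r where r: "\<And>q::'a. r q > 0" "\<And>q. compact (cball q (r q))" using lc by metis
  have cover: "cball p s \<subseteq> (\<Union>q\<in>cball p s. ball q (r q / 2))"
  proof
    fix y assume "y \<in> cball p s"
    moreover have "y \<in> ball y (r y / 2)" using r(1)[of y] by simp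
    ultimately show "y \<in> (\<Union>q\<in>cball p s. ball q (r q / 2))" by blast
  qed
  obtain F where F: "F \<subseteq> cball p s" "finite F" "cball p s \<subseteq> (\<Union>q\<in>F. ball q (r q / 2))"
    by (rule compactE_image[OF cs open_ball cover])
  have "p \<in> cball p s" using s0 by simp
  then have Fne: "F \<noteq> {}" using F(3) by auto
  define e where "e = Min (r ` F) / 8"
  have e0: "e > 0" using F(2) Fne r(1) by (simp add: e_def)
  have er: "4 * e \<le> r q / 2" if "q \<in> F" for q
  proof -
    have "Min (r ` F) \<le> r q" using F(2) that by (intro Min_le) auto
    then show ?thesis by (simp add: e_def)
  qed
  have "cball p (s + e) \<subseteq> (\<Union>q\<in>F. cball q (r q))"
  proof
    fix y assume "y \<in> cball p (s + e)"
    then obtain z where z: "dist p z \<le> s" "dist z y \<le> e + e"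
      using intermediate_point[where p = p and q = y and a = s and b = e and e = e] s0 e0 by (auto intro: almost)
    then obtain q where q: "q \<in> F" "dist q z < r q / 2" using F(3) by auto
    have "dist q y \<le> r q" using z(2) q er[OF q(1)] e0 dist_triangle[of q y z] by linarith
    then show "y \<in> (\<Union>q\<in>F. cball q (r q))" using q(1) by auto
  qed
  moreover have "compact (\<Union>q\<in>F. cball q (r q))" using F(2) r(2) by (intro compact_UN) auto
  ultimately have "compact (cball p (s + e))"
    using compact_Int_closed[of "\<Union>q\<in>F. cball q (r q)" "cball p (s + e)"] by (simp add: inf.absorb2)
  then have "s + e \<in> S" using s0 e0 by (simp add: S_def)
  then have "s + e \<le> s" unfolding s_def by (rule cSup_upper[OF _ bdd])
  then show False using e0 by simp
qed

text \<open>The Lebesgue number of a cover by convex balls.\<close>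

lemma uniform_Busemann_convex:
  assumes K: "compact (K :: 'a::metric_space set)" and loc: "\<And>q::'a. \<exists>r>0. Busemann_convex (ball q r)"
  shows "\<exists>r>0. \<forall>z\<in>K. Busemann_convex (ball z r)"
proof -
  obtain r where r: "\<And>q::'a. r q > 0" "\<And>q. Busemann_convex (ball q (r q))" using loc by metis
  have "K \<subseteq> \<Union>(range (\<lambda>q. ball q (r q)))" using r(1) by (auto intro: centre_in_ball[THEN iffD2])
  moreover have "open G" if "G \<in> range (\<lambda>q. ball q (r q))" for G using that by auto
  ultimately obtain e where e: "0 < e" "\<And>x. x \<in> K \<Longrightarrow> \<exists>G\<in>range (\<lambda>q. ball q (r q)). ball x e \<subseteq> G"
    using Heine_Borel_lemma[OF K] by metis
  have "Busemann_convex (ball z e)" if z: "z \<in> K" for z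
  proof -
    obtain q where "ball z e \<subseteq> ball q (r q)" using e(2)[OF z] by blast
    then show ?thesis using r(2)[of q] unfolding Busemann_convex_def subset_eq by meson
  qed
  then show ?thesis using e(1) by blast
qed

section \<open>The midpoint flow\<close>

definition mid :: "'a::metric_space \<Rightarrow> 'a \<Rightarrow> 'a" where
  "mid x y = (SOME m. metric_midpoint m x y)"

lemma
  assumes S: "Busemann_convex S" and xy: "x \<in> S" "y \<in> S"
  shows mid: "metric_midpoint (mid x y) x y"
    and mid_unique: "metric_midpoint m x y \<Longrightarrow> mid x y = m"
proof -
  have "\<exists>m. metric_midpoint m x y" using S xy unfolding Busemann_convex_def by blast
  then show m: "metric_midpoint (mid x y) x y" unfolding mid_def by (rule someI_ex)
  assume "metric_midpoint m x y"
  then have "dist (mid x y) m \<le> (dist x x + dist y y) / 2"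
    using S xy m unfolding Busemann_convex_def by blast
  then show "mid x y = m" by simp
qed

lemma mid_convex:
  assumes S: "Busemann_convex S" and "x \<in> S" "y \<in> S" "x' \<in> S" "y' \<in> S"
  shows "dist (mid x y) (mid x' y') \<le> (dist x x' + dist y y') / 2"
  using assms mid[OF S] unfolding Busemann_convex_def by blast

lemma dist_mid:
  assumes S: "Busemann_convex S" and xy: "x \<in> S" "y \<in> S"
  shows "dist x (mid x y) = dist x y / 2" "dist (mid x y) y = dist x y / 2"
  using mid[OF S xy] by (auto simp: metric_midpoint_def)

text \<open>Comparison with an explicit supersolution of the discrete heat equation. Averaging fixes the linear
part and lowers \<open>j * (M - j)\<close> by \<open>1\<close>, which is at least the fraction \<open>1 / M\<^sup>2\<close> of its value.\<close>

lemma discrete_heat_decay: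
  fixes e :: "nat \<Rightarrow> nat \<Rightarrow> real"
  assumes left: "\<And>k. e k 0 \<le> 0" and right: "\<And>k. e k M \<le> b" and b: "0 \<le> b" and D: "0 \<le> D"
    and step: "\<And>k j. 0 < j \<Longrightarrow> j < M \<Longrightarrow> e (Suc k) j \<le> (e k (j - 1) + e k (j + 1)) / 2"
    and init: "\<And>j. j \<le> M \<Longrightarrow> e 0 j \<le> D" and j: "j \<le> M" and M: "0 < M"
  shows "e k j \<le> real j / real M * b + D * (1 - 1 / (real M)\<^sup>2) ^ k * (real j * (real M - real j))"
  using j
proof (induction k arbitrary: j)
  case 0
  show ?case
  proof (cases "j = 0 \<or> j = M")
    case True
    then show ?thesis using left[of 0] right[of 0] M by auto
  next
    case False
    then have "1 \<le> j" "Suc j \<le> M" using 0 by auto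
    then have "1 \<le> real j" "1 \<le> real M - real j" by linarith+
    then have "1 * 1 \<le> real j * (real M - real j)" by (intro mult_mono) auto
    then have "D * 1 \<le> D * (real j * (real M - real j))" using D by (intro mult_left_mono) auto
    moreover have "0 \<le> real j / real M * b" using b by simp
    ultimately show ?thesis using init[OF 0] by simp
  qed
next
  case (Suc k)
  let ?t = "1 - 1 / (real M)\<^sup>2"
  show ?case
  proof (cases "j = 0 \<or> j = M")
    case True
    then show ?thesis using left[of "Suc k"] right[of "Suc k"] M by auto
  next
    case False
    then have j: "0 < j" "j < M" using Suc by auto
    have t0: "0 \<le> ?t" using M by (simp add: divide_le_eq)
    have r: "real (j - 1) = real j - 1" "real (j + 1) = real j + 1" using j by (auto simp: of_nat_diff)
    have "e (Suc k) j \<le> (e k (j - 1) + e k (j + 1)) / 2" by (rule step[OF j])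
    also have "\<dots> \<le> ((real (j - 1) / real M * b + D * ?t ^ k * (real (j - 1) * (real M - real (j - 1))))
       + (real (j + 1) / real M * b + D * ?t ^ k * (real (j + 1) * (real M - real (j + 1))))) / 2"
      using Suc.IH[of "j - 1"] Suc.IH[of "j + 1"] j by (intro divide_right_mono add_mono) auto
    also have "\<dots> = real j / real M * b + D * ?t ^ k * (real j * (real M - real j) - 1)"
    proof -
      have *: "((X - 1) * c + K * ((X - 1) * (m - (X - 1))) + ((X + 1) * c + K * ((X + 1) * (m - (X + 1))))) / 2
          = X * c + K * (X * (m - X) - 1)" for X m K c :: real
        by (simp add: field_simps)
      show ?thesis unfolding r times_divide_eq_left[symmetric] times_divide_eq_right[symmetric]
        using *[of "real j" "b / real M" "D * ?t ^ k" "real M"] by (simp add: mult.commute)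
    qed
    also have "\<dots> \<le> real j / real M * b + D * ?t ^ k * (?t * (real j * (real M - real j)))"
    proof (intro add_left_mono mult_left_mono)
      have "real j * (real M - real j) \<le> real M * real M" using j by (intro mult_mono) auto
      then have "real j * (real M - real j) / (real M)\<^sup>2 \<le> 1" using M by (simp add: power2_eq_square divide_le_eq)
      then show "real j * (real M - real j) - 1 \<le> ?t * (real j * (real M - real j))" by (simp add: left_diff_distrib)
      show "0 \<le> D * ?t ^ k" using D t0 by simp
    qed
    finally show ?thesis by (simp add: mult_ac)
  qed
qed

text \<open>Discrete curve shortening for a family of polygons \<open>x i\<close> with \<open>M\<close> edges: all interior vertices are
replaced at the same time by the midpoints of their neighbours.\<close>

definition midpoint_step :: "nat \<Rightarrow> (nat \<Rightarrow> nat \<Rightarrow> 'a::metric_space) \<Rightarrow> nat \<Rightarrow> nat \<Rightarrow> 'a" where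
  "midpoint_step M x i j = (if 0 < j \<and> j < M then mid (x i (j - 1)) (x i (j + 1)) else x i j)"

lemma dist_row_le:
  assumes "\<And>j. j < M \<Longrightarrow> dist (x j) (x (Suc j)) \<le> S" "j \<le> M"
  shows "dist (x 0) (x j) \<le> real j * S"
  using assms(2)
proof (induction j)
  case (Suc j)
  have "dist (x 0) (x (Suc j)) \<le> dist (x 0) (x j) + dist (x j) (x (Suc j))" by (rule dist_triangle)
  then show ?case using Suc assms(1)[of j] by (simp add: algebra_simps)
qed simp

text \<open>The polygons start at \<open>p\<close> and have edges of length at most \<open>S\<close>; corresponding vertices of consecutive
polygons are at most \<open>D\<close> apart. Where midpoints are convex at this scale, the flow preserves all three
conditions, and they keep it in the ball of radius \<open>M * S\<close> around \<open>p\<close>.\<close>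

definition admissible :: "'a::metric_space \<Rightarrow> nat \<Rightarrow> nat \<Rightarrow> real \<Rightarrow> real \<Rightarrow> (nat \<Rightarrow> nat \<Rightarrow> 'a) \<Rightarrow> bool" where
  "admissible p N M S D x \<longleftrightarrow> (\<forall>i\<le>N. x i 0 = p) \<and>
     (\<forall>i\<le>N. \<forall>j<M. dist (x i j) (x i (Suc j)) \<le> S) \<and>
     (\<forall>i<N. \<forall>j\<le>M. dist (x i j) (x (Suc i) j) \<le> D)"

text \<open>A vertex, its neighbours and the corresponding vertices of the next polygon lie in a common ball of
radius \<open>r\<close>, on which convexity is available.\<close>

context
  fixes p :: "'a::metric_space" and L r S D :: real and N M :: nat
  assumes BC: "\<And>z. z \<in> cball p L \<Longrightarrow> Busemann_convex (ball z r)"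
    and L: "real M * S \<le> L" and r: "2 * S + D < r" and S0: "0 \<le> S" "0 \<le> D"
begin

lemma admissible_ball:
  assumes x: "admissible p N M S D x" and ij: "i \<le> N" "j \<le> M"
  shows "Busemann_convex (ball (x i j) r)"
proof (rule BC)
  have "dist (x i 0) (x i j) \<le> real j * S"
    by (rule dist_row_le[of M]) (use x ij in \<open>auto simp: admissible_def\<close>)
  also have "\<dots> \<le> real M * S" using ij S0 by (intro mult_right_mono) auto
  finally show "x i j \<in> cball p L" using x ij L by (simp add: admissible_def)
qed

lemma admissible_near:
  assumes x: "admissible p N M S D x" and j: "0 < j" "j < M"
  shows "i \<le> N \<Longrightarrow> x i (j - 1) \<in> ball (x i j) r" "i \<le> N \<Longrightarrow> x i (j + 1) \<in> ball (x i j) r"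
    "i < N \<Longrightarrow> x (Suc i) (j - 1) \<in> ball (x i j) r" "i < N \<Longrightarrow> x (Suc i) (j + 1) \<in> ball (x i j) r"
proof -
  have s: "dist (x i (j - 1)) (x i j) \<le> S" "dist (x i j) (x i (j + 1)) \<le> S" if "i \<le> N" for i
    using x j that unfolding admissible_def by (metis Suc_pred' less_imp_diff_less, simp)
  show a: "i \<le> N \<Longrightarrow> x i (j - 1) \<in> ball (x i j) r" "i \<le> N \<Longrightarrow> x i (j + 1) \<in> ball (x i j) r"
    using s[of i] r S0 by (auto simp: dist_commute)
  assume i: "i < N"
  have d: "dist (x i (j - 1)) (x (Suc i) (j - 1)) \<le> D" "dist (x i (j + 1)) (x (Suc i) (j + 1)) \<le> D"
    using x j i unfolding admissible_def by auto
  have "dist (x i j) (x (Suc i) (j - 1)) \<le> S + D"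
    using dist_triangle[of "x i j" "x (Suc i) (j - 1)" "x i (j - 1)"] s(1)[of i] d(1) i by (simp add: dist_commute)
  then show "x (Suc i) (j - 1) \<in> ball (x i j) r" using r S0 by simp
  have "dist (x i j) (x (Suc i) (j + 1)) \<le> S + D"
    using dist_triangle[of "x i j" "x (Suc i) (j + 1)" "x i (j + 1)"] s(2)[of i] d(2) i by simp
  then show "x (Suc i) (j + 1) \<in> ball (x i j) r" using r S0 by simp
qed

lemma midpoint_step_gap:
  assumes x: "admissible p N M S D x" and i: "i < N" and j: "0 < j" "j < M"
  shows "dist (midpoint_step M x i j) (midpoint_step M x (Suc i) j) \<le>
    (dist (x i (j - 1)) (x (Suc i) (j - 1)) + dist (x i (j + 1)) (x (Suc i) (j + 1))) / 2"
  unfolding midpoint_step_def using j mid_convex[OF admissible_ball[OF x] admissible_near[OF x j]] i by simp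

lemma midpoint_step_fixed:
  assumes x: "admissible p N M S D x" and i: "i \<le> N" and j: "j \<le> M"
    and m: "0 < j \<Longrightarrow> j < M \<Longrightarrow> metric_midpoint (x i j) (x i (j - 1)) (x i (j + 1))"
  shows "midpoint_step M x i j = x i j"
proof (cases "0 < j \<and> j < M")
  case True
  then show ?thesis
    using mid_unique[OF admissible_ball[OF x i j] admissible_near(1)[OF x _ _ i] admissible_near(2)[OF x _ _ i] m]
    by (simp add: midpoint_step_def)
qed (auto simp: midpoint_step_def)

text \<open>By convexity a gap between new points is at most the mean of two old ones. At the ends of a polygon,
where one of the two points does not move, the new edge is half of a distance between vertices two
steps apart.\<close>

lemma midpoint_step_admissible:
  assumes x: "admissible p N M S D x"
  shows "admissible p N M S D (midpoint_step M x)"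
  unfolding admissible_def
proof (intro conjI allI impI)
  show "midpoint_step M x i 0 = p" if "i \<le> N" for i
    using x that by (simp add: midpoint_step_def admissible_def)
  have s: "dist (x i j) (x i (Suc j)) \<le> S" if "i \<le> N" "j < M" for i j using x that unfolding admissible_def by blast
  show "dist (midpoint_step M x i j) (midpoint_step M x i (Suc j)) \<le> S" if i: "i \<le> N" and jM: "j < M" for i j
  proof -
    have tri: "dist (x i (k - 1)) (x i (k + 1)) \<le> 2 * S" if "0 < k" "k < M" for k
    proof -
      have k: "k - 1 < M" "Suc (k - 1) = k" using that by auto
      have "dist (x i (k - 1)) (x i k) \<le> S" using s[OF i k(1)] k(2) by simp
      then show ?thesis
        using dist_triangle[of "x i (k - 1)" "x i (k + 1)" "x i k"] s[OF i that(2)] by simp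
    qed
    have dm: "dist (x i (k - 1)) (midpoint_step M x i k) \<le> S" "dist (midpoint_step M x i k) (x i (k + 1)) \<le> S" if k: "0 < k" "k < M" for k
      using dist_mid[OF admissible_ball[OF x i, of k] admissible_near(1)[OF x k i] admissible_near(2)[OF x k i]] tri[OF k] k by (auto simp: midpoint_step_def)
    consider "j = 0" "Suc j = M" | "j = 0" "Suc j < M" | "0 < j" "Suc j = M" | "0 < j" "Suc j < M" using jM by linarith
    then show ?thesis
    proof cases
      case 1
      then show ?thesis using s[OF i jM] by (simp add: midpoint_step_def)
    next
      case 2
      then show ?thesis using dm(1)[of 1] by (simp add: midpoint_step_def)
    next
      case 3
      then show ?thesis using dm(2)[of j] by (simp add: midpoint_step_def)
    next
      case 4
      have j1: "0 < Suc j" "Suc j < M" using 4 by auto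
      note n = admissible_near[OF x 4(1) jM]
      have c: "x i j \<in> ball (x i j) r" using r S0 by simp
      have "dist (x i j) (x i (j + 2)) \<le> S + S"
        using dist_triangle[of "x i j" "x i (j + 2)" "x i (Suc j)"] s[OF i jM] s[OF i j1(2)] by simp
      then have f: "x i (j + 2) \<in> ball (x i j) r" using r S0 by simp
      have "dist (mid (x i (j - 1)) (x i (j + 1))) (mid (x i j) (x i (j + 2))) \<le>
          (dist (x i (j - 1)) (x i j) + dist (x i (j + 1)) (x i (j + 2))) / 2"
        by (rule mid_convex[OF admissible_ball[OF x i less_imp_le[OF jM]] n(1)[OF i] n(2)[OF i] c f])
      also have "\<dots> \<le> S"
      proof -
        have k: "j - 1 < M" "Suc (j - 1) = j" using 4 by auto
        have "dist (x i (j - 1)) (x i j) \<le> S" using s[OF i k(1)] k(2) by simp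
        then show ?thesis using s[OF i j1(2)] by simp
      qed
      finally show ?thesis using 4 by (simp add: midpoint_step_def)
    qed
  qed
  show "dist (midpoint_step M x i j) (midpoint_step M x (Suc i) j) \<le> D" if i: "i < N" and j: "j \<le> M" for i j
  proof (cases "0 < j \<and> j < M")
    case True
    have d: "dist (x i (j - 1)) (x (Suc i) (j - 1)) \<le> D" "dist (x i (j + 1)) (x (Suc i) (j + 1)) \<le> D"
      using x i True unfolding admissible_def by auto
    have average: "w \<le> D" if "w \<le> (u + v) / 2" "u \<le> D" "v \<le> D" for u v w :: real
      using that by simp
    show ?thesis by (rule average[OF midpoint_step_gap[OF x i conjunct1[OF True] conjunct2[OF True]] d])
  next
    case False
    then show ?thesis using x i j by (auto simp: midpoint_step_def admissible_def)
  qed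
qed

text \<open>In the extreme polygons, \<open>x 0\<close> and \<open>x N\<close>, every vertex is the midpoint of its neighbours, so they do not move. In between the
gaps of consecutive polygons satisfy the discrete heat inequality with boundary value
\<open>0\<close> at the common starting point and a constant at the other end. In the limit they are bounded
by the linear interpolation, and their sum bounds the distance of the extreme polygons.\<close>

theorem midpoint_flow_contraction:
  assumes x: "admissible p N M S D x" and M: "0 < M"
    and rows: "\<And>i j. i = 0 \<or> i = N \<Longrightarrow> 0 < j \<Longrightarrow> j < M \<Longrightarrow> metric_midpoint (x i j) (x i (j - 1)) (x i (j + 1))"
    and j: "j \<le> M"
  shows "dist (x 0 j) (x N j) \<le> real j / real M * (\<Sum>i<N. dist (x i M) (x (Suc i) M))"
proof -
  define X where "X k = (midpoint_step M ^^ k) x" for k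
  have X0: "X 0 = x" and XS: "X (Suc k) = midpoint_step M (X k)" for k by (simp_all add: X_def)
  have adm: "admissible p N M S D (X k)" for k
    by (induction k) (auto simp: X0 XS x intro: midpoint_step_admissible)
  have fixM: "X k i M = x i M" for k i by (induction k) (auto simp: X0 XS midpoint_step_def)
  have fixed: "\<forall>j\<le>M. X k i j = x i j" if i: "i = 0 \<or> i = N" for k i
  proof (induction k)
    case (Suc k)
    have "X (Suc k) i j = x i j" if j: "j \<le> M" for j
    proof -
      have "midpoint_step M (X k) i j = X k i j"
      proof (rule midpoint_step_fixed[OF adm _ j])
        show "metric_midpoint (X k i j) (X k i (j - 1)) (X k i (j + 1))" if "0 < j" "j < M"
          using rows[OF i that] Suc that by simp
      qed (use i in auto)
      then show ?thesis using Suc j XS by simp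
    qed
    then show ?case by blast
  qed (simp add: X0)
  let ?t = "1 - 1 / (real M)\<^sup>2" and ?w = "real j * (real M - real j)"
  have gap: "dist (X k i j) (X k (Suc i) j) \<le> real j / real M * dist (x i M) (x (Suc i) M) + D * ?t ^ k * ?w"
    if i: "i < N" for i k
  proof (rule discrete_heat_decay[where e = "\<lambda>k j. dist (X k i j) (X k (Suc i) j)", OF _ _ _ S0(2) _ _ j M])
    show "dist (X k i 0) (X k (Suc i) 0) \<le> 0" for k using adm[of k] i by (simp add: admissible_def)
    show "dist (X k i M) (X k (Suc i) M) \<le> dist (x i M) (x (Suc i) M)" for k by (simp add: fixM)
    show "dist (X (Suc k) i j) (X (Suc k) (Suc i) j) \<le>
       (dist (X k i (j - 1)) (X k (Suc i) (j - 1)) + dist (X k i (j + 1)) (X k (Suc i) (j + 1))) / 2"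
      if "0 < j" "j < M" for k j unfolding XS by (rule midpoint_step_gap[OF adm i that])
    show "dist (X 0 i j) (X 0 (Suc i) j) \<le> D" if "j \<le> M" for j using adm[of 0] i that by (simp add: admissible_def)
  qed simp
  have le: "dist (x 0 j) (x N j) \<le> real j / real M * (\<Sum>i<N. dist (x i M) (x (Suc i) M)) + real N * (D * ?t ^ k * ?w)" for k
  proof -
    have "dist (x 0 j) (x N j) = dist (X k 0 j) (X k N j)" using fixed[of 0 k] fixed[of N k] j by simp
    also have "\<dots> \<le> (\<Sum>i<N. dist (X k i j) (X k (Suc i) j))" using dist_chain_le[of "\<lambda>i. X k i j" N] .
    also have "\<dots> \<le> (\<Sum>i<N. real j / real M * dist (x i M) (x (Suc i) M) + D * ?t ^ k * ?w)"
      by (rule sum_mono) (use gap in simp)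
    finally show ?thesis by (simp add: sum.distrib sum_distrib_left)
  qed
  have "0 \<le> ?t" "?t < 1" using M by (auto simp: divide_le_eq)
  then have lim: "(\<lambda>k. ?t ^ k) \<longlonglongrightarrow> 0" by (rule LIMSEQ_realpow_zero)
  have "(\<lambda>k. real j / real M * (\<Sum>i<N. dist (x i M) (x (Suc i) M)) + real N * (D * ?t ^ k * ?w)) \<longlonglongrightarrow>
      real j / real M * (\<Sum>i<N. dist (x i M) (x (Suc i) M)) + real N * (D * 0 * ?w)"
    by (intro tendsto_add tendsto_mult tendsto_const lim)
  from LIMSEQ_le_const[OF this] le show ?thesis by auto
qed

end

section \<open>Filling a triangle by a grid\<close>

text \<open>The extreme rows sample the curves \<open>a\<close> and \<open>b\<close>, and the last column has length at most \<open>l\<close>. The last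
condition localizes the grid near \<open>Z\<close>. It survives refinement because a new point is within \<open>S / 2\<close>
or \<open>D / 2\<close> of an old one, while \<open>S\<close> or \<open>D\<close> itself is halved.\<close>

definition fine_grid ::
  "'a::metric_space set \<Rightarrow> real \<Rightarrow> (real \<Rightarrow> 'a) \<Rightarrow> (real \<Rightarrow> 'a) \<Rightarrow> 'a \<Rightarrow> real
    \<Rightarrow> nat \<Rightarrow> nat \<Rightarrow> real \<Rightarrow> real \<Rightarrow> (nat \<Rightarrow> nat \<Rightarrow> 'a) \<Rightarrow> bool" where
  "fine_grid Z r a b p l N M S D x \<longleftrightarrow> 0 < N \<and> 0 < M \<and> 0 \<le> S \<and> 0 \<le> D \<and> admissible p N M S D x \<and>
     (\<forall>j\<le>M. x 0 j = a (real j / real M) \<and> x N j = b (real j / real M)) \<and>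
     (\<Sum>i<N. dist (x i M) (x (Suc i) M)) \<le> l \<and>
     (\<forall>i\<le>N. \<forall>j\<le>M. \<exists>z\<in>Z. dist z (x i j) + S + D \<le> r)"

lemma sum_double: "(\<Sum>i<2 * N. f i) = (\<Sum>i<N. f (2 * i) + f (Suc (2 * i)))" for f :: "nat \<Rightarrow> real"
  by (induction N) auto

lemma even_odd_le:
  assumes "i \<le> 2 * (N::nat)"
  obtains a where "a \<le> N" "i = 2 * a" | a where "a < N" "i = Suc (2 * a)"
proof (cases "even i")
  case True
  then obtain a where "i = 2 * a" by (elim evenE)
  then show ?thesis using assms that(1) by auto
next
  case False
  then obtain a where "i = 2 * a + 1" by (elim oddE)
  then show ?thesis using assms that(2)[of a] by auto
qed

context
  fixes Z :: "'a::metric_space set" and r :: real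
  assumes BC: "\<And>z. z \<in> Z \<Longrightarrow> Busemann_convex (ball z (2 * r))" and r: "0 < r"
begin

text \<open>A single ball with convex midpoints contains all four corners of a cell. This licenses the midpoint
constructions in the refinements below.\<close>

lemma grid_cell:
  assumes x: "fine_grid Z r a b p l N M S D x" and ij: "i \<le> N" "j \<le> M"
  shows "\<exists>z\<in>Z. Busemann_convex (ball z (2 * r)) \<and> dist z (x i j) + S + D \<le> r \<and> x i j \<in> ball z (2 * r) \<and>
     (i < N \<longrightarrow> x (Suc i) j \<in> ball z (2 * r)) \<and> (j < M \<longrightarrow> x i (Suc j) \<in> ball z (2 * r)) \<and>
     (i < N \<and> j < M \<longrightarrow> x (Suc i) (Suc j) \<in> ball z (2 * r))"
proof -
  obtain z where z: "z \<in> Z" "dist z (x i j) + S + D \<le> r" using x ij unfolding fine_grid_def by blast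
  have SD: "0 \<le> S" "0 \<le> D" and adm: "admissible p N M S D x" using x unfolding fine_grid_def by auto
  have d: "i < N \<Longrightarrow> dist (x i j) (x (Suc i) j) \<le> D" "j < M \<Longrightarrow> dist (x i j) (x i (Suc j)) \<le> S"
    "i < N \<Longrightarrow> j < M \<Longrightarrow> dist (x (Suc i) j) (x (Suc i) (Suc j)) \<le> S"
    using adm ij unfolding admissible_def by auto
  have "i < N \<Longrightarrow> dist z (x (Suc i) j) \<le> r" "j < M \<Longrightarrow> dist z (x i (Suc j)) \<le> r"
    using d z SD dist_triangle[of z "x (Suc i) j" "x i j"] dist_triangle[of z "x i (Suc j)" "x i j"] by linarith+
  moreover have "i < N \<Longrightarrow> j < M \<Longrightarrow> dist z (x (Suc i) (Suc j)) \<le> r"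
    using d z SD dist_triangle[of z "x (Suc i) (Suc j)" "x (Suc i) j"] dist_triangle[of z "x (Suc i) j" "x i j"] by linarith
  ultimately show ?thesis using z SD r BC[OF z(1)] by (intro bexI[of _ z]) fastforce+
qed

lemma refine_rows:
  assumes x: "fine_grid Z r a b p l N M S D x"
  shows "\<exists>y. fine_grid Z r a b p l (2 * N) M S (D / 2) y"
proof -
  define y where "y i j = (if even i then x (i div 2) j else mid (x (i div 2) j) (x (Suc (i div 2)) j))" for i j
  have y0: "y (2 * i) j = x i j" and y1: "y (Suc (2 * i)) j = mid (x i j) (x (Suc i) j)" for i j
    by (simp_all add: y_def)
  have N: "0 < N" "0 < M" and SD: "0 \<le> S" "0 \<le> D" and adm: "admissible p N M S D x" and ends: "\<forall>j\<le>M. x 0 j = a (real j / real M) \<and> x N j = b (real j / real M)"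
    and sum: "(\<Sum>i<N. dist (x i M) (x (Suc i) M)) \<le> l" using x unfolding fine_grid_def by auto
  have start: "x i 0 = p" and step: "j < M \<Longrightarrow> dist (x i j) (x i (Suc j)) \<le> S" if "i \<le> N" for i j
    using adm that unfolding admissible_def by auto
  have gap: "dist (x i j) (x (Suc i) j) \<le> D" if "i < N" "j \<le> M" for i j using adm that unfolding admissible_def by auto
  have dm: "dist (x i j) (mid (x i j) (x (Suc i) j)) = dist (x i j) (x (Suc i) j) / 2"
    "dist (mid (x i j) (x (Suc i) j)) (x (Suc i) j) = dist (x i j) (x (Suc i) j) / 2" if ij: "i < N" "j \<le> M" for i j
    using grid_cell[OF x less_imp_le[OF ij(1)] ij(2)] ij dist_mid by metis+
  have "admissible p (2 * N) M S (D / 2) y"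
    unfolding admissible_def
  proof (intro conjI allI impI)
    show "y i 0 = p" if "i \<le> 2 * N" for i
      using that
    proof (cases rule: even_odd_le)
      case (2 c)
      have "dist (x c 0) (mid (x c 0) (x (Suc c) 0)) = 0" using dm(1)[OF 2(1), of 0] start[of c] start[of "Suc c"] 2 by simp
      then show ?thesis using 2 start[of c] by (simp add: y1)
    qed (simp add: y0 start)
    show "dist (y i j) (y i (Suc j)) \<le> S" if i: "i \<le> 2 * N" and j: "j < M" for i j
      using i
    proof (cases rule: even_odd_le)
      case (2 c)
      obtain z where z: "Busemann_convex (ball z (2 * r))" "x c j \<in> ball z (2 * r)" "x (Suc c) j \<in> ball z (2 * r)"
        "x c (Suc j) \<in> ball z (2 * r)" "x (Suc c) (Suc j) \<in> ball z (2 * r)"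
        using grid_cell[OF x less_imp_le[OF 2(1)] less_imp_le[OF j]] 2(1) j by blast
      have "dist (y i j) (y i (Suc j)) \<le> (dist (x c j) (x c (Suc j)) + dist (x (Suc c) j) (x (Suc c) (Suc j))) / 2"
        unfolding 2 y1 by (rule mid_convex[OF z])
      then show ?thesis using step[of c j] step[of "Suc c" j] 2 j by simp
    qed (simp add: y0 step j)
    show "dist (y i j) (y (Suc i) j) \<le> D / 2" if i: "i < 2 * N" and j: "j \<le> M" for i j
      using less_imp_le[OF i]
    proof (cases rule: even_odd_le)
      case (1 c)
      then have c: "c < N" using i by simp
      show ?thesis unfolding 1 y0 y1 dm(1)[OF c j] using gap[OF c j] by simp
    next
      case (2 c)
      have "y (Suc i) j = x (Suc c) j" using y0[of "Suc c" j] 2 by simp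
      then show ?thesis unfolding 2 y1 using dm(2)[OF 2(1) j] gap[OF 2(1) j] 2 by simp
    qed
  qed
  moreover have "(\<Sum>i<2 * N. dist (y i M) (y (Suc i) M)) \<le> l"
  proof -
    have "dist (y (2 * i) M) (y (Suc (2 * i)) M) + dist (y (Suc (2 * i)) M) (y (Suc (Suc (2 * i))) M) = dist (x i M) (x (Suc i) M)"
      if "i < N" for i
      using dm[OF that order_refl] y0[of "Suc i" M] by (simp add: y0 y1)
    then show ?thesis using sum by (simp add: sum_double)
  qed
  moreover have "\<exists>z\<in>Z. dist z (y i j) + S + D / 2 \<le> r" if i: "i \<le> 2 * N" and j: "j \<le> M" for i j
    using i
  proof (cases rule: even_odd_le)
    case (1 c)
    obtain z where "z \<in> Z" "dist z (x c j) + S + D \<le> r" using grid_cell[OF x 1(1) j] by blast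
    then show ?thesis unfolding 1 y0 using SD by (intro bexI[of _ z]) auto
  next
    case (2 c)
    obtain z where z: "z \<in> Z" "dist z (x c j) + S + D \<le> r" using grid_cell[OF x less_imp_le[OF 2(1)] j] by blast
    have "dist z (y i j) \<le> dist z (x c j) + dist (x c j) (y i j)" by (rule dist_triangle)
    moreover have "dist (x c j) (y i j) \<le> D / 2" unfolding 2 y1 dm(1)[OF 2(1) j] using gap[OF 2(1) j] by simp
    ultimately show ?thesis using z by (intro bexI[of _ z]) auto
  qed
  moreover have "y 0 j = x 0 j" "y (2 * N) j = x N j" for j using y0[of 0 j] y0[of N j] by auto
  ultimately show ?thesis using N SD ends unfolding fine_grid_def by (intro exI[of _ y]) auto
qed

text \<open>The extreme rows are sampled from curves of constant speed, whose intermediate values are midpoints;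
by uniqueness of midpoints the refined rows again sample these curves.\<close>

lemma refine_columns:
  assumes x: "fine_grid Z r a b p l N M S D x"
    and ab: "\<And>s t. s \<in> {0..1} \<Longrightarrow> t \<in> {0..1} \<Longrightarrow> dist (a s) (a t) = T * \<bar>s - t\<bar>"
       "\<And>s t. s \<in> {0..1} \<Longrightarrow> t \<in> {0..1} \<Longrightarrow> dist (b s) (b t) = T * \<bar>s - t\<bar>"
  shows "\<exists>y. fine_grid Z r a b p l N (2 * M) (S / 2) D y"
proof -
  define y where "y i j = (if even j then x i (j div 2) else mid (x i (j div 2)) (x i (Suc (j div 2))))" for i j
  have y0: "y i (2 * j) = x i j" and y1: "y i (Suc (2 * j)) = mid (x i j) (x i (Suc j))" for i j
    by (simp_all add: y_def)
  have N: "0 < N" "0 < M" and SD: "0 \<le> S" "0 \<le> D" and adm: "admissible p N M S D x" and ends: "\<forall>j\<le>M. x 0 j = a (real j / real M) \<and> x N j = b (real j / real M)"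
    and sum: "(\<Sum>i<N. dist (x i M) (x (Suc i) M)) \<le> l" using x unfolding fine_grid_def by auto
  have start: "x i 0 = p" and step: "j < M \<Longrightarrow> dist (x i j) (x i (Suc j)) \<le> S" if "i \<le> N" for i j
    using adm that unfolding admissible_def by auto
  have gap: "dist (x i j) (x (Suc i) j) \<le> D" if "i < N" "j \<le> M" for i j using adm that unfolding admissible_def by auto
  have dm: "dist (x i j) (mid (x i j) (x i (Suc j))) = dist (x i j) (x i (Suc j)) / 2"
    "dist (mid (x i j) (x i (Suc j))) (x i (Suc j)) = dist (x i j) (x i (Suc j)) / 2" if ij: "i \<le> N" "j < M" for i j
    using grid_cell[OF x ij(1) less_imp_le[OF ij(2)]] ij dist_mid by metis+
  have "admissible p N (2 * M) (S / 2) D y"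
    unfolding admissible_def
  proof (intro conjI allI impI)
    show "y i 0 = p" if "i \<le> N" for i using y0[of i 0] start[OF that] by simp
    show "dist (y i j) (y i (Suc j)) \<le> S / 2" if i: "i \<le> N" and j: "j < 2 * M" for i j
      using less_imp_le[OF j]
    proof (cases rule: even_odd_le)
      case (1 c)
      then have c: "c < M" using j by simp
      show ?thesis unfolding 1 y0 y1 dm(1)[OF i c] using step[OF i c] by simp
    next
      case (2 c)
      have "y i (Suc j) = x i (Suc c)" using y0[of i "Suc c"] 2 by simp
      then show ?thesis unfolding 2 y1 using dm(2)[OF i 2(1)] step[OF i 2(1)] 2 by simp
    qed
    show "dist (y i j) (y (Suc i) j) \<le> D" if i: "i < N" and j: "j \<le> 2 * M" for i j
      using j
    proof (cases rule: even_odd_le)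
      case (2 c)
      obtain z where z: "Busemann_convex (ball z (2 * r))" "x i c \<in> ball z (2 * r)" "x i (Suc c) \<in> ball z (2 * r)"
        "x (Suc i) c \<in> ball z (2 * r)" "x (Suc i) (Suc c) \<in> ball z (2 * r)"
        using grid_cell[OF x less_imp_le[OF i] less_imp_le[OF 2(1)]] 2(1) i by blast
      have "dist (y i j) (y (Suc i) j) \<le> (dist (x i c) (x (Suc i) c) + dist (x i (Suc c)) (x (Suc i) (Suc c))) / 2"
        unfolding 2 y1 by (rule mid_convex[OF z])
      then show ?thesis using gap[OF i, of c] gap[OF i, of "Suc c"] 2 by simp
    qed (simp add: y0 gap i)
  qed
  moreover have "(\<Sum>i<N. dist (y i (2 * M)) (y (Suc i) (2 * M))) \<le> l" using sum by (simp add: y0)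
  moreover have "\<exists>z\<in>Z. dist z (y i j) + S / 2 + D \<le> r" if i: "i \<le> N" and j: "j \<le> 2 * M" for i j
    using j
  proof (cases rule: even_odd_le)
    case (1 c)
    obtain z where "z \<in> Z" "dist z (x i c) + S + D \<le> r" using grid_cell[OF x i 1(1)] by blast
    then show ?thesis unfolding 1 y0 using SD by (intro bexI[of _ z]) auto
  next
    case (2 c)
    obtain z where z: "z \<in> Z" "dist z (x i c) + S + D \<le> r" using grid_cell[OF x i less_imp_le[OF 2(1)]] by blast
    have "dist z (y i j) \<le> dist z (x i c) + dist (x i c) (y i j)" by (rule dist_triangle)
    moreover have "dist (x i c) (y i j) \<le> S / 2" unfolding 2 y1 dm(1)[OF i 2(1)] using step[OF i 2(1)] by simp
    ultimately show ?thesis using z by (intro bexI[of _ z]) auto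
  qed
  moreover have row: "y i j = f (real j / real (2 * M))"
    if i: "i \<le> N" and f: "\<And>s t. s \<in> {0..1} \<Longrightarrow> t \<in> {0..1} \<Longrightarrow> dist (f s) (f t) = T * \<bar>s - t\<bar>"
      and xf: "\<And>j. j \<le> M \<Longrightarrow> x i j = f (real j / real M)" and j: "j \<le> 2 * M" for i j f
    using j
  proof (cases rule: even_odd_le)
    case (1 c)
    then show ?thesis using xf[of c] by (simp add: y0)
  next
    case (2 c)
    obtain z where z: "Busemann_convex (ball z (2 * r))" "x i c \<in> ball z (2 * r)" "x i (Suc c) \<in> ball z (2 * r)"
      using grid_cell[OF x i less_imp_le[OF 2(1)]] 2(1) by blast
    let ?s = "real c / real M" and ?t = "real (Suc c) / real M" and ?u = "real j / real (2 * M)"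
    have m: "?s \<in> {0..1}" "?t \<in> {0..1}" "?u \<in> {0..1}" using 2 N by (auto simp: divide_le_eq)
    have u: "?u - ?s = 1 / (2 * real M)" "?t - ?u = 1 / (2 * real M)" "?t - ?s = 1 / real M"
      using 2 N by (simp_all add: field_simps)
    have e: "\<bar>?s - ?u\<bar> = 1 / (2 * real M)" "\<bar>?u - ?t\<bar> = 1 / (2 * real M)" "\<bar>?s - ?t\<bar> = 1 / real M"
      unfolding abs_minus_commute[of ?s ?u] abs_minus_commute[of ?u ?t] abs_minus_commute[of ?s ?t] u by simp_all
    have "metric_midpoint (f ?u) (f ?s) (f ?t)"
      unfolding metric_midpoint_def f[OF m(1,3)] f[OF m(3,2)] f[OF m(1,2)] e by simp
    then have "metric_midpoint (f ?u) (x i c) (x i (Suc c))" using xf[of c] xf[of "Suc c"] 2 by simp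
    from mid_unique[OF z this] show ?thesis unfolding 2 y1 using 2 by simp
  qed
  moreover have "y 0 j = a (real j / real (2 * M))" if "j \<le> 2 * M" for j
    by (rule row[OF _ ab(1) _ that]) (use ends in auto)
  moreover have "y N j = b (real j / real (2 * M))" if "j \<le> 2 * M" for j
    by (rule row[OF _ ab(2) _ that]) (use ends in auto)
  ultimately show ?thesis using N SD unfolding fine_grid_def by (intro exI[of _ y]) auto
qed

text \<open>Refinement makes the mesh small but keeps the bound \<open>M * S\<close> for the length of a row. This is what the
flow needs: the convexity radius depends on the ball that the flow may reach, hence on \<open>M * S\<close>,
and the mesh has to be small compared to this radius.\<close>

lemma refine:
  assumes x: "fine_grid Z r a b p l N M S D x"
    and ab: "\<And>s t. s \<in> {0..1} \<Longrightarrow> t \<in> {0..1} \<Longrightarrow> dist (a s) (a t) = T * \<bar>s - t\<bar>"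
       "\<And>s t. s \<in> {0..1} \<Longrightarrow> t \<in> {0..1} \<Longrightarrow> dist (b s) (b t) = T * \<bar>s - t\<bar>"
  shows "\<exists>y. fine_grid Z r a b p l (2 ^ k * N) (2 ^ k * M) (S / 2 ^ k) (D / 2 ^ k) y"
proof (induction k)
  case (Suc k)
  then obtain y where "fine_grid Z r a b p l (2 ^ k * N) (2 ^ k * M) (S / 2 ^ k) (D / 2 ^ k) y" by blast
  then obtain y where "fine_grid Z r a b p l (2 * (2 ^ k * N)) (2 ^ k * M) (S / 2 ^ k) (D / 2 ^ k / 2) y"
    using refine_rows by blast
  from refine_columns[OF this ab] show ?case by (simp add: mult.assoc mult.commute[of _ 2])
qed (use x in auto)

end

text \<open>Sample the strip, refine the grid until its mesh is below the convexity radius on the ball that the flow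
may reach, and let the flow run.\<close>

lemma strip_contraction:
  fixes H :: "real \<times> real \<Rightarrow> 'a::metric_space"
  assumes proper: "\<And>(p::'a) R. compact (cball p R)" and loc: "\<And>q::'a. \<exists>r>0. Busemann_convex (ball q r)"
    and H: "continuous_on ({0..1} \<times> {0..1}) H" and start: "\<And>s. s \<in> {0..1} \<Longrightarrow> H (s, 0) = p"
    and H01: "\<And>u. u \<in> {0..1} \<Longrightarrow> H (0, u) = a u" "\<And>u. u \<in> {0..1} \<Longrightarrow> H (1, u) = b u"
    and ab: "\<And>s t. s \<in> {0..1} \<Longrightarrow> t \<in> {0..1} \<Longrightarrow> dist (a s) (a t) = T * \<bar>s - t\<bar>"
       "\<And>s t. s \<in> {0..1} \<Longrightarrow> t \<in> {0..1} \<Longrightarrow> dist (b s) (b t) = T * \<bar>s - t\<bar>"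
    and len: "\<And>s t. 0 \<le> s \<Longrightarrow> s \<le> t \<Longrightarrow> t \<le> 1 \<Longrightarrow> dist (H (s, 1)) (H (t, 1)) \<le> La t - La s" "La 1 - La 0 \<le> l"
    and n: "0 < n"
  shows "dist (a (1 / real n)) (b (1 / real n)) \<le> l / real n"
proof -
  define Z where "Z = H ` ({0..1} \<times> {0..1})"
  have cQ: "compact ({0..1::real} \<times> {0..1::real})" by (intro compact_Times) auto
  have "compact Z" unfolding Z_def by (rule compact_continuous_image[OF H cQ])
  then obtain r2 where r2: "r2 > 0" "\<And>z. z \<in> Z \<Longrightarrow> Busemann_convex (ball z r2)"
    using uniform_Busemann_convex[OF _ loc] by blast
  define r where "r = r2 / 2"
  have r: "r > 0" and BC: "\<And>z. z \<in> Z \<Longrightarrow> Busemann_convex (ball z (2 * r))" using r2 by (auto simp: r_def)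
  define q where "q = r / 2"
  have q: "q > 0" using r by (simp add: q_def)
  have "uniformly_continuous_on ({0..1} \<times> {0..1}) H" by (rule compact_uniformly_continuous[OF H cQ])
  then obtain d where d: "d > 0" "\<And>u v. u \<in> {0..1} \<times> {0..1} \<Longrightarrow> v \<in> {0..1} \<times> {0..1} \<Longrightarrow> dist v u < d \<Longrightarrow> dist (H v) (H u) < q"
    using q unfolding uniformly_continuous_on_def by blast
  obtain K :: nat where K: "real K > 1 / d" using reals_Archimedean2 by blast
  have "0 < 1 / d" using d(1) by simp
  then have K0: "0 < real K" using K by linarith
  \<comment> \<open>A multiple of \<open>n\<close>, so that the parameter \<open>1 / n\<close> belongs to the grid.\<close>
  define N where "N = n * K"
  have N: "0 < N" using n K0 by (simp add: N_def)
  have "1 / real N \<le> 1 / real K" using n K0 by (intro divide_left_mono) (auto simp: N_def)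
  also have "1 / real K < d" using K K0 d(1) by (simp add: field_simps)
  finally have Nd: "1 / real N < d" .
  define x where "x i j = H (real i / real N, real j / real N)" for i j :: nat
  have in01: "real i / real N \<in> {0..1}" if "i \<le> N" for i using that N by (auto simp: divide_le_eq)
  have diff: "dist (real i / real N) (real (Suc i) / real N) = 1 / real N" for i
    by (simp add: dist_real_def add_divide_distrib)
  have "fine_grid Z r a b p l N N q q x"
    unfolding fine_grid_def admissible_def
  proof (intro conjI allI impI N less_imp_le[OF q])
    show "x i 0 = p" if "i \<le> N" for i using start[OF in01[OF that]] by (simp add: x_def)
    show "dist (x i j) (x i (Suc j)) \<le> q" if "i \<le> N" "j < N" for i j
      unfolding x_def by (rule less_imp_le[OF d(2)]) (use in01[of i] in01[of j] in01[of "Suc j"] that diff[of j] Nd in \<open>auto simp: dist_Pair_Pair\<close>)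
    show "dist (x i j) (x (Suc i) j) \<le> q" if "i < N" "j \<le> N" for i j
      unfolding x_def by (rule less_imp_le[OF d(2)]) (use in01[of i] in01[of j] in01[of "Suc i"] that diff[of i] Nd in \<open>auto simp: dist_Pair_Pair\<close>)
    show "x 0 j = a (real j / real N)" "x N j = b (real j / real N)" if "j \<le> N" for j
      using H01[OF in01[OF that]] N by (auto simp: x_def)
    show "(\<Sum>i<N. dist (x i N) (x (Suc i) N)) \<le> l"
    proof -
      have "(\<Sum>i<N. dist (x i N) (x (Suc i) N)) \<le> (\<Sum>i<N. La (real (Suc i) / real N) - La (real i / real N))"
      proof (rule sum_mono)
        fix i assume "i \<in> {..<N}"
        then have i: "i \<le> N" "Suc i \<le> N" by auto
        have "real i / real N \<le> real (Suc i) / real N" by (simp add: divide_right_mono)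
        then show "dist (x i N) (x (Suc i) N) \<le> La (real (Suc i) / real N) - La (real i / real N)"
          using len(1)[of "real i / real N" "real (Suc i) / real N"] in01[OF i(1)] in01[OF i(2)] N by (simp add: x_def)
      qed
      also have "\<dots> = La 1 - La 0" using sum_lessThan_telescope[of "\<lambda>i. La (real i / real N)" N] N by simp
      finally show ?thesis using len(2) by simp
    qed
    show "\<exists>z\<in>Z. dist z (x i j) + q + q \<le> r" if "i \<le> N" "j \<le> N" for i j
      by (rule bexI[of _ "x i j"]) (use in01[OF that(1)] in01[OF that(2)] in \<open>auto simp: Z_def x_def q_def\<close>)
  qed
  note G = refine[OF BC r this ab]
  define L where "L = real N * q"
  obtain r0 where r0: "r0 > 0" "\<And>z. z \<in> cball p L \<Longrightarrow> Busemann_convex (ball z r0)"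
    using uniform_Busemann_convex[OF proper loc] by blast
  obtain k where k: "(1 / 2) ^ k < r0 / (3 * q)"
    using real_arch_pow_inv[of "r0 / (3 * q)" "1 / 2"] r0(1) q by auto
  obtain y where y: "fine_grid Z r a b p l (2 ^ k * N) (2 ^ k * N) (q / 2 ^ k) (q / 2 ^ k) y" using G[of k] by blast
  define M where "M = 2 ^ k * N"
  have M: "0 < M" using N by (simp add: M_def)
  have y': "admissible p M M (q / 2 ^ k) (q / 2 ^ k) y" "\<And>j. j \<le> M \<Longrightarrow> y 0 j = a (real j / real M)" "\<And>j. j \<le> M \<Longrightarrow> y M j = b (real j / real M)"
     "(\<Sum>i<M. dist (y i M) (y (Suc i) M)) \<le> l"
    using y unfolding fine_grid_def M_def by auto
  have mids: "metric_midpoint (f (real j / real M)) (f (real (j - 1) / real M)) (f (real (j + 1) / real M))"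
    if f: "\<And>s t. s \<in> {0..1} \<Longrightarrow> t \<in> {0..1} \<Longrightarrow> dist (f s) (f t) = T * \<bar>s - t\<bar>" and j: "0 < j" "j < M" for f :: "real \<Rightarrow> 'a" and j
  proof -
    let ?s = "real (j - 1) / real M" and ?t = "real (j + 1) / real M" and ?u = "real j / real M"
    have m: "?s \<in> {0..1}" "?t \<in> {0..1}" "?u \<in> {0..1}" using j by (auto simp: divide_le_eq)
    have u: "?u - ?s = 1 / real M" "?t - ?u = 1 / real M" "?t - ?s = 2 / real M"
      using j by (simp_all add: of_nat_diff diff_divide_distrib add_divide_distrib)
    have e: "\<bar>?s - ?u\<bar> = 1 / real M" "\<bar>?u - ?t\<bar> = 1 / real M" "\<bar>?s - ?t\<bar> = 2 / real M"
      unfolding abs_minus_commute[of ?s ?u] abs_minus_commute[of ?u ?t] abs_minus_commute[of ?s ?t] u by simp_all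
    show ?thesis
      unfolding metric_midpoint_def f[OF m(1,3)] f[OF m(3,2)] f[OF m(1,2)] e by simp
  qed
  define j where "j = 2 ^ k * K"
  have jM: "j \<le> M" "real j / real M = 1 / real n" using n K0 by (auto simp: j_def M_def N_def)
  have "dist (y 0 j) (y M j) \<le> real j / real M * (\<Sum>i<M. dist (y i M) (y (Suc i) M))"
  proof (rule midpoint_flow_contraction[where L = L and r = r0, OF r0(2) _ _ _ _ y'(1) M _ jM(1)])
    show "real M * (q / 2 ^ k) \<le> L" by (simp add: M_def L_def)
    have "3 * q * (1 / 2) ^ k < r0" using k q by (simp add: field_simps)
    moreover have "q / 2 ^ k = q * (1 / 2) ^ k" by (simp add: power_one_over)
    ultimately show "2 * (q / 2 ^ k) + q / 2 ^ k < r0" by linarith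
    show "metric_midpoint (y i j) (y i (j - 1)) (y i (j + 1))" if "i = 0 \<or> i = M" "0 < j" "j < M" for i j
      using that mids[OF ab(1) that(2,3)] mids[OF ab(2) that(2,3)] y'(2)[of j] y'(2)[of "j - 1"] y'(2)[of "j + 1"]
        y'(3)[of j] y'(3)[of "j - 1"] y'(3)[of "j + 1"] by auto
  qed (use q in auto)
  also have "\<dots> \<le> real j / real M * l" using y'(4) by (intro mult_left_mono) auto
  finally show ?thesis using y'(2,3)[OF jM(1)] jM(2) by simp
qed

section \<open>Asymptotic rays\<close>

lemma homotopic_paths_square:
  fixes S :: "'a::topological_space set"
  assumes "homotopic_paths S p q"
  shows "\<exists>h. continuous_on ({0..1} \<times> {0..1}) h \<and> (\<forall>u\<in>{0..1}. h (0::real, u::real) = p u \<and> h (1, u) = q u) \<and>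
     (\<forall>s\<in>{0..1}. h (s, 0) = p 0 \<and> h (s, 1) = p 1)"
proof -
  obtain h :: "real \<times> real \<Rightarrow> 'a" where "continuous_on ({0..1} \<times> {0..1}) h" "\<forall>x\<in>{0..1}. h (0, x) = p x" "\<forall>x\<in>{0..1}. h (1, x) = q x"
    "\<forall>t\<in>{0..1::real}. pathstart (h \<circ> Pair t) = pathstart p \<and> pathfinish (h \<circ> Pair t) = pathfinish p"
    using assms unfolding homotopic_paths by blast
  then show ?thesis by (intro exI[of _ h]) (simp add: pathstart_def pathfinish_def)
qed

lemma homotopic_paths_convex_image:
  fixes f :: "'b::real_normed_vector \<Rightarrow> 'a::topological_space"
  assumes S: "convex S" and f: "continuous_on S f"
    and p: "path p" "path_image p \<subseteq> S" and q: "path q" "path_image q \<subseteq> S"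
    and ends: "pathstart q = pathstart p" "pathfinish q = pathfinish p"
  shows "homotopic_paths UNIV (f \<circ> p) (f \<circ> q)"
proof (rule homotopic_paths_continuous_image[OF _ f])
  have "simply_connected S" by (rule convex_imp_simply_connected[OF S])
  then show "homotopic_paths S p q" unfolding simply_connected_eq_homotopic_paths using p q ends by blast
qed simp

text \<open>Simple connectivity is defined by free homotopies of loops. Let \<open>h\<close> be such a homotopy from the
loop \<open>c\<close>, which is \<open>p\<close> followed by \<open>q\<close> backwards, to a constant loop. In the square, the path \<open>p\<close>
runs along the lower half of the left side. It can be deformed to the rest of the boundary, that is, to
the bottom, the right side, the top, and the upper half of the left side. On the right side \<open>h\<close> is
constant, the bottom and the top have the same image in opposite directions, and the upper half of the
left side yields \<open>q\<close>. So the image of this detour is a path in an interval followed by a map \<open>f\<close>, and in the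
interval the excursion along the bottom can be retracted.\<close>

lemma simply_connected_homotopic_paths:
  fixes p q :: "real \<Rightarrow> 'a::topological_space"
  assumes sc: "simply_connected (UNIV :: 'a set)" and pq: "path p" "path q"
    and ends: "pathstart q = pathstart p" "pathfinish q = pathfinish p"
  shows "homotopic_paths UNIV p q"
proof -
  have e: "q 0 = p 0" "q 1 = p 1" using ends by (auto simp: pathstart_def pathfinish_def)
  define c where "c = p +++ reversepath q"
  have "path c" unfolding c_def using pq ends by (intro path_join_imp) auto
  moreover have "pathfinish c = pathstart c" using ends by (simp add: c_def)
  moreover have "path (\<lambda>_::real. p 0)" by (simp add: path_def)
  ultimately have "homotopic_loops UNIV c (\<lambda>_. p 0)"
    using sc[unfolded simply_connected_def] by (simp add: pathstart_def pathfinish_def)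
  then obtain h :: "real \<times> real \<Rightarrow> 'a" where h: "continuous_on ({0..1} \<times> {0..1}) h"
    "\<forall>x\<in>{0..1}. h (0, x) = c x" "\<forall>x\<in>{0..1}. h (1, x) = p 0"
    "\<forall>t\<in>{0..1::real}. pathfinish (h \<circ> Pair t) = pathstart (h \<circ> Pair t)"
    unfolding homotopic_loops by blast
  have loop: "h (t, 1) = h (t, 0)" if "t \<in> {0..1}" for t
    using h(4) that by (simp add: pathstart_def pathfinish_def)
  have cp: "c (u / 2) = p u" if "u \<in> {0..1}" for u using that by (simp add: c_def joinpaths_def)
  have cq: "c (1 - u / 2) = q u" if "u \<in> {0..1}" for u
  proof (cases "u = 1")
    case True
    show ?thesis unfolding True using e by (simp add: c_def joinpaths_def)
  qed (use that in \<open>simp add: c_def joinpaths_def reversepath_def\<close>)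
  define f where "f x = (if x \<le> 0 then q (- x) else h (x, 0))" for x :: real
  have h00: "h (0, 0) = q 0" using h(2) cp[of 0] e by simp
  have f: "f (- x) = q x" "f x = h (x, 0)" if "x \<in> {0..1}" for x
  proof -
    show "f (- x) = q x" using that by (simp add: f_def)
    show "f x = h (x, 0)"
    proof (cases "x = 0")
      case True
      show ?thesis unfolding True f_def using h00 by simp
    qed (use that in \<open>simp add: f_def\<close>)
  qed
  have contf: "continuous_on {-1..1} f"
    unfolding f_def
  proof (rule continuous_on_cases_le)
    show "continuous_on {t \<in> {-1..1}. t \<le> 0} (\<lambda>x. q (- x))"
      by (rule continuous_on_compose2[OF pq(2)[unfolded path_def]]) (auto intro!: continuous_intros)
    show "continuous_on {t \<in> {-1..1}. 0 \<le> t} (\<lambda>x. h (x, 0))"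
      by (rule continuous_on_compose2[OF h(1)]) (auto intro!: continuous_intros)
  qed (use h00 in \<open>auto intro!: continuous_intros\<close>)
  let ?Q = "{0..1::real} \<times> {0..1::real}"
  have Q: "convex ?Q" by (intro convex_Times) auto
  have seg: "path_image (linepath x y) \<subseteq> ?Q" if "x \<in> ?Q" "y \<in> ?Q" for x y
    using closed_segment_subset[OF that Q] by simp
  have seg': "path_image (linepath x y) \<subseteq> {-1..1::real}" if "x \<in> {-1..1}" "y \<in> {-1..1}" for x y
    using closed_segment_subset[OF that convex_real_interval(5)] by simp
  let ?A0 = "linepath (0, 0) (0, 1/2) :: real \<Rightarrow> real \<times> real"
  let ?A1 = "(linepath (0, 0) (1, 0) +++ linepath (1, 0) (1, 1)) +++ (linepath (1, 1) (0, 1) +++ linepath (0, 1) (0, 1/2)) :: real \<Rightarrow> real \<times> real"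
  let ?A2 = "(linepath 0 1 +++ linepath 1 1) +++ (linepath 1 0 +++ linepath 0 (-1)) :: real \<Rightarrow> real"
  let ?A3 = "linepath 0 (-1) :: real \<Rightarrow> real"
  have 1: "homotopic_paths UNIV p (h \<circ> ?A0)"
  proof (rule homotopic_paths_eq[OF pq(1)])
    fix t :: real assume t: "t \<in> {0..1}"
    have "?A0 t = (0, t / 2)" by (simp add: linepath_def)
    moreover have "h (0, t / 2) = c (t / 2)" using h(2) t by auto
    ultimately show "p t = (h \<circ> ?A0) t" using cp[OF t] by simp
  qed simp
  have 2: "homotopic_paths UNIV (h \<circ> ?A0) (h \<circ> ?A1)"
  proof (rule homotopic_paths_convex_image[OF Q h(1)])
    show "path_image ?A0 \<subseteq> ?Q" by (rule seg) simp_all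
    show "path_image ?A1 \<subseteq> ?Q" by (intro subset_path_image_join seg) simp_all
    show "path ?A1" by (intro path_join_imp) simp_all
  qed simp_all
  have 3: "homotopic_paths UNIV (f \<circ> ?A2) (f \<circ> ?A3)"
  proof (rule homotopic_paths_convex_image[OF _ contf])
    show "path_image ?A2 \<subseteq> {-1..1}" by (intro subset_path_image_join seg') simp_all
    show "path_image ?A3 \<subseteq> {-1..1}" by (rule seg') simp_all
    show "path ?A2" by (intro path_join_imp) simp_all
  qed simp_all
  have 4: "homotopic_paths UNIV (f \<circ> ?A3) q"
  proof (rule homotopic_paths_eq)
    show "path (f \<circ> ?A3)" using homotopic_paths_imp_path[OF 3] by blast
    show "(f \<circ> ?A3) t = q t" if "t \<in> {0..1}" for t using f(1)[OF that] by (simp add: linepath_def)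
  qed simp
  have 5: "homotopic_paths UNIV (h \<circ> ?A1) (f \<circ> ?A2)"
  proof (rule homotopic_paths_eq)
    show "path (h \<circ> ?A1)" using homotopic_paths_imp_path[OF 2] by blast
    fix t :: real assume t: "t \<in> {0..1}"
    consider "t \<le> 1/4" | "1/4 < t" "t \<le> 1/2" | "1/2 < t" "t \<le> 3/4" | "3/4 < t" by linarith
    then show "(h \<circ> ?A1) t = (f \<circ> ?A2) t"
    proof cases
      case 1
      then have "?A1 t = (4 * t, 0)" "?A2 t = 4 * t" by (simp_all add: joinpaths_def linepath_def)
      then show ?thesis using f(2)[of "4 * t"] 1 t by simp
    next
      case 2
      then have "?A1 t = (1, 4 * t - 1)" "?A2 t = 1" by (simp_all add: joinpaths_def linepath_def algebra_simps)
      then show ?thesis using f(2)[of 1] h(3) 2 t by simp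
    next
      case 3
      then have "?A1 t = (3 - 4 * t, 1)" "?A2 t = 3 - 4 * t" by (simp_all add: joinpaths_def linepath_def algebra_simps)
      then show ?thesis using f(2)[of "3 - 4 * t"] loop[of "3 - 4 * t"] 3 t by simp
    next
      case 4
      then have "?A1 t = (0, 1 - (4 * t - 3) / 2)" "?A2 t = - (4 * t - 3)" by (simp_all add: joinpaths_def linepath_def algebra_simps)
      moreover have "h (0, 1 - (4 * t - 3) / 2) = c (1 - (4 * t - 3) / 2)" using h(2) 4 t by auto
      moreover have "f (- (4 * t - 3)) = q (4 * t - 3)" by (rule f(1)) (use 4 t in auto)
      ultimately show ?thesis using cq[of "4 * t - 3"] 4 t by simp
    qed
  qed simp
  show ?thesis
    by (rule homotopic_paths_trans[OF 1 homotopic_paths_trans[OF 2 homotopic_paths_trans[OF 5 homotopic_paths_trans[OF 3 4]]]])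
qed

text \<open>A free homotopy between two constant loops moves one point to the other.\<close>

lemma simply_connected_connected:
  assumes sc: "simply_connected (UNIV :: 'a::topological_space set)"
  shows "connected (UNIV :: 'a set)"
proof -
  have "\<exists>g. path g \<and> path_image g \<subseteq> UNIV \<and> pathstart g = x \<and> pathfinish g = y" for x y :: 'a
  proof -
    have "homotopic_loops UNIV (\<lambda>_. x) (\<lambda>_. y)"
      using sc[unfolded simply_connected_def] by (simp add: pathstart_def pathfinish_def path_def)
    then obtain h :: "real \<times> real \<Rightarrow> 'a" where h: "continuous_on ({0..1} \<times> {0..1}) h"
      "\<forall>u\<in>{0..1::real}. h (0, u) = x" "\<forall>u\<in>{0..1::real}. h (1, u) = y" unfolding homotopic_loops by blast
    have "path (\<lambda>t. h (t, 0))" unfolding path_def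
      by (rule continuous_on_compose2[OF h(1)]) (auto intro!: continuous_intros)
    then show ?thesis using h by (intro exI[of _ "\<lambda>t. h (t, 0)"]) (auto simp: pathstart_def pathfinish_def)
  qed
  then have "path_connected (UNIV :: 'a set)" unfolding path_connected_def by blast
  then show ?thesis by (rule path_connected_imp_connected)
qed

text \<open>Follow the rays up to time \<open>T = n * t\<close> and close the triangle by a curve of length at most \<open>K + 1\<close>. Simple
connectivity fills the triangle by a strip of curves that start at the common origin. The contraction of
the strip gives \<open>dist (a t) (b t) \<le> (K + 1) / n\<close>.\<close>

theorem bounded_rays_coincide:
  fixes a b :: "real \<Rightarrow> 'a::metric_space"
  assumes proper: "\<And>(p::'a) R. compact (cball p R)" and loc: "\<And>q::'a. \<exists>r>0. Busemann_convex (ball q r)"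
    and almost: "\<And>p q e. e > 0 \<Longrightarrow> \<exists>c L. almost_geodesic c L (p::'a) q e"
    and sc: "simply_connected (UNIV :: 'a set)"
    and ab: "geodesic_ray a" "geodesic_ray b" "a 0 = b 0"
    and K: "\<And>t. 0 \<le> t \<Longrightarrow> dist (a t) (b t) \<le> K" and t: "0 \<le> t"
  shows "a t = b t"
proof -
  have le: "dist (a t) (b t) \<le> (K + 1) / real n" if n: "0 < n" for n
  proof -
    define T where "T = real n * t"
    have T: "0 \<le> T" using t by (simp add: T_def)
    define a' where "a' u = a (u * T)" for u
    define b' where "b' u = b (u * T)" for u
    have iso: "dist (f (s * T)) (f (u * T)) = T * \<bar>s - u\<bar>" if "geodesic_ray f" "s \<in> {0..1}" "u \<in> {0..1}" for f :: "real \<Rightarrow> 'a" and s u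
    proof -
      have "dist (f (s * T)) (f (u * T)) = \<bar>s * T - u * T\<bar>" using that T unfolding geodesic_ray_def by auto
      also have "\<dots> = T * \<bar>s - u\<bar>" using T by (simp add: left_diff_distrib[symmetric] abs_mult)
      finally show ?thesis .
    qed
    have a': "dist (a' s) (a' u) = T * \<bar>s - u\<bar>" and b': "dist (b' s) (b' u) = T * \<bar>s - u\<bar>"
      if "s \<in> {0..1}" "u \<in> {0..1}" for s u
      unfolding a'_def b'_def using iso[OF ab(1) that] iso[OF ab(2) that] .
    have cont: "continuous_on {0..1} f" if f: "\<And>s u. s \<in> {0..1} \<Longrightarrow> u \<in> {0..1} \<Longrightarrow> dist (f s) (f u) = T * \<bar>s - u\<bar>" for f :: "real \<Rightarrow> 'a"
    proof -
      have "T-lipschitz_on {0..1} f" by (rule lipschitz_onI) (use f T in \<open>auto simp: dist_real_def\<close>)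
      then show ?thesis by (rule lipschitz_on_continuous_on)
    qed
    obtain c L where "almost_geodesic c L (a T) (b T) 1" using almost[of 1 "a T" "b T"] by auto
    then have c: "continuous_on {0..1} c" "c 0 = a T" "c 1 = b T" "L 1 - L 0 \<le> dist (a T) (b T) + 1"
      "\<And>s u. 0 \<le> s \<Longrightarrow> s \<le> u \<Longrightarrow> u \<le> 1 \<Longrightarrow> dist (c s) (c u) \<le> L u - L s"
      unfolding almost_geodesic_def by auto
    define P where "P = a' +++ c"
    have pa: "path a'" "path b'" "path c" using cont[OF a'] cont[OF b'] c(1) by (auto simp: path_def)
    have pP: "path P" unfolding P_def by (rule path_join_imp[OF pa(1,3)]) (simp add: pathfinish_def pathstart_def a'_def c)
    have Pv: "P u = a' (2 * u)" if "u \<le> 1/2" for u using that by (simp add: P_def joinpaths_def)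
    have Pc: "P u = c (2 * u - 1)" if "1/2 \<le> u" for u
    proof (cases "u = 1/2")
      case True
      show ?thesis unfolding True P_def joinpaths_def by (simp add: a'_def c)
    qed (use that in \<open>simp add: P_def joinpaths_def\<close>)
    have P01: "P 0 = a 0" "P 1 = b T" using Pv[of 0] Pc[of 1] c by (auto simp: a'_def)
    have "homotopic_paths UNIV P b'"
      by (rule simply_connected_homotopic_paths[OF sc pP pa(2)])
        (use P01 ab(3) in \<open>simp_all add: pathstart_def pathfinish_def b'_def[of 0] b'_def[of 1]\<close>)
    then obtain h where h0: "continuous_on ({0..1} \<times> {0..1}) h"
      "\<forall>u\<in>{0..1}. h (0::real, u::real) = P u \<and> h (1, u) = b' u" "\<forall>s\<in>{0..1}. h (s, 0) = P 0 \<and> h (s, 1) = P 1"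
      using homotopic_paths_square by blast
    then have h: "continuous_on ({0..1} \<times> {0..1}) h" "\<And>u. u \<in> {0..1} \<Longrightarrow> h (0, u) = P u"
      "\<And>u. u \<in> {0..1} \<Longrightarrow> h (1, u) = b' u" "\<And>s. s \<in> {0..1} \<Longrightarrow> h (s, 0) = P 0" "\<And>s. s \<in> {0..1} \<Longrightarrow> h (s, 1) = P 1"
      by auto
    \<comment> \<open>In the first half of the family the curve follows \<open>a'\<close> and then a growing part of \<open>c\<close>. In the second half
         it is deformed to \<open>b'\<close> with fixed ends. The free ends thus run through \<open>c\<close> and then rest.\<close>
    define H where "H z = (if fst z \<le> 1/2 then P (snd z * (1/2 + fst z)) else h (2 * fst z - 1, snd z))" for z :: "real \<times> real"
    have Hc: "continuous_on ({0..1} \<times> {0..1}) H"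
      unfolding H_def
    proof (rule continuous_on_cases_le)
      have 1: "u * (1/2 + s) \<in> {0..1}" if "s \<in> {0..1}" "s \<le> 1/2" "u \<in> {0..1}" for s u :: real
      proof -
        have "u * (1/2 + s) \<le> 1 * 1" using that by (intro mult_mono) auto
        then show ?thesis using that by simp
      qed
      show "continuous_on {z \<in> {0..1} \<times> {0..1}. fst z \<le> 1/2} (\<lambda>z. P (snd z * (1/2 + fst z)))"
        by (rule continuous_on_compose2[OF pP[unfolded path_def]]) (use 1 in \<open>auto intro!: continuous_intros\<close>)
      show "continuous_on {z \<in> {0..1} \<times> {0..1}. 1/2 \<le> fst z} (\<lambda>z. h (2 * fst z - 1, snd z))"
        by (rule continuous_on_compose2[OF h(1)]) (auto intro!: continuous_intros)
      show "P (snd z * (1/2 + fst z)) = h (2 * fst z - 1, snd z)" if "z \<in> {0..1} \<times> {0..1}" "fst z = 1/2" for z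
      proof -
        have "2 * fst z - 1 = 0" "1/2 + fst z = 1" "snd z \<in> {0..1}" using that by auto
        then show ?thesis using h(2)[of "snd z"] by (simp only: mult_1_right)
      qed
    qed (auto intro!: continuous_intros)
    have H1: "H (s, 1) = c (min (2 * s) 1)" if s: "s \<in> {0..1}" for s
    proof (cases "s \<le> 1/2")
      case True
      then show ?thesis using Pc[of "1/2 + s"] s by (simp add: H_def)
    next
      case False
      then show ?thesis using h(5)[of "2 * s - 1"] s P01 c by (simp add: H_def)
    qed
    have "dist (a' (1 / real n)) (b' (1 / real n)) \<le> (K + 1) / real n"
    proof (rule strip_contraction[where H = H and p = "a 0" and La = "\<lambda>s. L (min (2 * s) 1)" and T = T, OF proper loc Hc])
      show "H (s, 0) = a 0" if "s \<in> {0..1}" for s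
        using h(4)[of "2 * s - 1"] that P01 by (auto simp: H_def)
      show "H (0, u) = a' u" if "u \<in> {0..1}" for u using Pv[of "u / 2"] that by (simp add: H_def)
      show "H (1, u) = b' u" if "u \<in> {0..1}" for u using h(3)[OF that] by (simp add: H_def)
      show "dist (H (s, 1)) (H (u, 1)) \<le> L (min (2 * u) 1) - L (min (2 * s) 1)" if "0 \<le> s" "s \<le> u" "u \<le> 1" for s u
      proof -
        have "dist (c (min (2 * s) 1)) (c (min (2 * u) 1)) \<le> L (min (2 * u) 1) - L (min (2 * s) 1)"
          by (rule c(5)) (use that in auto)
        then show ?thesis using H1[of s] H1[of u] that by simp
      qed
      show "L (min (2 * 1) 1) - L (min (2 * 0) 1) \<le> K + 1" using c(4) K[OF T] by simp
    qed (use a' b' n in auto)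
    moreover have "1 / real n * T = t" using n by (simp add: T_def)
    ultimately show ?thesis by (simp add: a'_def b'_def)
  qed
  have "(\<lambda>n. (K + 1) / real n) \<longlonglongrightarrow> 0" by (rule lim_const_over_n)
  moreover have "\<exists>N. \<forall>n\<ge>N. dist (a t) (b t) \<le> (K + 1) / real n" using le by (intro exI[of _ 1]) auto
  ultimately have "dist (a t) (b t) \<le> 0" by (rule LIMSEQ_le_const)
  then show ?thesis by simp
qed

text \<open>The only place where a Hadamard manifold has to provide the properties of a metric space that the
preceding argument uses.\<close>

theorem hadamard_asymptotic_rays_coincide:
  fixes A :: "('a::metric_space, 'e::euclidean_space) chart set" and a b :: "real \<Rightarrow> 'a"
  assumes H: "hadamard_manifold A g" and ab: "(a, b) \<in> asymptotic" "a 0 = b 0" and t: "0 \<le> t"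
  shows "a t = b t"
proof -
  interpret riemannian_space A g
    using H unfolding hadamard_manifold_def by unfold_locales blast+
  have sc: "simply_connected (UNIV :: 'a set)" and complete: "complete (UNIV :: 'a set)"
    using H unfolding hadamard_manifold_def by blast+
  have curv: "sectional_curvature (g k) x u v \<le> 0"
    if "k \<in> A" "x \<in> snd k ` fst k" "u \<noteq> v" "independent {u, v}" for k x u v
    using H that unfolding hadamard_manifold_def by blast
  have conn: "connected (UNIV :: 'a set)" by (rule simply_connected_connected[OF sc])
  obtain K where K: "geodesic_ray a" "geodesic_ray b" "\<forall>t\<ge>0. dist (a t) (b t) \<le> K"
    using ab(1) unfolding asymptotic_def by blast
  show ?thesis
  proof (rule bounded_rays_coincide[OF _ _ _ sc K(1,2) ab(2) _ t])
    show almost: "\<exists>c L. almost_geodesic c L p q e" if "0 < e" for p q :: 'a and e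
      by (rule ex_almost_geodesic[OF conn that])
    show "compact (cball p R)" for p :: 'a and R
      by (rule Hopf_Rinow[OF complete almost locally_compact])
    show "\<exists>r>0. Busemann_convex (ball q r)" for q :: 'a
      by (rule locally_Busemann_convex[OF conn curv])
    show "dist (a t) (b t) \<le> K" if "0 \<le> t" for t using K(3) that by blast
  qed
qed

section \<open>Busemann functions\<close>

text \<open>The function is decreasing and bounded below, by the triangle inequality.\<close>

lemma Busemann_limit_exists:
  assumes s: "geodesic_ray s"
  shows "\<exists>l. ((\<lambda>t. dist x (s t) - t) \<longlongrightarrow> l) at_top"
proof -
  let ?f = "\<lambda>t. dist x (s t) - t"
  have d: "dist (s u) (s v) = v - u" if "0 \<le> u" "u \<le> v" for u v
    using s that unfolding geodesic_ray_def by auto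
  have mono: "?f v \<le> ?f u" if "0 \<le> u" "u \<le> v" for u v
    using d[OF that] dist_triangle[of x "s v" "s u"] by linarith
  have low: "- dist x (s 0) \<le> ?f v" if "0 \<le> v" for v
    using d[of 0 v] that dist_triangle[of "s 0" "s v" x] by (simp add: dist_commute)
  have bdd: "bdd_below (?f ` {0..})" by (rule bdd_belowI2[of _ "- dist x (s 0)"]) (use low in simp)
  let ?l = "INF t\<in>{0..}. ?f t"
  have "(?f \<longlongrightarrow> ?l) at_top"
  proof (rule decreasing_tendsto)
    show "\<forall>\<^sub>F t in at_top. ?l \<le> ?f t"
      using eventually_ge_at_top[of 0] by eventually_elim (auto intro!: cINF_lower[OF bdd])
    fix y assume "?l < y"
    then obtain u where u: "0 \<le> u" "?f u < y" using cINF_less_iff[OF _ bdd] by auto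
    show "\<forall>\<^sub>F t in at_top. ?f t < y"
      using eventually_ge_at_top[of u] by eventually_elim (use mono[OF u(1)] u(2) in force)
  qed
  then show ?thesis by blast
qed

text \<open>Along the ray \<open>a\<close> itself the difference of distances would be at least \<open>t0 - c\<close>. Replacing \<open>a t\<close> by \<open>s t\<close>
in both distances costs \<open>2 * K\<close>.\<close>

lemma Busemann_lower_bound:
  assumes a: "geodesic_ray a" "0 \<le> t0" and s: "geodesic_ray s"
    and K: "\<And>t. 0 \<le> t \<Longrightarrow> dist (a t) (s t) \<le> K" and y: "dist y (a t0) \<le> c"
  shows "t0 - c - 2 * K \<le> Lim at_top (\<lambda>t. dist (a 0) (s t) - dist y (s t))"
proof -
  obtain l1 l2 where "((\<lambda>t. dist (a 0) (s t) - t) \<longlongrightarrow> l1) at_top" "((\<lambda>t. dist y (s t) - t) \<longlongrightarrow> l2) at_top"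
    using Busemann_limit_exists[OF s] by meson
  then have "((\<lambda>t. (dist (a 0) (s t) - t) - (dist y (s t) - t)) \<longlongrightarrow> l1 - l2) at_top" by (rule tendsto_diff)
  then have lim: "((\<lambda>t. dist (a 0) (s t) - dist y (s t)) \<longlongrightarrow> l1 - l2) at_top" by simp
  have "\<forall>\<^sub>F t in at_top. t0 - c - 2 * K \<le> dist (a 0) (s t) - dist y (s t)"
    using eventually_ge_at_top[of t0]
  proof eventually_elim
    case (elim t)
    then have t: "0 \<le> t" using a(2) by simp
    have "dist (a 0) (a t) = t" "dist (a t0) (a t) = t - t0" using a elim t unfolding geodesic_ray_def by auto
    moreover have "dist (a 0) (a t) \<le> dist (a 0) (s t) + dist (a t) (s t)" by (rule dist_triangle2)
    moreover have "dist y (s t) \<le> dist y (a t0) + (dist (a t0) (a t) + dist (a t) (s t))"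
      by (rule order_trans[OF dist_triangle add_left_mono[OF dist_triangle]])
    ultimately show ?case using K[OF t] y by linarith
  qed
  then have "t0 - c - 2 * K \<le> l1 - l2"
    by (rule tendsto_lowerbound[OF lim]) (rule trivial_limit_at_top_linorder)
  moreover have "Lim at_top (\<lambda>t. dist (a 0) (s t) - dist y (s t)) = l1 - l2"
    by (rule tendsto_Lim[OF trivial_limit_at_top_linorder lim])
  ultimately show ?thesis by simp
qed

section \<open>Atoms of conformal densities\<close>

lemma openin_boundary_subset: "openin boundary_topology U \<Longrightarrow> U \<subseteq> geometric_boundary"
  using openin_subset[of boundary_topology U]
  unfolding boundary_topology_def topspace_pullback_topology by blast

lemma openin_boundary_borel: "openin boundary_topology U \<Longrightarrow> U \<in> sets boundary_borel"
  unfolding boundary_borel_def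
  by (subst sets_measure_of) (use openin_boundary_subset in blast)+

lemma AE_at_atom:
  assumes "AE x in M. P x" "emeasure M {y} \<noteq> 0"
  shows "P y"
proof (rule ccontr)
  assume nP: "\<not> P y"
  have y: "{y} \<in> sets M" using assms(2) emeasure_notin_sets by blast
  obtain N where N: "{x \<in> space M. \<not> P x} \<subseteq> N" "emeasure M N = 0" "N \<in> sets M" using AE_E[OF assms(1)] .
  have "y \<in> space M" using sets.sets_into_space[OF y] by blast
  then have "{y} \<subseteq> N" using N(1) nP by blast
  then have "emeasure M {y} \<le> emeasure M N" using N(3) by (rule emeasure_mono)
  then show False using N(2) assms(2) by simp
qed

lemma emeasure_RN_deriv_atom:
  assumes M: "finite_measure M" and N: "absolutely_continuous M N" "sets N = sets M"
    and y: "{y} \<in> sets M"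
  shows "emeasure N {y} = RN_deriv M N y * emeasure M {y}"
proof -
  interpret finite_measure M by (rule M)
  have "emeasure N {y} = emeasure (density M (RN_deriv M N)) {y}" by (simp add: density_RN_deriv[OF N])
  also have "\<dots> = (\<integral>\<^sup>+x. RN_deriv M N x * indicator {y} x \<partial>M)"
    by (rule emeasure_density[OF borel_measurable_RN_deriv y])
  also have "\<dots> = RN_deriv M N y * emeasure M {y}" by (rule nn_integral_indicator_singleton[OF y])
  finally show ?thesis .
qed

text \<open>The function \<open>f\<close> is arbitrary: if the masses of preimages under \<open>f\<close> do not form a measure, \<open>distr\<close> is the
zero measure. The action of an isometry on the boundary can thus be treated without a discussion of its
measurability.\<close>

lemma emeasure_distr_le: "emeasure (distr M N f) A \<le> emeasure M (space M)"
  unfolding distr_def emeasure_measure_of_conv by (simp add: emeasure_space)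

text \<open>An atom lies in the support and is not negligible, so the formula for the density, which holds almost
everywhere, holds at it.\<close>

lemma conformal_density_atom:
  assumes \<mu>: "conformal_density \<Gamma> x0 \<delta> \<mu>" and \<eta>: "\<eta> \<in> geometric_boundary" "emeasure (\<mu> x0) {\<eta>} \<noteq> 0"
  shows "emeasure (\<mu> x) {\<eta>} = ennreal (exp (\<delta> * busemann \<eta> x0 x)) * emeasure (\<mu> x0) {\<eta>}"
proof -
  have sets: "sets (\<mu> x) = sets boundary_borel" "finite_measure (\<mu> x)" for x
    using \<mu> unfolding conformal_density_def by blast+
  have ac: "absolutely_continuous (\<mu> x0) (\<mu> x)"
    and ae: "AE \<eta> in \<mu> x0. \<eta> \<in> boundary_support (\<mu> x0) \<longrightarrow>
           RN_deriv (\<mu> x0) (\<mu> x) \<eta> = ennreal (exp (\<delta> * busemann \<eta> x0 x))"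
    using \<mu> unfolding conformal_density_def by blast+
  have m: "{\<eta>} \<in> sets (\<mu> x0)" using \<eta>(2) emeasure_notin_sets by blast
  have "emeasure (\<mu> x0) U > 0" if "openin boundary_topology U" "\<eta> \<in> U" for U
  proof -
    have "emeasure (\<mu> x0) {\<eta>} \<le> emeasure (\<mu> x0) U"
      using that openin_boundary_borel sets by (intro emeasure_mono) auto
    moreover have "0 < emeasure (\<mu> x0) {\<eta>}" using \<eta>(2) by (simp add: zero_less_iff_neq_zero)
    ultimately show ?thesis by (rule order.strict_trans2[rotated])
  qed
  then have "\<eta> \<in> boundary_support (\<mu> x0)" using \<eta>(1) unfolding boundary_support_def by blast
  then have "RN_deriv (\<mu> x0) (\<mu> x) \<eta> = ennreal (exp (\<delta> * busemann \<eta> x0 x))"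
    using AE_at_atom[OF ae \<eta>(2)] by blast
  then show ?thesis using emeasure_RN_deriv_atom[OF sets(2) ac _ m] sets by simp
qed

theorem proposition5:
  fixes A :: "('a::metric_space, 'e::euclidean_space) chart set"
    and g :: "('a, 'e) chart \<Rightarrow> 'e \<Rightarrow> 'e \<Rightarrow> 'e \<Rightarrow> real"
    and \<Gamma> :: "('a \<Rightarrow> 'a) set"
    and h :: "'a \<Rightarrow> 'a"
    and x0 :: 'a
    and \<delta> :: real
    and \<mu> :: "'a \<Rightarrow> 'a ideal_point measure"
  assumes "hadamard_manifold A g"
    and "discrete_isometry_group \<Gamma>"
    and "non_elementary \<Gamma> x0"
    and "h \<in> \<Gamma>" and "rank_one_isometry h" and "x0 \<in> axial_set h"
    and "\<delta> > 0"
    and "conformal_density \<Gamma> x0 \<delta> \<mu>"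
  shows "\<forall>\<eta> \<in> radial_limit_set \<Gamma> x0. emeasure (\<mu> x0) {\<eta>} = 0"
proof (intro ballI, rule ccontr)
  fix \<eta> assume \<eta>: "\<eta> \<in> radial_limit_set \<Gamma> x0" and pos: "emeasure (\<mu> x0) {\<eta>} \<noteq> 0"
  note H = assms(1) and \<delta> = assms(7) and \<mu> = assms(8)
  obtain c where c: "c > 0" "\<eta> \<in> radial_limit_set_within \<Gamma> x0 c"
    using \<eta> unfolding radial_limit_set_def by auto
  have approach: "\<exists>\<gamma> \<tau> t. \<gamma> \<in> \<Gamma> \<and> R < dist x0 (\<gamma> x0) \<and> geodesic_ray \<tau> \<and> \<tau> 0 = x0 \<and> \<eta> = ray_endpoint \<tau> \<and>
      0 \<le> t \<and> dist (\<gamma> x0) (\<tau> t) < c" if R: "R > 0" for R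
  proof -
    obtain \<gamma> where \<gamma>: "\<gamma> \<in> \<Gamma>" "R < dist x0 (\<gamma> x0)" "\<eta> \<in> shadow x0 (ball (\<gamma> x0) c)"
      using c(2) R unfolding radial_limit_set_within_def by auto
    then show ?thesis unfolding shadow_def by (auto simp: mem_ball)
  qed
  obtain \<tau>1 where \<tau>1: "geodesic_ray \<tau>1" "\<tau>1 0 = x0" "\<eta> = ray_endpoint \<tau>1" using approach[of 1] by auto
  have refl: "(\<tau>, \<tau>) \<in> asymptotic" if "geodesic_ray \<tau>" for \<tau> :: "real \<Rightarrow> 'a"
    using that unfolding asymptotic_def by (auto intro!: exI[of _ 0])
  have boundary: "\<eta> \<in> geometric_boundary"
    unfolding geometric_boundary_def \<tau>1(3) ray_endpoint_def using \<tau>1(1) by (intro quotientI) simp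
  \<comment> \<open>The ray by which the Busemann function of \<open>\<eta>\<close> is computed.\<close>
  define \<sigma> where "\<sigma> = (SOME \<sigma>. \<sigma> \<in> \<eta>)"
  have "\<tau>1 \<in> \<eta>" using refl[OF \<tau>1(1)] by (simp add: \<tau>1(3) ray_endpoint_def)
  then have "\<sigma> \<in> \<eta>" unfolding \<sigma>_def by (rule someI[of "\<lambda>\<sigma>. \<sigma> \<in> \<eta>"])
  then have "(\<tau>1, \<sigma>) \<in> asymptotic" by (simp add: \<tau>1(3) ray_endpoint_def)
  then obtain K where \<sigma>: "geodesic_ray \<sigma>" and K: "\<And>t. 0 \<le> t \<Longrightarrow> dist (\<tau>1 t) (\<sigma> t) \<le> K"
    unfolding asymptotic_def by blast
  have K0: "0 \<le> K" using K[of 0] order_trans[OF zero_le_dist] by blast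
  \<comment> \<open>The ray \<open>\<tau>\<close> that passes near \<open>\<gamma> x0\<close> depends on \<open>\<gamma>\<close>, but it coincides with \<open>\<tau>1\<close>. Hence one constant \<open>K\<close>
       serves for all \<open>\<gamma>\<close>.\<close>
  have large: "\<exists>\<gamma>\<in>\<Gamma>. R - 2 * c - 2 * K \<le> busemann \<eta> x0 (\<gamma> x0)" if R: "R > 0" for R
  proof -
    obtain \<gamma> \<tau> t where \<gamma>: "\<gamma> \<in> \<Gamma>" "R < dist x0 (\<gamma> x0)" "geodesic_ray \<tau>" "\<tau> 0 = x0" "\<eta> = ray_endpoint \<tau>"
      "0 \<le> t" "dist (\<gamma> x0) (\<tau> t) < c" using approach[OF R] by blast
    have "\<tau>1 \<in> asymptotic `` {\<tau>}" using \<open>\<tau>1 \<in> \<eta>\<close> \<gamma>(5) by (simp add: ray_endpoint_def)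
    then have "\<tau> t = \<tau>1 t"
      using hadamard_asymptotic_rays_coincide[OF H, of \<tau> \<tau>1 t] \<gamma>(4,6) \<tau>1(2) by simp
    then have near: "dist (\<gamma> x0) (\<tau>1 t) \<le> c" using \<gamma>(7) by simp
    have "dist x0 (\<tau>1 t) = t" using \<tau>1(1,2) \<gamma>(6) unfolding geodesic_ray_def by force
    then have "R - c \<le> t" using \<gamma>(2) near dist_triangle[of x0 "\<gamma> x0" "\<tau>1 t"] by (simp add: dist_commute)
    moreover have "t - c - 2 * K \<le> busemann \<eta> x0 (\<gamma> x0)"
      using Busemann_lower_bound[OF \<tau>1(1) \<gamma>(6) \<sigma> K near] \<tau>1(2)
      unfolding busemann_def \<sigma>_def[symmetric] Let_def by simp
    ultimately show ?thesis using \<gamma>(1) by (intro bexI[of _ \<gamma>]) auto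
  qed
  have fin: "finite_measure (\<mu> x0)" using \<mu> unfolding conformal_density_def by blast
  then interpret finite_measure "\<mu> x0" .
  define m where "m = measure (\<mu> x0) {\<eta>}"
  define B where "B = measure (\<mu> x0) (space (\<mu> x0))"
  have em: "emeasure (\<mu> x0) {\<eta>} = ennreal m" and eB: "emeasure (\<mu> x0) (space (\<mu> x0)) = ennreal B"
    by (simp_all add: m_def B_def emeasure_eq_measure)
  have m: "m > 0" using pos em by (metis ennreal_eq_0_iff not_less)
  have B: "B \<ge> 0" by (simp add: B_def)
  \<comment> \<open>For an orbit point at this distance the atom would have more than the total mass \<open>B\<close>.\<close>
  define R where "R = B / m / \<delta> + 2 * c + 2 * K"
  have "0 \<le> B / m / \<delta>" using B m \<delta> by simp
  then have "R > 0" using c(1) K0 by (simp add: R_def)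
  then obtain \<gamma> where \<gamma>: "\<gamma> \<in> \<Gamma>" "R - 2 * c - 2 * K \<le> busemann \<eta> x0 (\<gamma> x0)" using large by blast
  have "B / m = \<delta> * (R - 2 * c - 2 * K)" using \<delta> by (simp add: R_def)
  also have "\<dots> \<le> \<delta> * busemann \<eta> x0 (\<gamma> x0)" using \<gamma>(2) \<delta> by (intro mult_left_mono) auto
  finally have "1 + B / m \<le> exp (\<delta> * busemann \<eta> x0 (\<gamma> x0))"
    using exp_ge_add_one_self[of "\<delta> * busemann \<eta> x0 (\<gamma> x0)"] by linarith
  then have "(1 + B / m) * m \<le> exp (\<delta> * busemann \<eta> x0 (\<gamma> x0)) * m" using m by (intro mult_right_mono) auto
  then have "B < exp (\<delta> * busemann \<eta> x0 (\<gamma> x0)) * m" using m by (simp add: distrib_right)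
  moreover have "ennreal (exp (\<delta> * busemann \<eta> x0 (\<gamma> x0)) * m) \<le> ennreal B"
  proof -
    have "distr (\<mu> x0) boundary_borel (boundary_action \<gamma>) = \<mu> (\<gamma> x0)"
      using \<mu> \<gamma>(1) unfolding conformal_density_def by blast
    then have "emeasure (\<mu> (\<gamma> x0)) {\<eta>} \<le> ennreal B"
      using emeasure_distr_le[of "\<mu> x0" boundary_borel "boundary_action \<gamma>" "{\<eta>}"] eB by simp
    then show ?thesis
      unfolding conformal_density_atom[OF \<mu> boundary pos, of "\<gamma> x0"] em using m by (simp add: ennreal_mult)
  qed
  ultimately show False using B by (simp add: ennreal_le_iff)
qed

end
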